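(* Let $X$ and $Y$ be finite $T_0$ topological spaces and let $f,g:X\to Y$ be continuous maps, where $f$ is a Vietoris-like map. Then $\Lambda(g_*\circ f_*^{-1})$ is defined (that is, $f_*:H_*(X)\to H_*(Y)$ is invertible, so that $g_*\circ f_*^{-1}:H_*(Y)\to H_*(Y)$ makes sense), and if $\Lambda(g_*\circ f_*^{-1})\neq 0$, then there exists $x\in X$ such that $f(x)=g(x)$.
   Context: A finite $T_0$ topological space is identified with a finite poset: $x\le y$ iff $U_x\subseteq U_y$, where $U_x$ is the intersection of all open sets containing $x$ (so the open sets are the lower sets); continuous maps are exactly the order-preserving maps. $H_*$ is singular homology with integer coefficients. A space is acyclic if its homology groups are isomorphic to those of a point. A continuous map $f:X\to Y$ between finite $T_0$ spaces is called a Vietoris-like map if for every chain $y_1<y_2<\dots<y_n$ in $Y$ ($n\ge 1$) the subspace $\bigcup_{i=1}^n f^{-1}(y_i)$ of $X$ is acyclic. For a degree-preserving endomorphism $\varphi$ of the homology groups $H_*(Y)$, the Lefschetz number is $\Lambda(\varphi)=\sum_{i\ge 0}(-1)^i\,\mathrm{tr}(\varphi_i)$, where $\mathrm{tr}(\varphi_i)$ is the trace of the linear map induced by $\varphi$ on the torsion-free part of $H_i(Y)$. *)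

theory Defs
  imports "HOL-Analysis.Analysis" "HOL-Homology.Homology"
begin

section \<open>Finite spaces as posets\<close>

definition min_open :: "'a topology \<Rightarrow> 'a \<Rightarrow> 'a set" where
  "min_open X x = \<Inter> {U. openin X U \<and> x \<in> U}"

definition space_le :: "'a topology \<Rightarrow> 'a \<Rightarrow> 'a \<Rightarrow> bool" where
  "space_le X x y \<longleftrightarrow> x \<in> topspace X \<and> y \<in> topspace X \<and> min_open X x \<subseteq> min_open X y"

definition space_less :: "'a topology \<Rightarrow> 'a \<Rightarrow> 'a \<Rightarrow> bool" where
  "space_less X x y \<longleftrightarrow> space_le X x y \<and> x \<noteq> y"

text \<open>A chain \<open>y\<^sub>1 < \<dots> < y\<^sub>n\<close> with \<open>n \<ge> 1\<close> is represented as the list of its elements.\<close>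

definition space_chain :: "'a topology \<Rightarrow> 'a list \<Rightarrow> bool" where
  "space_chain X ys \<longleftrightarrow> ys \<noteq> [] \<and> set ys \<subseteq> topspace X \<and> sorted_wrt (space_less X) ys"

section \<open>Vietoris-like maps\<close>

definition acyclic_space :: "'a topology \<Rightarrow> bool" where
  "acyclic_space X \<longleftrightarrow>
     (\<forall>p. homology_group p X \<cong> homology_group p (discrete_topology {()}))"

definition vietoris_like_map :: "'a topology \<Rightarrow> 'b topology \<Rightarrow> ('a \<Rightarrow> 'b) \<Rightarrow> bool" where
  "vietoris_like_map X Y f \<longleftrightarrow> continuous_map X Y f \<and>
     (\<forall>ys. space_chain Y ys \<longrightarrow>
        acyclic_space (subtopology X (\<Union>y\<in>set ys. {x \<in> topspace X. f x = y})))"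

abbreviation homology_map ::
    "int \<Rightarrow> 'a topology \<Rightarrow> 'b topology \<Rightarrow> ('a \<Rightarrow> 'b) \<Rightarrow> 'a chain set \<Rightarrow> 'b chain set" where
  "homology_map p X Y f \<equiv> hom_induced p X {} Y {} f"

section \<open>Traces and the Lefschetz number\<close>

text \<open>Groups are written multiplicatively, as in \<^theory>\<open>HOL-Algebra.Group\<close>.\<close>

definition torsion_set :: "('a, 'm) monoid_scheme \<Rightarrow> 'a set" where
  "torsion_set G = {x \<in> carrier G. \<exists>n::nat. n > 0 \<and> x [^]\<^bsub>G\<^esub> n = \<one>\<^bsub>G\<^esub>}"

definition torsion_free_part :: "('a, 'm) monoid_scheme \<Rightarrow> 'a set monoid" where
  "torsion_free_part G = G Mod torsion_set G"

text \<open>The map induced on cosets, \<open>T x \<mapsto> T \<phi>(x)\<close>; the formula avoids choosing a representative.\<close>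

definition torsion_free_map ::
    "('a, 'm) monoid_scheme \<Rightarrow> ('a \<Rightarrow> 'a) \<Rightarrow> 'a set \<Rightarrow> 'a set" where
  "torsion_free_map G \<phi> C = torsion_set G <#>\<^bsub>G\<^esub> (\<phi> ` C)"

text \<open>An isomorphism from the free abelian group on \<open>{..<n}\<close> is an ordered basis; \<open>basis_trace\<close> is the
  sum of the diagonal entries of the matrix of \<open>\<psi>\<close> in that basis.\<close>

definition basis_trace ::
    "('a, 'm) monoid_scheme \<Rightarrow> nat \<Rightarrow> ((nat \<Rightarrow>\<^sub>0 int) \<Rightarrow> 'a) \<Rightarrow> ('a \<Rightarrow> 'a) \<Rightarrow> int" where
  "basis_trace F n h \<psi> =
     (\<Sum>i<n. Poly_Mapping.lookup
        (inv_into (carrier (free_Abelian_group {..<n})) h (\<psi> (h (frag_of i)))) i)"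

text \<open>The trace of an endomorphism of a free abelian group of finite rank. By the lemma
  \<open>free_trace_eq\<close> below it does not depend on the basis chosen.\<close>

definition free_trace :: "('a, 'm) monoid_scheme \<Rightarrow> ('a \<Rightarrow> 'a) \<Rightarrow> int" where
  "free_trace F \<psi> =
     (let (n, h) = (SOME (n, h). h \<in> iso (free_Abelian_group {..<n}) F)
      in basis_trace F n h \<psi>)"

definition group_trace :: "('a, 'm) monoid_scheme \<Rightarrow> ('a \<Rightarrow> 'a) \<Rightarrow> int" where
  "group_trace G \<phi> = free_trace (torsion_free_part G) (torsion_free_map G \<phi>)"

text \<open>\<open>Sum_any\<close> sums the nonzero terms; for a finite space only finitely many are nonzero, since the
  homology vanishes above the height of the poset.\<close>

definition lefschetz_number :: "'a topology \<Rightarrow> (int \<Rightarrow> 'a chain set \<Rightarrow> 'a chain set) \<Rightarrow> int" where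
  "lefschetz_number Y \<phi> =
     Sum_any (\<lambda>i::nat. (- 1) ^ i * group_trace (homology_group (int i) Y) (\<phi> (int i)))"

section \<open>Independence of the basis\<close>

lemma lookup_hom_free_Abelian_group:
  fixes \<theta> :: "(nat \<Rightarrow>\<^sub>0 int) \<Rightarrow> (nat \<Rightarrow>\<^sub>0 int)"
  assumes \<theta>: "\<theta> \<in> hom (free_Abelian_group {..<m}) (free_Abelian_group {..<n})"
    and x: "x \<in> carrier (free_Abelian_group {..<m})"
  shows "Poly_Mapping.lookup (\<theta> x) i =
    (\<Sum>j<m. Poly_Mapping.lookup x j * Poly_Mapping.lookup (\<theta> (frag_of j)) i)"
proof -
  interpret \<theta>: group_hom "free_Abelian_group {..<m}" "free_Abelian_group {..<n}" \<theta>
    using \<theta> by (simp add: group_hom_def group_hom_axioms_def)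
  let ?P = "\<lambda>x. Poly_Mapping.lookup (\<theta> x) i =
    (\<Sum>j<m. Poly_Mapping.lookup x j * Poly_Mapping.lookup (\<theta> (frag_of j)) i)"
  have "Poly_Mapping.keys x \<subseteq> {..<m}"
    using x by simp
  then show "?P x"
  proof (rule free_Abelian_group_induct)
    show "?P 0"
      using \<theta>.hom_one by simp
  next
    fix a b
    assume ab: "Poly_Mapping.keys a \<subseteq> {..<m}" "Poly_Mapping.keys b \<subseteq> {..<m}" "?P a" "?P b"
    have "\<theta> (a - b) = \<theta> a - \<theta> b"
      using hom_frag_diff[OF \<theta>, of a b] ab by simp
    then show "?P (a - b)"
      using ab by (simp add: lookup_minus left_diff_distrib sum_subtractf)
  next
    fix j assume j: "j \<in> {..<m}"
    have "(\<Sum>k<m. Poly_Mapping.lookup (frag_of j) k * Poly_Mapping.lookup (\<theta> (frag_of k)) i)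
        = (\<Sum>k<m. if k = j then Poly_Mapping.lookup (\<theta> (frag_of k)) i else 0)"
      by (intro sum.cong) auto
    then show "?P (frag_of j)"
      using j by simp
  qed
qed

lemma basis_trace_eq:
  assumes F: "group F" and \<psi>: "\<psi> \<in> hom F F"
    and h: "h \<in> iso (free_Abelian_group {..<m}) F"
    and k: "k \<in> iso (free_Abelian_group {..<n}) F"
  shows "basis_trace F m h \<psi> = basis_trace F n k \<psi>"
proof -
  let ?M = "free_Abelian_group {..<m}" and ?N = "free_Abelian_group {..<n}"
  define h' where "h' = inv_into (carrier ?M) h"
  define k' where "k' = inv_into (carrier ?N) k"
  have h'h: "h' (h x) = x" if "x \<in> carrier ?M" for x
    using h that by (simp add: h'_def iso_def bij_betw_def)
  have k'k: "k' (k x) = x" if "x \<in> carrier ?N" for x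
    using k that by (simp add: k'_def iso_def bij_betw_def)
  have hh': "h (h' y) = y" if "y \<in> carrier F" for y
    using h that unfolding h'_def iso_def by (auto intro: bij_betw_inv_into_right)
  have kk': "k (k' y) = y" if "y \<in> carrier F" for y
    using k that unfolding k'_def iso_def by (auto intro: bij_betw_inv_into_right)
  have hh: "h \<in> hom ?M F" and kh: "k \<in> hom ?N F"
    using h k by (auto simp: iso_def)
  have h'm: "h' \<in> hom F ?M" and k'm: "k' \<in> hom F ?N"
    using group.iso_set_sym[OF group_free_Abelian_group h]
      group.iso_set_sym[OF group_free_Abelian_group k]
    by (auto simp: iso_def h'_def k'_def)
  have fM: "frag_of i \<in> carrier ?M" if "i < m" for i
    using that by simp
  have fN: "frag_of i \<in> carrier ?N" if "i < n" for i
    using that by simp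
  define A where "A = k' \<circ> h"
  define B where "B = h' \<circ> k"
  define P where "P = k' \<circ> \<psi> \<circ> k"
  have A: "A \<in> hom ?M ?N" and B: "B \<in> hom ?N ?M" and P: "P \<in> hom ?N ?N"
    unfolding A_def B_def P_def
    using hh kh h'm k'm \<psi> by (metis hom_compose)+
  let ?l = "Poly_Mapping.lookup :: (nat \<Rightarrow>\<^sub>0 int) \<Rightarrow> nat \<Rightarrow> int"
  have "basis_trace F m h \<psi> = (\<Sum>i<m. ?l (B (P (A (frag_of i)))) i)"
    unfolding basis_trace_def h'_def[symmetric]
  proof (intro sum.cong refl)
    fix i assume "i \<in> {..<m}"
    then have "h (frag_of i) \<in> carrier F"
      using hom_in_carrier[OF hh] fM by auto
    moreover have "\<psi> y \<in> carrier F" if "y \<in> carrier F" for y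
      using hom_in_carrier[OF \<psi> that] .
    ultimately show "?l (h' (\<psi> (h (frag_of i)))) i = ?l (B (P (A (frag_of i)))) i"
      by (simp add: A_def B_def P_def kk')
  qed
  also have "\<dots> = (\<Sum>i<m. \<Sum>j<n. ?l (A (frag_of i)) j * (\<Sum>l<n. ?l (P (frag_of j)) l * ?l (B (frag_of l)) i))"
  proof (intro sum.cong refl)
    fix i assume i: "i \<in> {..<m}"
    then have Ai: "A (frag_of i) \<in> carrier ?N"
      using hom_in_carrier[OF A] fM by auto
    have "?l ((B \<circ> P) (A (frag_of i))) i
        = (\<Sum>j<n. ?l (A (frag_of i)) j * ?l ((B \<circ> P) (frag_of j)) i)"
      by (rule lookup_hom_free_Abelian_group[OF hom_compose[OF P B] Ai])
    also have "\<dots> = (\<Sum>j<n. ?l (A (frag_of i)) j * (\<Sum>l<n. ?l (P (frag_of j)) l * ?l (B (frag_of l)) i))"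
    proof (intro sum.cong refl)
      fix j assume "j \<in> {..<n}"
      then have "P (frag_of j) \<in> carrier ?N"
        using hom_in_carrier[OF P] fN by auto
      from lookup_hom_free_Abelian_group[OF B this, of i]
      show "?l (A (frag_of i)) j * ?l ((B \<circ> P) (frag_of j)) i =
          ?l (A (frag_of i)) j * (\<Sum>l<n. ?l (P (frag_of j)) l * ?l (B (frag_of l)) i)"
        by simp
    qed
    finally show "?l (B (P (A (frag_of i)))) i =
        (\<Sum>j<n. ?l (A (frag_of i)) j * (\<Sum>l<n. ?l (P (frag_of j)) l * ?l (B (frag_of l)) i))"
      by simp
  qed
  also have "\<dots> = (\<Sum>i<m. \<Sum>j<n. \<Sum>l<n. ?l (P (frag_of j)) l * (?l (B (frag_of l)) i * ?l (A (frag_of i)) j))"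
    by (simp add: sum_distrib_left mult_ac)
  also have "\<dots> = (\<Sum>j<n. \<Sum>i<m. \<Sum>l<n. ?l (P (frag_of j)) l * (?l (B (frag_of l)) i * ?l (A (frag_of i)) j))"
    by (rule sum.swap)
  also have "\<dots> = (\<Sum>j<n. \<Sum>l<n. \<Sum>i<m. ?l (P (frag_of j)) l * (?l (B (frag_of l)) i * ?l (A (frag_of i)) j))"
    by (intro sum.cong refl sum.swap)
  also have "\<dots> = (\<Sum>j<n. \<Sum>l<n. ?l (P (frag_of j)) l * ?l (A (B (frag_of l))) j)"
  proof (intro sum.cong refl)
    fix j l assume "l \<in> {..<n}"
    then have "B (frag_of l) \<in> carrier ?M"
      using hom_in_carrier[OF B] fN by auto
    from lookup_hom_free_Abelian_group[OF A this, of j]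
    show "(\<Sum>i<m. ?l (P (frag_of j)) l * (?l (B (frag_of l)) i * ?l (A (frag_of i)) j))
        = ?l (P (frag_of j)) l * ?l (A (B (frag_of l))) j"
      by (simp add: sum_distrib_left)
  qed
  also have "\<dots> = (\<Sum>j<n. \<Sum>l<n. if l = j then ?l (P (frag_of j)) l else 0)"
  proof (intro sum.cong refl)
    fix j l assume "l \<in> {..<n}"
    then have "frag_of l \<in> carrier ?N"
      using fN by auto
    moreover from this have "k (frag_of l) \<in> carrier F"
      using hom_in_carrier[OF kh] by auto
    ultimately have "A (B (frag_of l)) = frag_of l"
      by (simp only: A_def B_def o_apply hh' k'k)
    then show "?l (P (frag_of j)) l * ?l (A (B (frag_of l))) j
        = (if l = j then ?l (P (frag_of j)) l else 0)"
      by simp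
  qed
  also have "\<dots> = basis_trace F n k \<psi>"
    by (simp add: basis_trace_def P_def k'_def)
  finally show ?thesis .
qed

lemma free_trace_eq:
  assumes "group F" "\<psi> \<in> hom F F" "h \<in> iso (free_Abelian_group {..<n}) F"
  shows "free_trace F \<psi> = basis_trace F n h \<psi>"
proof -
  define p where "p = (SOME (m, k). k \<in> iso (free_Abelian_group {..<m::nat}) F)"
  have "case p of (m, k) \<Rightarrow> k \<in> iso (free_Abelian_group {..<m}) F"
    unfolding p_def by (rule someI[where x = "(n, h)"]) (simp add: assms)
  then show ?thesis
    using basis_trace_eq[OF assms(1,2) _ assms(3)]
    unfolding free_trace_def p_def[symmetric] Let_def by (cases p) auto
qed

end

theory Submission
  imports Defs
begin

text \<open>
  Let \<open>C(X)\<close> be the chain complex of the order complex of a finite \<open>T\<^sub>0\<close> space \<open>X\<close>: in degree \<open>p\<close> it is free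
  on the chains \<open>x\<^sub>0 < \<dots> < x\<^sub>p\<close>. It is realised here as a subcomplex of the singular complex. The chain
  \<open>x\<^sub>0 < \<dots> < x\<^sub>p\<close> is the singular simplex that takes the value \<open>x\<^sub>i\<close> at \<open>t\<close>, where \<open>i\<close> is the least index with
  \<open>t\<^sub>i \<noteq> 0\<close>; this map is continuous because open sets are lower sets. Being a subcomplex, \<open>C(X)\<close> inherits
  its boundary operator, and it makes sense to compare it with singular chains by asking whether the quotient complex is
  acyclic. It is (\<open>order_chains_suffice_finite\<close>), by induction on the number of points: for a
  maximal element \<open>m\<close>, a Mayer--Vietoris argument reduces \<open>X\<close> to the open sets \<open>X - {m}\<close> and \<open>U\<^sub>m\<close> and their
  intersection, and if \<open>U\<^sub>m = X\<close> then \<open>m\<close> is a maximum and both complexes have the homology of a point.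

  The rest is the method of acyclic carriers. If \<open>f\<close> is Vietoris-like, then the preimage of every chain of
  \<open>Y\<close> is acyclic, so there is a chain map \<open>\<Phi> : C(Y) \<rightarrow> C(X)\<close> that sends each simplex \<open>\<tau>\<close> to chains over
  \<open>f\<^sup>-\<^sup>1(\<tau>)\<close>. A continuous map \<open>h\<close> of finite spaces has a model \<open>H\<close> on order chains that sends \<open>\<sigma>\<close> to chains on
  \<open>h(\<sigma>)\<close>, because the image of a chain is a chain and so has a maximum. Two chain maps with the same acyclic carrier agree on
  homology. Hence \<open>f\<^sub>*\<close> and \<open>\<Phi>\<close> are mutually inverse on homology (\<open>vietoris_transfer\<close>,
  \<open>vietoris_like_map_iso\<close>), and with a model \<open>G\<close> of \<open>g\<close> the endomorphism \<open>g\<^sub>* \<circ> f\<^sub>*\<^sup>-\<^sup>1\<close> is induced by \<open>G \<circ> \<Phi>\<close>.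

  By the Hopf trace formula (\<open>Hopf_trace_formula\<close>, \<open>lefschetz_number_eq_trace\<close>) the Lefschetz number is the
  alternating sum of the traces of \<open>G \<circ> \<Phi>\<close> on the groups \<open>C\<^sub>n(Y)\<close>. If it is nonzero, some simplex \<open>\<sigma>\<close> occurs in
  \<open>G(\<Phi>(\<sigma>))\<close>. Then there is a chain \<open>x\<^sub>0 < \<dots> < x\<^sub>n\<close> in \<open>X\<close> with
  \<open>f(x\<^sub>i) \<in> \<sigma> \<subseteq> {g(x\<^sub>0), \<dots>, g(x\<^sub>n)}\<close> for all \<open>i\<close>, and monotonicity forces \<open>f(x\<^sub>i) = g(x\<^sub>i)\<close> for some \<open>i\<close>
  (\<open>coincidence_on_chain\<close>).

  The trace is taken on homology modulo torsion, and everything stays over the integers: a splitting of the boundary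
  operator, which in general exists only over the rationals, is replaced by a homomorphism \<open>D\<close> with
  \<open>\<partial> \<circ> D \<circ> \<partial> = N \<cdot> \<partial>\<close> for an integer \<open>N \<noteq> 0\<close> (\<open>integral_generalised_inverse\<close>).
\<close>

section \<open>Additive maps on groups of formal sums\<close>

text \<open>
  Subgroups of formal sums are sets closed under differences, and homomorphisms are maps compatible with
  differences. This one condition covers zero, sums and negatives, and it is the shape of the induction rule
  \<open>frag_induction\<close>.
\<close>

definition diff_closed :: "'a::ab_group_add set \<Rightarrow> bool" where
  "diff_closed S \<longleftrightarrow> 0 \<in> S \<and> (\<forall>a\<in>S. \<forall>b\<in>S. a - b \<in> S)"

definition additive_on :: "'a::ab_group_add set \<Rightarrow> ('a \<Rightarrow> 'b::ab_group_add) \<Rightarrow> bool" where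
  "additive_on S f \<longleftrightarrow> (\<forall>a\<in>S. \<forall>b\<in>S. f (a - b) = f a - f b)"

definition frags :: "'k set \<Rightarrow> ('k \<Rightarrow>\<^sub>0 int) set" where
  "frags K = {c. Poly_Mapping.keys c \<subseteq> K}"

lemma diff_closed_UNIV [simp]: "diff_closed UNIV"
  by (simp add: diff_closed_def)

lemma diff_closed_frags [simp]: "diff_closed (frags K)"
  unfolding diff_closed_def frags_def using keys_diff by fastforce

lemma diff_closedD:
  assumes "diff_closed S"
  shows "0 \<in> S" and "a \<in> S \<Longrightarrow> b \<in> S \<Longrightarrow> a - b \<in> S" and "b \<in> S \<Longrightarrow> - b \<in> S"
    and "a \<in> S \<Longrightarrow> b \<in> S \<Longrightarrow> a + b \<in> S"
proof -
  show z: "0 \<in> S" using assms by (simp add: diff_closed_def)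
  show d: "a - b \<in> S" if "a \<in> S" "b \<in> S" for a b
    using assms that by (simp add: diff_closed_def)
  show n: "- b \<in> S" if "b \<in> S" for b using d[OF z that] by simp
  show "a + b \<in> S" if "a \<in> S" "b \<in> S" using d[OF that(1) n[OF that(2)]] by simp
qed

lemma diff_closed_cmul: "diff_closed S \<Longrightarrow> c \<in> S \<Longrightarrow> frag_cmul k c \<in> S"
  by (rule frag_closure_minus_cmul[where P = "\<lambda>c. c \<in> S"]) (auto simp: diff_closed_def)

lemma diff_closed_sum:
  "diff_closed S \<Longrightarrow> (\<And>i. i \<in> I \<Longrightarrow> g i \<in> S) \<Longrightarrow> sum g I \<in> S"
  by (induction I rule: infinite_finite_induct) (auto intro: diff_closedD)

lemma additive_onD:
  assumes "diff_closed S" "additive_on S f"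
  shows "f 0 = 0" and "a \<in> S \<Longrightarrow> b \<in> S \<Longrightarrow> f (a - b) = f a - f b"
    and "b \<in> S \<Longrightarrow> f (- b) = - f b" and "a \<in> S \<Longrightarrow> b \<in> S \<Longrightarrow> f (a + b) = f a + f b"
proof -
  show d: "f (a - b) = f a - f b" if "a \<in> S" "b \<in> S" for a b
    using assms that by (simp add: additive_on_def)
  have S0: "0 \<in> S" by (rule diff_closedD(1)[OF assms(1)])
  show z: "f 0 = 0" using d[OF S0 S0] by simp
  show n: "f (- b) = - f b" if "b \<in> S" for b using d[OF S0 that] z by simp
  show "f (a + b) = f a + f b" if "a \<in> S" "b \<in> S"
    using d[OF that(1) diff_closedD(3)[OF assms(1) that(2)]] n[OF that(2)] by simp
qed

lemma frag_cmul_diff_distrib2: "frag_cmul k (a - b) = frag_cmul k a - frag_cmul k b"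
  by (rule poly_mapping_eqI) (simp add: lookup_minus right_diff_distrib)

lemma additive_on_sum:
  assumes "diff_closed S" "additive_on S f" "\<And>i. i \<in> I \<Longrightarrow> g i \<in> S"
  shows "f (sum g I) = (\<Sum>i\<in>I. f (g i))"
  using assms(3)
proof (induction I rule: infinite_finite_induct)
  case (insert i I)
  have "f (g i + sum g I) = f (g i) + f (sum g I)"
    by (intro additive_onD(4)[OF assms(1,2)] diff_closed_sum[OF assms(1)] insert.prems) auto
  then show ?case using insert by simp
qed (simp_all add: additive_onD[OF assms(1,2)])

text \<open>
  The two instances below have different codomains, integers and formal sums, with no common notion of
  integer multiple. The function \<open>h\<close> stands for \<open>k \<mapsto> k \<cdot> f c\<close> in either of them.
\<close>

lemma additive_on_scale:
  fixes f :: "('k \<Rightarrow>\<^sub>0 int) \<Rightarrow> 'b::ab_group_add" and h :: "int \<Rightarrow> 'b"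
  assumes S: "diff_closed S" and f: "additive_on S f" and c: "c \<in> S"
    and h: "additive_on UNIV h" "h 1 = f c"
  shows "f (frag_cmul k c) = h k"
proof (induction k rule: int_induct[where k = 0])
  case base
  show ?case using additive_onD(1)[OF S f] additive_onD(1)[OF _ h(1)] by simp
next
  case (step1 i)
  then show ?case
    using additive_onD(4)[OF S f diff_closed_cmul[OF S c] c, of i] additive_onD(4)[OF _ h(1), of i 1] h(2)
    by (simp add: frag_cmul_distrib)
next
  case (step2 i)
  then show ?case
    using additive_onD(2)[OF S f diff_closed_cmul[OF S c] c, of i] additive_onD(2)[OF _ h(1), of i 1] h(2)
    by (simp add: frag_cmul_diff_distrib)
qed

lemma additive_on_cmul:
  assumes "diff_closed S" "additive_on S f" "c \<in> S"
  shows "f (frag_cmul k c) = frag_cmul k (f c)"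
  by (rule additive_on_scale[OF assms]) (auto simp: additive_on_def frag_cmul_diff_distrib)

lemma additive_on_cmul_int:
  fixes f :: "('k \<Rightarrow>\<^sub>0 int) \<Rightarrow> int"
  assumes "diff_closed S" "additive_on S f" "c \<in> S"
  shows "f (frag_cmul k c) = k * f c"
  by (rule additive_on_scale[OF assms]) (auto simp: additive_on_def algebra_simps)

lemma frag_of_in_frags [simp]: "frag_of s \<in> frags K \<longleftrightarrow> s \<in> K"
  by (simp add: frags_def)

lemma frags_expansion:
  assumes "finite K" "c \<in> frags K"
  shows "c = (\<Sum>s\<in>K. frag_cmul (Poly_Mapping.lookup c s) (frag_of s))"
proof -
  have "c = (\<Sum>s\<in>Poly_Mapping.keys c. frag_cmul (Poly_Mapping.lookup c s) (frag_of s))"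
    using frag_expansion[of c] by (simp add: frag_extend_def)
  also have "\<dots> = (\<Sum>s\<in>K. frag_cmul (Poly_Mapping.lookup c s) (frag_of s))"
    using assms by (intro sum.mono_neutral_left) (auto simp: frags_def in_keys_iff)
  finally show ?thesis .
qed

lemma additive_on_expansion:
  fixes f :: "('k \<Rightarrow>\<^sub>0 int) \<Rightarrow> ('l \<Rightarrow>\<^sub>0 int)"
  assumes "finite K" "c \<in> frags K" "additive_on (frags K) f"
  shows "f c = (\<Sum>s\<in>K. frag_cmul (Poly_Mapping.lookup c s) (f (frag_of s)))"
proof -
  have "f c = f (\<Sum>s\<in>K. frag_cmul (Poly_Mapping.lookup c s) (frag_of s))"
    using frags_expansion[OF assms(1,2)] by simp
  also have "\<dots> = (\<Sum>s\<in>K. frag_cmul (Poly_Mapping.lookup c s) (f (frag_of s)))"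
    using assms(3)
    by (subst additive_on_sum[where S = "frags K"])
      (auto intro!: sum.cong additive_on_cmul[where S = "frags K"] diff_closed_cmul)
  finally show ?thesis .
qed

lemma additive_on_expansion_int:
  fixes f :: "('k \<Rightarrow>\<^sub>0 int) \<Rightarrow> int"
  assumes "finite K" "c \<in> frags K" "additive_on (frags K) f"
  shows "f c = (\<Sum>s\<in>K. Poly_Mapping.lookup c s * f (frag_of s))"
proof -
  have "f c = f (\<Sum>s\<in>K. frag_cmul (Poly_Mapping.lookup c s) (frag_of s))"
    using frags_expansion[OF assms(1,2)] by simp
  also have "\<dots> = (\<Sum>s\<in>K. Poly_Mapping.lookup c s * f (frag_of s))"
    using assms(3)
    by (subst additive_on_sum[where S = "frags K"])
      (auto intro!: sum.cong additive_on_cmul_int[where S = "frags K"] diff_closed_cmul)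
  finally show ?thesis .
qed

lemma additive_on_subset: "additive_on S f \<Longrightarrow> T \<subseteq> S \<Longrightarrow> additive_on T f"
  by (auto simp: additive_on_def)

lemma additive_on_compose:
  "additive_on S f \<Longrightarrow> additive_on T g \<Longrightarrow> f \<in> S \<rightarrow> T \<Longrightarrow> additive_on S (\<lambda>c. g (f c))"
  by (auto simp: additive_on_def Pi_iff)

section \<open>Traces on finitely generated free groups\<close>

definition matrix_trace :: "'k set \<Rightarrow> (('k \<Rightarrow>\<^sub>0 int) \<Rightarrow> ('k \<Rightarrow>\<^sub>0 int)) \<Rightarrow> int" where
  "matrix_trace K f = (\<Sum>s\<in>K. Poly_Mapping.lookup (f (frag_of s)) s)"

lemma matrix_trace_add: "matrix_trace K (\<lambda>c. f c + g c) = matrix_trace K f + matrix_trace K g"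
  by (simp add: matrix_trace_def lookup_add sum.distrib)

lemma matrix_trace_cmul: "matrix_trace K (\<lambda>c. frag_cmul k (f c)) = k * matrix_trace K f"
  by (simp add: matrix_trace_def sum_distrib_left)

lemma matrix_trace_sum: "matrix_trace K (\<lambda>c. \<Sum>i\<in>I. f i c) = (\<Sum>i\<in>I. matrix_trace K (f i))"
  by (simp add: matrix_trace_def lookup_sum sum.swap[of _ I])

lemma matrix_trace_cong:
  "(\<And>c. c \<in> frags K \<Longrightarrow> f c = g c) \<Longrightarrow> matrix_trace K f = matrix_trace K g"
  unfolding matrix_trace_def by (intro sum.cong refl) simp

lemma matrix_trace_commute:
  assumes K: "finite K" "finite L"
    and f: "f \<in> frags K \<rightarrow> frags L" "additive_on (frags K) f"
    and g: "g \<in> frags L \<rightarrow> frags K" "additive_on (frags L) g"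
  shows "matrix_trace L (\<lambda>c. f (g c)) = matrix_trace K (\<lambda>c. g (f c))"
proof -
  let ?l = Poly_Mapping.lookup
  have "?l (f (g (frag_of t))) t = (\<Sum>s\<in>K. ?l (g (frag_of t)) s * ?l (f (frag_of s)) t)" if "t \<in> L" for t
    using additive_on_expansion[OF K(1) funcset_mem[OF g(1)] f(2), of "frag_of t"] that
    by (simp add: lookup_sum)
  moreover
  have "?l (g (f (frag_of s))) s = (\<Sum>t\<in>L. ?l (f (frag_of s)) t * ?l (g (frag_of t)) s)" if "s \<in> K" for s
    using additive_on_expansion[OF K(2) funcset_mem[OF f(1)] g(2), of "frag_of s"] that
    by (simp add: lookup_sum)
  ultimately show ?thesis
    unfolding matrix_trace_def by (simp add: mult.commute) (rule sum.swap)
qed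

text \<open>
  In the Hopf trace formula, this extracts the contribution of a homology class \<open>v\<close> with its dual functional \<open>l\<close>.
\<close>

lemma matrix_trace_rank_one:
  fixes l :: "('k \<Rightarrow>\<^sub>0 int) \<Rightarrow> int"
  assumes "finite K" "v \<in> frags K" "additive_on (frags K) l"
  shows "matrix_trace K (\<lambda>c. frag_cmul (l c) v) = l v"
  using additive_on_expansion_int[OF assms] by (simp add: matrix_trace_def mult.commute)

section \<open>Subgroups of free abelian groups\<close>

text \<open>
  The image of \<open>f\<close> is a nonzero subgroup of the integers, generated by its least positive element.
\<close>

lemma int_subgroup_generator:
  fixes f :: "'a::ab_group_add \<Rightarrow> int"
  assumes L: "diff_closed L" and f: "additive_on L f" and ne: "\<exists>y\<in>L. f y \<noteq> 0"
  obtains g where "g \<in> L" "f g \<noteq> 0" "\<And>y. y \<in> L \<Longrightarrow> f g dvd f y"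
proof -
  obtain y0 where y0: "y0 \<in> L" "f y0 \<noteq> 0" using ne by blast
  define P where "P n \<longleftrightarrow> n > 0 \<and> (\<exists>y\<in>L. f y = int n)" for n :: nat
  have "\<exists>n. P n"
  proof (cases "f y0 > 0")
    case True
    then show ?thesis unfolding P_def using y0(1) by (intro exI[of _ "nat (f y0)"]) auto
  next
    case False
    then show ?thesis unfolding P_def
      using y0 diff_closedD(3)[OF L y0(1)] additive_onD(3)[OF L f y0(1)]
      by (intro exI[of _ "nat (- f y0)"]) (auto intro!: bexI[of _ "- y0"])
  qed
  then have Pl: "P (LEAST n. P n)" by (rule LeastI_ex)
  define d where "d = (LEAST n. P n)"
  obtain g where g: "g \<in> L" "f g = int d" "d > 0" using Pl unfolding P_def d_def by auto
  have mult: "(\<exists>z\<in>L. f z = f y - int d * k)" if "y \<in> L" for y k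
  proof (induction k rule: int_induct[where k = 0])
    case base
    then show ?case using that by auto
  next
    case (step1 i)
    then obtain z where "z \<in> L" "f z = f y - int d * i" by blast
    then show ?case using g diff_closedD(2)[OF L _ g(1), of z] additive_onD(2)[OF L f _ g(1), of z]
      by (intro bexI[of _ "z - g"]) (auto simp: algebra_simps)
  next
    case (step2 i)
    then obtain z where "z \<in> L" "f z = f y - int d * i" by blast
    then show ?case using g diff_closedD(4)[OF L _ g(1), of z] additive_onD(4)[OF L f _ g(1), of z]
      by (intro bexI[of _ "z + g"]) (auto simp: algebra_simps)
  qed
  have "f g dvd f y" if y: "y \<in> L" for y
  proof (rule ccontr)
    assume nd: "\<not> f g dvd f y"
    obtain z where z: "z \<in> L" "f z = f y - int d * (f y div int d)" using mult[OF y] by blast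
    then have fz: "f z = f y mod int d" by (simp add: minus_mult_div_eq_mod)
    have "f y mod int d \<noteq> 0" using nd g by auto
    have "f y mod int d \<noteq> 0" using nd g by auto
    moreover have "0 \<le> f y mod int d" using g(3) by simp
    ultimately have "0 < f z" using fz by linarith
    then have "P (nat (f z))" unfolding P_def using z(1) by auto
    moreover have "nat (f z) < d" using fz g(3) by (simp add: nat_less_iff)
    ultimately show False unfolding d_def using not_less_Least by blast
  qed
  then show thesis using that[of g] g by auto
qed

text \<open>
  A basis \<open>b\<close> of \<open>L\<close> together with its coordinate functionals \<open>l\<close>, the form in which traces use it.
\<close>

definition dual_bases :: "('k \<Rightarrow>\<^sub>0 int) set \<Rightarrow> nat \<Rightarrow> (nat \<Rightarrow> 'k \<Rightarrow>\<^sub>0 int) \<Rightarrow> (nat \<Rightarrow> ('k \<Rightarrow>\<^sub>0 int) \<Rightarrow> int) \<Rightarrow> bool"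
  where "dual_bases L r b l \<longleftrightarrow>
    (\<forall>i<r. b i \<in> L \<and> additive_on L (l i) \<and> (\<forall>j<r. l i (b j) = (if i = j then 1 else 0))) \<and>
    (\<forall>y\<in>L. y = (\<Sum>i<r. frag_cmul (l i y) (b i)))"

text \<open>
  The induction removes one coordinate \<open>s\<close> of the ambient group: if \<open>s\<close> does not vanish on \<open>L\<close>, then \<open>L\<close> is the direct sum of the subgroup where it vanishes and
  of the multiples of an element \<open>g\<close> whose \<open>s\<close>-coordinate divides all the others.
\<close>

lemma subgroup_of_free_group_basis:
  fixes L :: "('k \<Rightarrow>\<^sub>0 int) set"
  assumes "finite K" "L \<subseteq> frags K" "diff_closed L"
  shows "\<exists>r b l. dual_bases L r b l"
  using assms
proof (induction K arbitrary: L rule: finite_induct)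
    case empty
    then have "y = 0" if "y \<in> L" for y
      using that by (auto simp: frags_def)
    then have "dual_bases L 0 (\<lambda>_. 0) (\<lambda>_ _. 0)" by (auto simp: dual_bases_def)
    then show ?case by blast
  next
    case (insert s K)
    let ?c = "\<lambda>y. Poly_Mapping.lookup y s"
    have cadd: "additive_on T ?c" for T :: "('k \<Rightarrow>\<^sub>0 int) set"
      by (simp add: additive_on_def lookup_minus)
    define L0 where "L0 = {y \<in> L. ?c y = 0}"
    have L0: "L0 \<subseteq> frags K"
      using insert.prems(1) by (auto simp: L0_def frags_def in_keys_iff subset_iff)
    have L0d: "diff_closed L0"
      using insert.prems(2) by (auto simp: diff_closed_def L0_def lookup_minus)
    obtain r b l where B: "dual_bases L0 r b l"
      using insert.IH[OF L0 L0d] by blast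
    then have IH: "\<And>i. i < r \<Longrightarrow> b i \<in> L0" "\<And>i. i < r \<Longrightarrow> additive_on L0 (l i)"
      "\<And>i j. i < r \<Longrightarrow> j < r \<Longrightarrow> l i (b j) = (if i = j then 1 else 0)"
      "\<And>y. y \<in> L0 \<Longrightarrow> y = (\<Sum>i<r. frag_cmul (l i y) (b i))"
      unfolding dual_bases_def by blast+
    show ?case
    proof (cases "\<exists>y\<in>L. ?c y \<noteq> 0")
      case False
      then have "L = L0" by (auto simp: L0_def)
      then show ?thesis using B by blast
    next
      case True
      obtain g where g: "g \<in> L" "?c g \<noteq> 0" "\<And>y. y \<in> L \<Longrightarrow> ?c g dvd ?c y"
        using int_subgroup_generator[OF insert.prems(2) cadd True] by blast
      define m where "m y = ?c y div ?c g" for y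
      have m: "?c y = m y * ?c g" if "y \<in> L" for y
        using g(3)[OF that] by (simp add: m_def)
      have madd: "m (x - y) = m x - m y" if "x \<in> L" "y \<in> L" for x y
      proof -
        have "m (x - y) * ?c g = (m x - m y) * ?c g"
          using m[OF that(1)] m[OF that(2)] m[OF diff_closedD(2)[OF insert.prems(2) that]]
          by (simp add: lookup_minus left_diff_distrib)
        then show ?thesis using g(2) by simp
      qed
      define y0 where "y0 y = y - frag_cmul (m y) g" for y
      have y0: "y0 y \<in> L0" if "y \<in> L" for y
        using that m[OF that] diff_closed_cmul[OF insert.prems(2) g(1)] diff_closedD(2)[OF insert.prems(2)]
        by (auto simp: L0_def y0_def lookup_minus)
      have y0add: "y0 (x - y) = y0 x - y0 y" if "x \<in> L" "y \<in> L" for x y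
        using madd[OF that] by (simp add: y0_def frag_cmul_diff_distrib)
      have m0: "m y = 0" if "y \<in> L0" for y using that by (auto simp: m_def L0_def)
      have mg: "m g = 1" using g(2) by (simp add: m_def)
      have y0g: "y0 g = 0" by (simp add: y0_def mg)
      have y0L0: "y0 y = y" if "y \<in> L0" for y using m0[OF that] by (simp add: y0_def)
      let ?b = "\<lambda>i. if i < r then b i else g"
      let ?l = "\<lambda>i y. if i < r then l i (y0 y) else m y"
      have "?b i \<in> L" if "i < Suc r" for i using IH(1) g(1) by (auto simp: L0_def)
      moreover have "additive_on L (?l i)" if "i < Suc r" for i
        using IH(2) y0 y0add madd by (auto simp: additive_on_def)
      moreover have "?l i (?b j) = (if i = j then 1 else 0)" if "i < Suc r" "j < Suc r" for i j
        using that IH(1,3) y0L0 m0 mg y0g additive_onD(1)[OF L0d IH(2)] by auto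
      moreover have "y = (\<Sum>i<Suc r. frag_cmul (?l i y) (?b i))" if "y \<in> L" for y
      proof -
        have "(\<Sum>i<Suc r. frag_cmul (?l i y) (?b i)) = (\<Sum>i<r. frag_cmul (l i (y0 y)) (b i)) + frag_cmul (m y) g"
          by simp
        also have "\<dots> = y" using IH(4)[OF y0[OF that]] by (simp add: y0_def)
        finally show ?thesis by simp
      qed
      ultimately have "dual_bases L (Suc r) ?b ?l" unfolding dual_bases_def by blast
      then show ?thesis by blast
    qed
  qed

section \<open>Generalised inverses over the integers\<close>

text \<open>
  Over a field every linear map \<open>A\<close> has a generalised inverse \<open>D\<close> with \<open>A \<circ> D \<circ> A = A\<close>; over the integers this
  holds after clearing denominators. The basis elements of the source are added one at a time. For the defect
  \<open>\<rho> = N - A \<circ> D\<close>, which vanishes on the image of the old elements, there are two cases for a new element \<open>s\<close>: if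
  \<open>\<rho>(A s) = 0\<close>, then \<open>D\<close> still works; otherwise a coordinate \<open>\<mu>\<close> of \<open>\<rho>\<close> with \<open>\<mu>(A s) = M \<noteq> 0\<close> detects \<open>A s\<close>
  without affecting the old elements, and \<open>M \<cdot> D\<close> can be corrected along \<open>\<mu>\<close>.
\<close>

lemma integral_generalised_inverse:
  fixes A :: "('k \<Rightarrow>\<^sub>0 int) \<Rightarrow> ('l \<Rightarrow>\<^sub>0 int)"
  assumes "finite K" and A: "additive_on UNIV A"
  obtains D N where "additive_on UNIV D" "\<And>y. D y \<in> frags K" "N \<noteq> 0"
    "\<And>c. c \<in> frags K \<Longrightarrow> A (D (A c)) = frag_cmul N (A c)"
proof -
  note A' = additive_onD[OF diff_closed_UNIV A, simplified]
  have Ac: "A (frag_cmul k c) = frag_cmul k (A c)" for k c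
    using additive_on_cmul[OF diff_closed_UNIV A] by simp
  have "\<exists>D N. additive_on UNIV D \<and> (\<forall>y. D y \<in> frags K) \<and> N \<noteq> 0 \<and>
    (\<forall>s\<in>K. A (D (A (frag_of s))) = frag_cmul N (A (frag_of s)))"
    using assms(1)
  proof (induction K rule: finite_induct)
    case empty
    then show ?case
      by (intro exI[of _ "\<lambda>_. 0"] exI[of _ 1]) (auto simp: additive_on_def frags_def)
  next
    case (insert s K)
    then obtain D N where D: "additive_on UNIV D" "\<And>y. D y \<in> frags K" "N \<noteq> 0"
      "\<And>t. t \<in> K \<Longrightarrow> A (D (A (frag_of t))) = frag_cmul N (A (frag_of t))" by blast
    note D' = additive_onD[OF diff_closed_UNIV D(1), simplified]
    have Dc: "D (frag_cmul k c) = frag_cmul k (D c)" for k c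
      using additive_on_cmul[OF diff_closed_UNIV D(1)] by simp
    have KK: "frags K \<subseteq> frags (insert s K)" by (auto simp: frags_def)
    define \<rho> where "\<rho> y = frag_cmul N y - A (D y)" for y
    let ?v = "A (frag_of s)"
    show ?case
    proof (cases "\<rho> ?v = 0")
      case True
      then show ?thesis using D KK unfolding \<rho>_def
        by (intro exI[of _ D] exI[of _ N]) auto
    next
      case False
      then obtain e where e: "Poly_Mapping.lookup (\<rho> ?v) e \<noteq> 0"
        by (metis lookup_zero poly_mapping_eqI)
      define \<mu> where "\<mu> y = Poly_Mapping.lookup (\<rho> y) e" for y
      define M where "M = \<mu> ?v"
      define w where "w = frag_cmul N (frag_of s) - D ?v"
      define D' where "D' y = frag_cmul M (D y) + frag_cmul (\<mu> y) w" for y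
      have \<mu>add: "\<mu> (x - y) = \<mu> x - \<mu> y" for x y
        by (simp add: \<mu>_def \<rho>_def lookup_minus D' A' right_diff_distrib)
      have "additive_on UNIV D'"
        by (simp add: additive_on_def D'_def \<mu>add D' frag_cmul_diff_distrib frag_cmul_diff_distrib2)
      moreover have "D' y \<in> frags (insert s K)" for y
        unfolding D'_def w_def using D(2) KK
        by (intro diff_closedD diff_closed_cmul) auto
      moreover have "M * N \<noteq> 0" using e D(3) by (simp add: M_def \<mu>_def)
      moreover have "A (D' (A (frag_of t))) = frag_cmul (M * N) (A (frag_of t))" if "t \<in> insert s K" for t
      proof (cases "t = s")
        case True
        have "A (D' ?v) = frag_cmul M (A (D ?v)) + frag_cmul M (frag_cmul N ?v - A (D ?v))"
          by (simp add: D'_def A' Ac w_def M_def)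
        also have "\<dots> = frag_cmul M (A (D ?v) + (frag_cmul N ?v - A (D ?v)))"
          by (simp only: frag_cmul_distrib2)
        finally show ?thesis using True by simp
      next
        case False
        with that have t: "t \<in> K" by simp
        have "\<mu> (A (frag_of t)) = 0" using D(4)[OF t] by (simp add: \<mu>_def \<rho>_def)
        then show ?thesis using D(4)[OF t] by (simp add: D'_def Ac)
      qed
      ultimately show ?thesis by (intro exI[of _ D'] exI[of _ "M * N"]) auto
    qed
  qed
  then obtain D N where D: "additive_on UNIV D" "\<And>y. D y \<in> frags K" "N \<noteq> 0"
      "\<And>t. t \<in> K \<Longrightarrow> A (D (A (frag_of t))) = frag_cmul N (A (frag_of t))" by blast
  have "A (D (A c)) = frag_cmul N (A c)" if c: "c \<in> frags K" for c
  proof -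
    have 1: "additive_on (frags K) (\<lambda>c. A (D (A c)))" "additive_on (frags K) (\<lambda>c. frag_cmul N (A c))"
      by (simp_all add: additive_on_def A' additive_onD(2)[OF _ D(1)] frag_cmul_diff_distrib2)
    show ?thesis
      unfolding additive_on_expansion[OF assms(1) c 1(1)] additive_on_expansion[OF assms(1) c 1(2)]
      by (intro sum.cong refl) (simp add: D(4))
  qed
  then show thesis using that D by blast
qed

section \<open>The Hopf trace formula\<close>

text \<open>
  A basis of \<open>Z / B\<close> modulo torsion, described on representatives: cycles \<open>z i\<close> and functionals \<open>l i\<close> dual to
  them that vanish on boundaries, such that only torsion classes are killed by all functionals.
\<close>

definition homology_basis ::
    "('k \<Rightarrow>\<^sub>0 int) set \<Rightarrow> ('k \<Rightarrow>\<^sub>0 int) set \<Rightarrow> nat \<Rightarrow> (nat \<Rightarrow> 'k \<Rightarrow>\<^sub>0 int) \<Rightarrow> (nat \<Rightarrow> ('k \<Rightarrow>\<^sub>0 int) \<Rightarrow> int) \<Rightarrow> bool"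
  where "homology_basis Z B r z l \<longleftrightarrow>
    (\<forall>i<r. z i \<in> Z \<and> additive_on Z (l i) \<and> (\<forall>b\<in>B. l i b = 0) \<and>
       (\<forall>j<r. l i (z j) = (if i = j then 1 else 0))) \<and>
    (\<forall>c\<in>Z. (\<forall>i<r. l i c = 0) \<longrightarrow> (\<exists>m. m \<noteq> 0 \<and> frag_cmul m c \<in> B))"

text \<open>
  With a generalised inverse \<open>D\<close> of \<open>d\<close>, the map \<open>\<pi> = N - d \<circ> D\<close> kills, among the cycles, exactly those of
  torsion class. So \<open>Z / B\<close> modulo torsion is isomorphic to \<open>\<pi>(Z)\<close>, a subgroup of a free group, hence free.
\<close>

lemma homology_basis_exists:
  fixes K :: "'k set" and K1 :: "'k set"
  assumes K: "finite K" "finite K1" and d: "additive_on UNIV d" "d \<in> frags K1 \<rightarrow> Z"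
    and Z: "Z \<subseteq> frags K" "diff_closed Z"
  shows "\<exists>r z l. homology_basis Z (d ` frags K1) r z l"
proof -
  note d' = additive_onD[OF diff_closed_UNIV d(1), simplified]
  obtain D N where D: "additive_on UNIV D" "\<And>y. D y \<in> frags K1" "N \<noteq> 0"
    "\<And>c. c \<in> frags K1 \<Longrightarrow> d (D (d c)) = frag_cmul N (d c)"
    using integral_generalised_inverse[OF K(2) d(1)] by blast
  note D' = additive_onD[OF diff_closed_UNIV D(1), simplified]
  define \<pi> where "\<pi> c = frag_cmul N c - d (D c)" for c
  have \<pi>add: "\<pi> (a - b) = \<pi> a - \<pi> b" for a b
    by (simp add: \<pi>_def D' d' frag_cmul_diff_distrib2)
  have \<pi>Z: "\<pi> c \<in> Z" if "c \<in> Z" for c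
    unfolding \<pi>_def using that d(2) D(2)
    by (intro diff_closedD(2)[OF Z(2)] diff_closed_cmul[OF Z(2)]) auto
  have \<pi>0: "\<pi> 0 = 0" using \<pi>add[of 0 0] by simp
  have "diff_closed (\<pi> ` Z)"
    unfolding diff_closed_def using diff_closedD[OF Z(2)] \<pi>add \<pi>0
    by (force simp flip: \<pi>add)
  moreover have "\<pi> ` Z \<subseteq> frags K" using \<pi>Z Z(1) by blast
  ultimately obtain r b l where bl: "dual_bases (\<pi> ` Z) r b l"
    using subgroup_of_free_group_basis[OF K(1)] by blast
  then have "\<forall>i<r. \<exists>z\<in>Z. b i = \<pi> z" unfolding dual_bases_def by blast
  then obtain z where z: "\<And>i. i < r \<Longrightarrow> z i \<in> Z" "\<And>i. i < r \<Longrightarrow> b i = \<pi> (z i)" by metis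
  let ?l = "\<lambda>i c. l i (\<pi> c)"
  have "additive_on Z (?l i)" if "i < r" for i
    using bl that unfolding dual_bases_def additive_on_def by (simp add: \<pi>add)
  moreover have "?l i c = 0" if "i < r" "c \<in> d ` frags K1" for i c
  proof -
    have "\<pi> c = 0" using that(2) D(4) by (auto simp: \<pi>_def)
    moreover have "additive_on (\<pi> ` Z) (l i)" using bl that(1) unfolding dual_bases_def by blast
    ultimately show ?thesis using additive_onD(1)[OF \<open>diff_closed (\<pi> ` Z)\<close>] by simp
  qed
  moreover have "?l i (z j) = (if i = j then 1 else 0)" if "i < r" "j < r" for i j
  proof -
    have "l i (b j) = (if i = j then 1 else 0)" using bl that unfolding dual_bases_def by blast
    then show ?thesis using z(2)[OF that(2)] by simp
  qed
  moreover have "\<exists>m. m \<noteq> 0 \<and> frag_cmul m c \<in> d ` frags K1" if "c \<in> Z" "\<forall>i<r. ?l i c = 0" for c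
  proof -
    have "\<pi> c = (\<Sum>i<r. frag_cmul (l i (\<pi> c)) (b i))"
      using bl that(1) unfolding dual_bases_def by blast
    also have "\<dots> = 0" using that(2) by simp
    finally have "frag_cmul N c = d (D c)" by (simp add: \<pi>_def)
    then show ?thesis using D(2,3) by (intro exI[of _ N]) auto
  qed
  ultimately have "homology_basis Z (d ` frags K1) r z ?l"
    unfolding homology_basis_def using z(1) by (intro conjI allI ballI impI) simp_all
  then show ?thesis by blast
qed

text \<open>
  The map \<open>\<pi> = N - d1 \<circ> D1 - D0 \<circ> d0\<close> sends chains to cycles, kills boundaries, and acts on homology as
  multiplication by \<open>N\<close>. So the trace of \<open>\<psi> \<circ> \<pi>\<close> on chains is \<open>N\<close> times the trace of \<open>\<psi>\<close> on homology: writing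
  \<open>\<pi>(c)\<close> as its homology part \<open>\<Sum>i. l i (\<pi> c) \<cdot> z i\<close> plus a remainder \<open>\<beta>(c)\<close> of torsion class, the first summand gives
  the claim, and the remainder contributes nothing, because up to the factor \<open>N\<close> it factors through
  boundaries, which \<open>\<beta>\<close> kills.
\<close>

lemma trace_on_homology:
  fixes K :: "'k set" and K1 :: "'k set"
  assumes K: "finite K" "finite K1"
    and d1: "additive_on UNIV d1" "d1 \<in> frags K1 \<rightarrow> frags K" "\<And>w. w \<in> frags K1 \<Longrightarrow> d0 (d1 w) = 0"
    and d0: "additive_on UNIV (d0 :: _ \<Rightarrow> ('k \<Rightarrow>\<^sub>0 int))"
    and D1: "additive_on UNIV D1" "\<And>c. D1 c \<in> frags K1"
      "\<And>w. w \<in> frags K1 \<Longrightarrow> d1 (D1 (d1 w)) = frag_cmul N (d1 w)"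
    and D0: "additive_on UNIV D0" "\<And>c. D0 c \<in> frags K"
      "\<And>c. c \<in> frags K \<Longrightarrow> d0 (D0 (d0 c)) = frag_cmul N (d0 c)"
    and N: "N \<noteq> 0"
    and \<psi>: "additive_on UNIV \<psi>" "\<psi> \<in> frags K \<rightarrow> frags K" "\<And>c. c \<in> frags K \<Longrightarrow> d0 c = 0 \<Longrightarrow> d0 (\<psi> c) = 0"
    and \<psi>1: "additive_on UNIV \<psi>1" "\<psi>1 \<in> frags K1 \<rightarrow> frags K1" "\<And>w. w \<in> frags K1 \<Longrightarrow> d1 (\<psi>1 w) = \<psi> (d1 w)"
    and basis: "homology_basis {c \<in> frags K. d0 c = 0} (d1 ` frags K1) r z l"
  shows "matrix_trace K (\<lambda>c. \<psi> (frag_cmul N c - d1 (D1 c) - D0 (d0 c))) = N * (\<Sum>i<r. l i (\<psi> (z i)))"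
proof -
  define Z where "Z = {c \<in> frags K. d0 c = 0}"
  note add = additive_onD[OF diff_closed_UNIV, simplified]
  note d1' = add[OF d1(1)] and d0' = add[OF d0] and D1' = add[OF D1(1)] and D0' = add[OF D0(1)]
    and \<psi>' = add[OF \<psi>(1)] and \<psi>1' = add[OF \<psi>1(1)]
  have scale: "f (frag_cmul k c) = frag_cmul k (f c)"
    if "additive_on UNIV f" for f :: "('k \<Rightarrow>\<^sub>0 int) \<Rightarrow> ('k \<Rightarrow>\<^sub>0 int)" and k c
    using additive_on_cmul[OF diff_closed_UNIV that] by simp
  have Zd: "diff_closed Z" unfolding Z_def diff_closed_def
    using diff_closedD[OF diff_closed_frags[of K]] by (auto simp: d0')
  have zZ: "\<And>i. i < r \<Longrightarrow> z i \<in> Z" and ladd: "\<And>i. i < r \<Longrightarrow> additive_on Z (l i)"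
    and lB: "\<And>i w. i < r \<Longrightarrow> w \<in> frags K1 \<Longrightarrow> l i (d1 w) = 0"
    and lz: "\<And>i j. i < r \<Longrightarrow> j < r \<Longrightarrow> l i (z j) = (if i = j then 1 else 0)"
    and tors: "\<And>c. c \<in> Z \<Longrightarrow> \<forall>i<r. l i c = 0 \<Longrightarrow> \<exists>m. m \<noteq> 0 \<and> frag_cmul m c \<in> d1 ` frags K1"
    using basis unfolding homology_basis_def Z_def by blast+
  define \<pi> where "\<pi> c = frag_cmul N c - d1 (D1 c) - D0 (d0 c)" for c
  have \<pi>add: "\<pi> (a - b) = \<pi> a - \<pi> b" for a b
    by (simp add: \<pi>_def D1' d1' D0' d0' frag_cmul_diff_distrib2)
  have BZ: "d1 w \<in> Z" if "w \<in> frags K1" for w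
    using that d1(2,3) by (auto simp: Z_def)
  have \<pi>Z: "\<pi> c \<in> Z" if "c \<in> frags K" for c
  proof -
    have "\<pi> c \<in> frags K" unfolding \<pi>_def using that d1(2) D1(2) D0(2)
      by (intro diff_closedD(2)[OF diff_closed_frags] diff_closed_cmul) auto
    moreover have "d0 (\<pi> c) = 0"
      using that D0(3) d1(3)[OF D1(2)] by (simp add: \<pi>_def d0' scale[OF d0])
    ultimately show ?thesis by (simp add: Z_def)
  qed
  have \<pi>B: "\<pi> (d1 w) = 0" if "w \<in> frags K1" for w
    using that D1(3) d1(3) by (simp add: \<pi>_def D0'(1))
  define \<beta> where "\<beta> c = \<pi> c - (\<Sum>i<r. frag_cmul (l i (\<pi> c)) (z i))" for c
  have sumZ: "(\<Sum>i<r. frag_cmul (l i (\<pi> c)) (z i)) \<in> Z" for c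
    using zZ by (intro diff_closed_sum[OF Zd] diff_closed_cmul[OF Zd]) auto
  have \<beta>Z: "\<beta> c \<in> Z" if "c \<in> frags K" for c
    unfolding \<beta>_def by (intro diff_closedD(2)[OF Zd] \<pi>Z sumZ that)
  have l\<beta>: "l j (\<beta> c) = 0" if c: "c \<in> frags K" and j: "j < r" for c j
  proof -
    have "l j (\<Sum>i<r. frag_cmul (l i (\<pi> c)) (z i)) = (\<Sum>i<r. l j (frag_cmul (l i (\<pi> c)) (z i)))"
      using zZ by (intro additive_on_sum[OF Zd ladd[OF j]] diff_closed_cmul[OF Zd]) auto
    also have "\<dots> = (\<Sum>i<r. if i = j then l i (\<pi> c) else 0)"
      using zZ by (intro sum.cong refl) (auto simp: additive_on_cmul_int[OF Zd ladd[OF j]] lz j)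
    also have "\<dots> = l j (\<pi> c)" using j by simp
    finally show ?thesis
      unfolding \<beta>_def using additive_onD(2)[OF Zd ladd[OF j] \<pi>Z[OF c] sumZ] by simp
  qed
  (* The class of \<beta> c is torsion, say m times \<beta> c is d1 w; the identity for D1 on boundaries, applied to
     d1 w, can be divided by m because the group of chains is torsion-free. *)
  have N\<beta>: "frag_cmul N (\<beta> c) = d1 (D1 (\<beta> c))" if c: "c \<in> frags K" for c
  proof -
    obtain m w where m: "m \<noteq> 0" "w \<in> frags K1" "frag_cmul m (\<beta> c) = d1 w"
      using tors[OF \<beta>Z[OF c]] l\<beta>[OF c] by blast
    have "frag_cmul m (frag_cmul N (\<beta> c) - d1 (D1 (\<beta> c))) = frag_cmul N (d1 w) - d1 (D1 (d1 w))"
    proof -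
      have "frag_cmul m (frag_cmul N (\<beta> c) - d1 (D1 (\<beta> c))) =
          frag_cmul N (frag_cmul m (\<beta> c)) - d1 (D1 (frag_cmul m (\<beta> c)))"
        by (simp add: frag_cmul_diff_distrib2 mult.commute scale[OF d1(1)] scale[OF D1(1)])
      then show ?thesis by (simp only: m(3))
    qed
    also have "\<dots> = 0" using D1(3)[OF m(2)] by simp
    finally show ?thesis using m(1) by simp
  qed
  have "N * matrix_trace K (\<lambda>c. \<psi> (\<beta> c)) = matrix_trace K (\<lambda>c. frag_cmul N (\<psi> (\<beta> c)))"
    by (simp add: matrix_trace_cmul)
  also have "\<dots> = matrix_trace K (\<lambda>c. d1 (\<psi>1 (D1 (\<beta> c))))"
    by (intro matrix_trace_cong) (simp add: \<psi>1(3)[OF D1(2)] N\<beta> flip: scale[OF \<psi>(1)])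
  (* Moving d1 to the other end of the composite brings it next to \<beta>, where \<beta> \<circ> d1 = 0. *)
  also have "\<dots> = matrix_trace K1 (\<lambda>w. \<psi>1 (D1 (\<beta> (d1 w))))"
  proof (rule matrix_trace_commute[OF K(2,1)])
    have "additive_on (frags K) \<beta>"
      unfolding additive_on_def
    proof (intro ballI)
      fix a b assume ab: "a \<in> frags K" "b \<in> frags K"
      have "l i (\<pi> (a - b)) = l i (\<pi> a) - l i (\<pi> b)" if "i < r" for i
        using additive_onD(2)[OF Zd ladd[OF that] \<pi>Z[OF ab(1)] \<pi>Z[OF ab(2)]] by (simp add: \<pi>add)
      then have "(\<Sum>i<r. frag_cmul (l i (\<pi> (a - b))) (z i)) =
          (\<Sum>i<r. frag_cmul (l i (\<pi> a)) (z i)) - (\<Sum>i<r. frag_cmul (l i (\<pi> b)) (z i))"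
        by (simp add: frag_cmul_diff_distrib flip: sum_subtractf)
      then show "\<beta> (a - b) = \<beta> a - \<beta> b"
        by (simp add: \<beta>_def \<pi>add)
    qed
    then show "additive_on (frags K) (\<lambda>c. \<psi>1 (D1 (\<beta> c)))"
      by (simp add: additive_on_def D1' \<psi>1')
  qed (use d1 D1 \<psi>1 in \<open>auto simp: additive_on_def\<close>)
  also have "\<dots> = matrix_trace K1 (\<lambda>w. 0)"
  proof (rule matrix_trace_cong)
    fix w assume w: "w \<in> frags K1"
    have "\<beta> (d1 w) = 0"
      using \<pi>B[OF w] additive_onD(1)[OF Zd ladd] by (simp add: \<beta>_def)
    then show "\<psi>1 (D1 (\<beta> (d1 w))) = 0" by (simp add: D1' \<psi>1')
  qed
  finally have tr\<beta>: "matrix_trace K (\<lambda>c. \<psi> (\<beta> c)) = 0"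
    using N by (simp add: matrix_trace_def)
  have "matrix_trace K (\<lambda>c. \<psi> (\<pi> c)) =
      matrix_trace K (\<lambda>c. (\<Sum>i<r. frag_cmul (l i (\<pi> c)) (\<psi> (z i))) + \<psi> (\<beta> c))"
  proof (rule matrix_trace_cong)
    fix c assume "c \<in> frags K"
    have "\<psi> (\<beta> c) = \<psi> (\<pi> c) - (\<Sum>i<r. frag_cmul (l i (\<pi> c)) (\<psi> (z i)))"
      by (simp add: \<beta>_def \<psi>' additive_on_sum[OF diff_closed_UNIV \<psi>(1)] scale[OF \<psi>(1)])
    then show "\<psi> (\<pi> c) = (\<Sum>i<r. frag_cmul (l i (\<pi> c)) (\<psi> (z i))) + \<psi> (\<beta> c)" by simp
  qed
  also have "\<dots> = (\<Sum>i<r. matrix_trace K (\<lambda>c. frag_cmul (l i (\<pi> c)) (\<psi> (z i))))"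
    by (simp add: matrix_trace_add tr\<beta> matrix_trace_sum)
  also have "\<dots> = (\<Sum>i<r. N * l i (\<psi> (z i)))"
  proof (intro sum.cong refl)
    fix i assume "i \<in> {..<r}"
    then have i: "i < r" by simp
    have \<psi>z: "\<psi> (z i) \<in> frags K" "d0 (\<psi> (z i)) = 0"
      using zZ[OF i] \<psi>(2,3) by (auto simp: Z_def)
    have ladd\<pi>: "additive_on (frags K) (\<lambda>c. l i (\<pi> c))"
      unfolding additive_on_def using additive_onD(2)[OF Zd ladd[OF i] \<pi>Z \<pi>Z] by (simp add: \<pi>add)
    have \<psi>zZ: "\<psi> (z i) \<in> Z" using \<psi>z by (simp add: Z_def)
    have "matrix_trace K (\<lambda>c. frag_cmul (l i (\<pi> c)) (\<psi> (z i))) = l i (\<pi> (\<psi> (z i)))"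
      by (rule matrix_trace_rank_one[OF K(1) \<psi>z(1) ladd\<pi>])
    also have "\<pi> (\<psi> (z i)) = frag_cmul N (\<psi> (z i)) - d1 (D1 (\<psi> (z i)))"
      by (simp add: \<pi>_def \<psi>z(2) D0'(1))
    also have "l i \<dots> = N * l i (\<psi> (z i))"
      using additive_onD(2)[OF Zd ladd[OF i] diff_closed_cmul[OF Zd \<psi>zZ] BZ[OF D1(2)]]
        additive_on_cmul_int[OF Zd ladd[OF i] \<psi>zZ] lB[OF i D1(2)] by simp
    finally show "matrix_trace K (\<lambda>c. frag_cmul (l i (\<pi> c)) (\<psi> (z i))) = N * l i (\<psi> (z i))" .
  qed
  finally show ?thesis by (simp add: \<pi>_def sum_distrib_left)
qed

lemma alternating_telescope:
  fixes a :: "nat \<Rightarrow> int"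
  shows "(\<Sum>n\<le>M. (-1) ^ n * (a n + (if n = 0 then 0 else a (n - 1)))) = (-1) ^ M * a M"
proof (induction M)
  case (Suc M)
  have "(\<Sum>n\<le>Suc M. (-1) ^ n * (a n + (if n = 0 then 0 else a (n - 1)))) =
      (-1) ^ M * a M + (-1) ^ Suc M * (a (Suc M) + a M)"
    by (simp only: sum.atMost_Suc Suc.IH) simp
  then show ?case by (simp add: distrib_left)
qed simp

text \<open>
  The identity map times \<open>N\<close> is \<open>\<pi>\<^sub>n + d\<^sub>n\<^sub>+\<^sub>1 \<circ> D\<^sub>n\<^sub>+\<^sub>1 + D\<^sub>n \<circ> d\<^sub>n\<close>, with \<open>\<pi>\<^sub>n\<close> as in
  \<open>trace_on_homology\<close>. Composed with \<open>\<psi>\<^sub>n\<close>, the first summand has trace \<open>N\<close> times that of \<open>\<psi>\<^sub>n\<close> on homology. By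
  \<open>tr(A \<circ> B) = tr(B \<circ> A)\<close> the third summand in degree \<open>n\<close> has the same trace as the second in degree \<open>n - 1\<close>, so in
  the alternating sum these two telescope.
\<close>

theorem Hopf_trace_formula:
  fixes K :: "nat \<Rightarrow> 'k set"
  assumes K: "\<And>n. finite (K n)" "K (Suc M) = {}"
    and d: "\<And>n. additive_on UNIV (d n)" "\<And>n. d (Suc n) \<in> frags (K (Suc n)) \<rightarrow> frags (K n)"
      "\<And>n c. c \<in> frags (K (Suc n)) \<Longrightarrow> d n (d (Suc n) c) = 0" "\<And>c. d 0 c = (0 :: 'k \<Rightarrow>\<^sub>0 int)"
    and \<psi>: "\<And>n. additive_on UNIV (\<psi> n)" "\<And>n. \<psi> n \<in> frags (K n) \<rightarrow> frags (K n)"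
      "\<And>n c. c \<in> frags (K (Suc n)) \<Longrightarrow> d (Suc n) (\<psi> (Suc n) c) = \<psi> n (d (Suc n) c)"
    and basis: "\<And>n. homology_basis {c \<in> frags (K n). d n c = 0} (d (Suc n) ` frags (K (Suc n))) (r n) (z n) (l n)"
  shows "(\<Sum>n\<le>M. (-1) ^ n * (\<Sum>i<r n. l n i (\<psi> n (z n i)))) = (\<Sum>n\<le>M. (-1) ^ n * matrix_trace (K n) (\<psi> n))"
proof -
  note add = additive_onD[OF diff_closed_UNIV, simplified]
  have scale: "f (frag_cmul k c) = frag_cmul k (f c)"
    if "additive_on UNIV f" for f :: "('k \<Rightarrow>\<^sub>0 int) \<Rightarrow> ('k \<Rightarrow>\<^sub>0 int)" and k c
    using additive_on_cmul[OF diff_closed_UNIV that] by simp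
  have "\<forall>n. \<exists>D N. additive_on UNIV D \<and> (\<forall>y. D y \<in> frags (K n)) \<and> N \<noteq> 0 \<and>
    (\<forall>c\<in>frags (K n). d n (D (d n c)) = frag_cmul N (d n c))"
  proof
    fix n
    show "\<exists>D N. additive_on UNIV D \<and> (\<forall>y. D y \<in> frags (K n)) \<and> N \<noteq> 0 \<and>
      (\<forall>c\<in>frags (K n). d n (D (d n c)) = frag_cmul N (d n c))"
      by (rule integral_generalised_inverse[OF K(1)[of n] d(1)[of n]]) blast
  qed
  then obtain D' N' where D': "\<And>n. additive_on UNIV (D' n)" "\<And>n y. D' n y \<in> frags (K n)"
    "\<And>n. N' n \<noteq> 0" "\<And>n c. c \<in> frags (K n) \<Longrightarrow> d n (D' n (d n c)) = frag_cmul (N' n) (d n c)"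
    by metis
  (* A common multiple of the N' n: the telescoping compares neighbouring degrees, so the factor must not
     depend on the degree. *)
  define N where "N = (\<Prod>n\<le>Suc M. N' n)"
  define D where "D n y = frag_cmul (\<Prod>k\<in>{..Suc M}-{n}. N' k) (D' n y)" for n y
  have N: "N \<noteq> 0" using D'(3) by (simp add: N_def)
  have D: "additive_on UNIV (D n)" "D n y \<in> frags (K n)" for n y
    using D'(1,2) by (auto simp: D_def additive_on_def frag_cmul_diff_distrib2 intro: diff_closed_cmul)
  have DN: "d n (D n (d n c)) = frag_cmul N (d n c)" if "n \<le> Suc M" "c \<in> frags (K n)" for n c
  proof -
    have "N = (\<Prod>k\<in>{..Suc M}-{n}. N' k) * N' n"
      unfolding N_def using that(1) prod.remove[of "{..Suc M}" n N'] by (simp add: mult.commute del: prod.atMost_Suc)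
    then show ?thesis by (simp add: D_def scale[OF d(1)] D'(4)[OF that(2)])
  qed
  define a where "a n = matrix_trace (K n) (\<lambda>c. \<psi> n (d (Suc n) (D (Suc n) c)))" for n
  have step: "N * matrix_trace (K n) (\<psi> n) =
      N * (\<Sum>i<r n. l n i (\<psi> n (z n i))) + (a n + (if n = 0 then 0 else a (n - 1)))" if n: "n \<le> M" for n
  proof -
    let ?\<pi> = "\<lambda>c. frag_cmul N c - d (Suc n) (D (Suc n) c) - D n (d n c)"
    have cycle: "d n (\<psi> n c) = 0" if "c \<in> frags (K n)" "d n c = 0" for c
      using that \<psi>(3) d(4) by (cases n) (auto simp: add[OF \<psi>(1)])
    have DN': "d n (D n (d n c)) = frag_cmul N (d n c)" if "c \<in> frags (K n)" for c
      using n that by (intro DN) auto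
    have DN1: "d (Suc n) (D (Suc n) (d (Suc n) c)) = frag_cmul N (d (Suc n) c)" if "c \<in> frags (K (Suc n))" for c
      using n that by (intro DN) auto
    have "matrix_trace (K n) (\<lambda>c. \<psi> n (?\<pi> c)) = N * (\<Sum>i<r n. l n i (\<psi> n (z n i)))"
      by (rule trace_on_homology[OF K(1) K(1) d(1) d(2) d(3) d(1) D(1) D(2) DN1 D(1) D(2) DN' N
            \<psi>(1) \<psi>(2) cycle \<psi>(1) \<psi>(2) \<psi>(3) basis])
    moreover
    have "matrix_trace (K n) (\<lambda>c. \<psi> n (D n (d n c))) = (if n = 0 then 0 else a (n - 1))"
    proof (cases n)
      case 0
      then show ?thesis by (simp add: d(4) add[OF D(1)] add[OF \<psi>(1)] matrix_trace_def)
    next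
      case (Suc m)
      have "matrix_trace (K n) (\<lambda>c. \<psi> n (D n (d n c))) = matrix_trace (K m) (\<lambda>c. d n (\<psi> n (D n c)))"
      proof (rule matrix_trace_commute)
        show "d n \<in> frags (K n) \<rightarrow> frags (K m)" using d(2) Suc by blast
        show "(\<lambda>c. \<psi> n (D n c)) \<in> frags (K m) \<rightarrow> frags (K n)" using \<psi>(2) D(2) by blast
      qed (use K d(1) in \<open>auto simp: additive_on_def add[OF D(1)] add[OF \<psi>(1)] add[OF d(1)]\<close>)
      also have "\<dots> = a m"
        unfolding a_def by (rule matrix_trace_cong) (use \<psi>(3)[of _ m] D(2) Suc in simp)
      finally show ?thesis using Suc by simp
    qed
    moreover have "N * matrix_trace (K n) (\<psi> n) = matrix_trace (K n) (\<lambda>c. frag_cmul N (\<psi> n c))"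
      by (simp add: matrix_trace_cmul)
    moreover have "\<dots> = matrix_trace (K n) (\<lambda>c. (\<psi> n (?\<pi> c) + \<psi> n (d (Suc n) (D (Suc n) c))) + \<psi> n (D n (d n c)))"
      by (rule matrix_trace_cong) (simp add: add[OF \<psi>(1)] scale[OF \<psi>(1)])
    ultimately show ?thesis by (simp only: matrix_trace_add a_def)
  qed
  have "frags (K (Suc M)) = {0}" using K(2) by (auto simp: frags_def)
  then have aM: "a M = 0"
    using D(2)[of "Suc M"] by (simp add: a_def matrix_trace_def add[OF d(1)] add[OF \<psi>(1)])
  have "N * (\<Sum>n\<le>M. (-1) ^ n * matrix_trace (K n) (\<psi> n)) =
     (\<Sum>n\<le>M. (-1) ^ n * (N * matrix_trace (K n) (\<psi> n)))"
    by (simp add: sum_distrib_left algebra_simps)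
  also have "\<dots> = (\<Sum>n\<le>M. N * ((-1) ^ n * (\<Sum>i<r n. l n i (\<psi> n (z n i)))) +
       (-1) ^ n * (a n + (if n = 0 then 0 else a (n - 1))))"
  proof (intro sum.cong refl)
    fix n assume "n \<in> {..M}"
    then show "(-1) ^ n * (N * matrix_trace (K n) (\<psi> n)) = N * ((-1) ^ n * (\<Sum>i<r n. l n i (\<psi> n (z n i)))) +
       (-1) ^ n * (a n + (if n = 0 then 0 else a (n - 1)))"
      using step[of n] by (simp only: atMost_iff distrib_left mult.left_commute)
  qed
  also have "\<dots> = N * (\<Sum>n\<le>M. (-1) ^ n * (\<Sum>i<r n. l n i (\<psi> n (z n i))))"
    by (simp only: sum.distrib alternating_telescope aM) (simp add: sum_distrib_left)
  finally show ?thesis using N by simp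
qed

section \<open>The trace on the torsion-free part\<close>

text \<open>
  The functionals \<open>l i\<close> are the coordinates of a homomorphism \<open>q\<close> onto the free abelian group on \<open>{..<r}\<close>
  whose kernel is the torsion subgroup. It induces an isomorphism from the torsion-free part, whose inverse is a
  basis in which the matrix of \<open>\<phi>\<close> has the diagonal entries \<open>l i (\<phi> (e i))\<close>.
\<close>

lemma group_trace_dual_bases:
  fixes G :: "('a, 'm) monoid_scheme" and l :: "nat \<Rightarrow> 'a \<Rightarrow> int"
  assumes G: "comm_group G" and \<phi>: "\<phi> \<in> hom G G"
    and e: "\<And>i. i < r \<Longrightarrow> e i \<in> carrier G"
    and l: "\<And>i x y. i < r \<Longrightarrow> x \<in> carrier G \<Longrightarrow> y \<in> carrier G \<Longrightarrow> l i (x \<otimes>\<^bsub>G\<^esub> y) = l i x + l i y"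
    and dual: "\<And>i j. i < r \<Longrightarrow> j < r \<Longrightarrow> l i (e j) = (if i = j then 1 else 0)"
    and tors: "\<And>x. x \<in> carrier G \<Longrightarrow> \<forall>i<r. l i x = 0 \<Longrightarrow> x \<in> torsion_set G"
  shows "group_trace G \<phi> = (\<Sum>i<r. l i (\<phi> (e i)))"
proof -
  interpret G: comm_group G by (rule G)
  interpret \<phi>: group_hom G G \<phi> by (intro group_hom.intro group_hom_axioms.intro G.is_group \<phi>)
  let ?F = "free_Abelian_group {..<r}"
  define q where "q x = (\<Sum>i<r. frag_cmul (l i x) (frag_of i))" for x
  have lq: "Poly_Mapping.lookup (q x) i = (if i < r then l i x else 0)" for x i
    unfolding q_def lookup_sum by (simp add: if_distrib cong: if_cong)
  have qF: "q x \<in> carrier ?F" for x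
    by (auto simp: in_keys_iff lq split: if_splits)
  have qhom: "q \<in> hom G ?F"
  proof (rule homI)
    show "q (x \<otimes>\<^bsub>G\<^esub> y) = q x \<otimes>\<^bsub>?F\<^esub> q y" if "x \<in> carrier G" "y \<in> carrier G" for x y
      using that by (intro poly_mapping_eqI) (simp add: lookup_add lq l)
  qed (rule qF)
  interpret q: group_hom G ?F q
    using qhom by (simp add: group_hom_def group_hom_axioms_def)
  have qe: "q (e i) = frag_of i" if "i < r" for i
    using that by (intro poly_mapping_eqI) (auto simp: lq dual)
  have onto: "q ` carrier G = carrier ?F"
  proof
    show "q ` carrier G \<subseteq> carrier ?F" using qF by blast
    show "carrier ?F \<subseteq> q ` carrier G"
    proof
      fix c assume "c \<in> carrier ?F"
      then have "Poly_Mapping.keys c \<subseteq> {..<r}" by simp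
      then show "c \<in> q ` carrier G"
      proof (rule free_Abelian_group_induct)
        show "0 \<in> q ` carrier G" using q.hom_one G.one_closed by (metis image_eqI one_free_Abelian_group)
      next
        fix a b assume "a \<in> q ` carrier G" "b \<in> q ` carrier G"
        then obtain x y where xy: "x \<in> carrier G" "y \<in> carrier G" "a = q x" "b = q y" by blast
        have "q (x \<otimes>\<^bsub>G\<^esub> inv\<^bsub>G\<^esub> y) = a - b"
          using xy qF[of y] by (simp add: q.hom_mult q.hom_inv)
        then show "a - b \<in> q ` carrier G" using xy by (metis G.inv_closed G.m_closed image_eqI)
      next
        fix i assume "i \<in> {..<r}"
        then show "frag_of i \<in> q ` carrier G" using qe e by (metis image_eqI lessThan_iff)
      qed
    qed
  qed
  have ker: "kernel G ?F q = torsion_set G"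
  proof (intro equalityI subsetI)
    fix x assume "x \<in> kernel G ?F q"
    then have x: "x \<in> carrier G" "q x = 0" by (auto simp: kernel_def)
    then have "\<forall>i<r. l i x = 0" by (metis lookup_zero lq)
    then show "x \<in> torsion_set G" using tors x(1) by blast
  next
    fix x assume "x \<in> torsion_set G"
    then obtain n :: nat where x: "x \<in> carrier G" "n > 0" "x [^]\<^bsub>G\<^esub> n = \<one>\<^bsub>G\<^esub>"
      by (auto simp: torsion_set_def)
    have "frag_cmul (int n) (q x) = 0"
      using q.hom_nat_pow[OF x(1), of n] x(3) q.hom_one by simp
    then show "x \<in> kernel G ?F q" using x(1,2) by (simp add: kernel_def)
  qed
  let ?T = "torsion_set G" and ?H = "torsion_free_part G" and ?\<Phi> = "torsion_free_map G \<phi>"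
  have nT: "?T \<lhd> G" using q.normal_kernel ker by simp
  interpret T: normal ?T G by (rule nT)
  define k where "k = (\<lambda>X. the_elem (q ` X))"
  have kiso: "k \<in> iso ?H ?F"
    using q.FactGroup_iso_set[OF onto] unfolding ker k_def torsion_free_part_def .
  have gH: "group ?H" unfolding torsion_free_part_def by (rule T.factorgroup_is_group)
  have carH: "carrier ?H = (\<lambda>x. ?T #>\<^bsub>G\<^esub> x) ` carrier G"
    by (auto simp: torsion_free_part_def FactGroup_def RCOSETS_def)
  have kT: "k (?T #>\<^bsub>G\<^esub> x) = q x" if x: "x \<in> carrier G" for x
  proof -
    have "q ` (?T #>\<^bsub>G\<^esub> x) = {q x}"
    proof -
      have "q y = q x" if "y \<in> ?T #>\<^bsub>G\<^esub> x" for y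
      proof -
        obtain t where t: "t \<in> ?T" "y = t \<otimes>\<^bsub>G\<^esub> x" using \<open>y \<in> ?T #>\<^bsub>G\<^esub> x\<close> by (auto simp: r_coset_def)
        have "q t = 0" "t \<in> carrier G" using t(1) ker by (auto simp: kernel_def)
        then show ?thesis using t x by (simp add: q.hom_mult)
      qed
      moreover have "x \<in> ?T #>\<^bsub>G\<^esub> x" using x by (rule G.rcos_self[OF _ T.subgroup_axioms])
      ultimately show ?thesis by blast
    qed
    then show ?thesis by (simp add: k_def)
  qed
  have \<Phi>: "?\<Phi> (?T #>\<^bsub>G\<^esub> x) = ?T #>\<^bsub>G\<^esub> \<phi> x" if x: "x \<in> carrier G" for x
  proof -
    have \<phi>T: "\<phi> t \<in> ?T" if t: "t \<in> ?T" for t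
    proof -
      obtain n :: nat where n: "t \<in> carrier G" "n > 0" "t [^]\<^bsub>G\<^esub> n = \<one>\<^bsub>G\<^esub>"
        using t unfolding torsion_set_def by blast
      have "\<phi> t [^]\<^bsub>G\<^esub> n = \<phi> (t [^]\<^bsub>G\<^esub> n)" by (rule \<phi>.hom_nat_pow[OF n(1), symmetric])
      also have "\<dots> = \<one>\<^bsub>G\<^esub>" by (simp only: n(3) \<phi>.hom_one)
      finally show ?thesis unfolding torsion_set_def using \<phi>.hom_closed[OF n(1)] n(2) by blast
    qed
    show ?thesis
    proof (intro equalityI subsetI)
      fix y assume "y \<in> ?\<Phi> (?T #>\<^bsub>G\<^esub> x)"
      then obtain s t where st: "s \<in> ?T" "t \<in> ?T" "y = s \<otimes>\<^bsub>G\<^esub> \<phi> (t \<otimes>\<^bsub>G\<^esub> x)"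
        unfolding torsion_free_map_def set_mult_def r_coset_def by blast
      have "y = (s \<otimes>\<^bsub>G\<^esub> \<phi> t) \<otimes>\<^bsub>G\<^esub> \<phi> x"
        unfolding st(3) \<phi>.hom_mult[OF T.mem_carrier[OF st(2)] x]
        by (rule G.m_assoc[symmetric]) (use st x T.mem_carrier \<phi>.hom_closed in blast)+
      then show "y \<in> ?T #>\<^bsub>G\<^esub> \<phi> x" using st(1,2) \<phi>T T.m_closed unfolding r_coset_def by blast
    next
      fix y assume "y \<in> ?T #>\<^bsub>G\<^esub> \<phi> x"
      then obtain s where s: "s \<in> ?T" "y = s \<otimes>\<^bsub>G\<^esub> \<phi> x" unfolding r_coset_def by blast
      moreover have "\<phi> x \<in> \<phi> ` (?T #>\<^bsub>G\<^esub> x)" using G.rcos_self[OF x T.subgroup_axioms] by blast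
      ultimately show "y \<in> ?\<Phi> (?T #>\<^bsub>G\<^esub> x)" unfolding torsion_free_map_def set_mult_def by blast
    qed
  qed
  have \<Phi>hom: "?\<Phi> \<in> hom ?H ?H"
  proof (rule homI)
    fix C assume "C \<in> carrier ?H"
    then show "?\<Phi> C \<in> carrier ?H" using \<Phi> \<phi>.hom_closed by (auto simp: carH)
  next
    fix C D assume "C \<in> carrier ?H" "D \<in> carrier ?H"
    then obtain x y where xy: "x \<in> carrier G" "y \<in> carrier G" "C = ?T #>\<^bsub>G\<^esub> x" "D = ?T #>\<^bsub>G\<^esub> y"
      by (auto simp: carH)
    have "C \<otimes>\<^bsub>?H\<^esub> D = ?T #>\<^bsub>G\<^esub> (x \<otimes>\<^bsub>G\<^esub> y)"
      using xy by (simp add: torsion_free_part_def FactGroup_def T.rcos_sum)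
    then show "?\<Phi> (C \<otimes>\<^bsub>?H\<^esub> D) = ?\<Phi> C \<otimes>\<^bsub>?H\<^esub> ?\<Phi> D"
      using xy by (simp add: \<Phi> \<phi>.hom_mult) (simp add: torsion_free_part_def FactGroup_def T.rcos_sum)
  qed
  define h where "h = inv_into (carrier ?H) k"
  have hiso: "h \<in> iso ?F ?H" unfolding h_def by (rule group.iso_set_sym[OF gH kiso])
  have kinj: "inj_on k (carrier ?H)" and hinj: "inj_on h (carrier ?F)"
    using kiso hiso by (auto simp: iso_def bij_betw_def)
  have hk: "h (k C) = C" if "C \<in> carrier ?H" for C
    unfolding h_def by (rule inv_into_f_f[OF kinj that])
  have inv_h: "inv_into (carrier ?F) h C = k C" if "C \<in> carrier ?H" for C
  proof (rule inv_into_f_eq[OF hinj _ hk[OF that]])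
    show "k C \<in> carrier ?F" by (rule hom_in_carrier[OF _ that]) (use kiso in \<open>simp add: iso_def\<close>)
  qed
  have "group_trace G \<phi> = basis_trace ?H r h ?\<Phi>"
    unfolding group_trace_def by (rule free_trace_eq[OF gH \<Phi>hom hiso])
  also have "\<dots> = (\<Sum>i<r. l i (\<phi> (e i)))"
    unfolding basis_trace_def
  proof (intro sum.cong refl)
    fix i assume "i \<in> {..<r}"
    then have i: "i < r" by simp
    have "h (frag_of i) = ?T #>\<^bsub>G\<^esub> e i"
      using hk[of "?T #>\<^bsub>G\<^esub> e i"] e[OF i] kT[OF e[OF i]] qe[OF i] by (auto simp: carH)
    then have "?\<Phi> (h (frag_of i)) = ?T #>\<^bsub>G\<^esub> \<phi> (e i)" using \<Phi>[OF e[OF i]] by simp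
    moreover have "?T #>\<^bsub>G\<^esub> \<phi> (e i) \<in> carrier ?H" using e[OF i] \<phi>.hom_closed by (auto simp: carH)
    ultimately have "inv_into (carrier ?F) h (?\<Phi> (h (frag_of i))) = q (\<phi> (e i))"
      using inv_h kT \<phi>.hom_closed[OF e[OF i]] by simp
    then show "Poly_Mapping.lookup (inv_into (carrier ?F) h (?\<Phi> (h (frag_of i)))) i = l i (\<phi> (e i))"
      using i by (simp add: lq)
  qed
  finally show ?thesis .
qed

section \<open>The order of a finite space\<close>

text \<open>
  The order of a finite space is its specialisation order. In this form it restricts to subspaces
  without reference to minimal open sets, which change with the subspace.
\<close>

lemma space_le_iff:
  "space_le X x y \<longleftrightarrow> x \<in> topspace X \<and> y \<in> topspace X \<and> (\<forall>U. openin X U \<longrightarrow> y \<in> U \<longrightarrow> x \<in> U)"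
  unfolding space_le_def min_open_def by blast

lemma space_le_refl: "x \<in> topspace X \<Longrightarrow> space_le X x x"
  by (simp add: space_le_iff)

lemma space_le_trans: "space_le X x y \<Longrightarrow> space_le X y z \<Longrightarrow> space_le X x z"
  by (simp add: space_le_iff)

lemma space_le_antisym: "t0_space X \<Longrightarrow> space_le X x y \<Longrightarrow> space_le X y x \<Longrightarrow> x = y"
  unfolding space_le_iff t0_space_def by metis

lemma space_le_continuous_map: "continuous_map X Y f \<Longrightarrow> space_le X x y \<Longrightarrow> space_le Y (f x) (f y)"
  unfolding space_le_iff continuous_map_def by (fastforce simp: Pi_iff)

lemma space_le_subtopology:
  "space_le (subtopology X A) x y \<longleftrightarrow> x \<in> A \<and> y \<in> A \<and> space_le X x y"
proof -
  have "(\<forall>U. openin (subtopology X A) U \<longrightarrow> y \<in> U \<longrightarrow> x \<in> U) \<longleftrightarrow> (\<forall>U. openin X U \<longrightarrow> y \<in> U \<longrightarrow> x \<in> U)"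
    if "x \<in> A" "y \<in> A"
    using that unfolding openin_subtopology by (metis IntD1 IntI)
  then show ?thesis unfolding space_le_iff topspace_subtopology by blast
qed

lemma space_less_subtopology:
  "space_less (subtopology X A) x y \<longleftrightarrow> x \<in> A \<and> y \<in> A \<and> space_less X x y"
  by (auto simp: space_less_def space_le_subtopology)

lemma openin_min_open:
  assumes "finite (topspace X)" "x \<in> topspace X"
  shows "openin X (min_open X x)" "x \<in> min_open X x"
proof -
  let ?\<U> = "{U. openin X U \<and> x \<in> U}"
  have "?\<U> \<subseteq> Pow (topspace X)" using openin_subset by blast
  then have "finite ?\<U>" using assms(1) by (meson finite_Pow_iff finite_subset)
  moreover have "topspace X \<in> ?\<U>" using assms(2) by simp
  ultimately show "openin X (min_open X x)"
    unfolding min_open_def by (intro openin_Inter) auto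
  show "x \<in> min_open X x" by (simp add: min_open_def)
qed

lemma in_min_open_iff:
  assumes "finite (topspace X)" "y \<in> topspace X"
  shows "x \<in> min_open X y \<longleftrightarrow> space_le X x y"
proof
  assume "x \<in> min_open X y"
  then show "space_le X x y"
    using assms openin_subset[OF openin_min_open(1)[OF assms]] by (auto simp: space_le_iff min_open_def)
next
  assume "space_le X x y"
  then show "x \<in> min_open X y" by (auto simp: space_le_iff min_open_def)
qed

section \<open>Order simplices\<close>

text \<open>
  The least index of a nonzero coordinate, rather than the greatest, makes this map continuous for increasing
  \<open>x\<close>: \<open>{t. t i \<noteq> 0}\<close> is open, and open sets of a finite space are lower sets.
\<close>

definition order_simplex :: "nat \<Rightarrow> (nat \<Rightarrow> 'a) \<Rightarrow> (nat \<Rightarrow> real) \<Rightarrow> 'a" where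
  "order_simplex p x = restrict (\<lambda>t. x (LEAST i. t i \<noteq> 0)) (standard_simplex p)"

text \<open>
  Chains are sequences, of which only the values at the indices up to \<open>p\<close> matter.
\<close>

definition strict_chain :: "'a topology \<Rightarrow> nat \<Rightarrow> (nat \<Rightarrow> 'a) \<Rightarrow> bool" where
  "strict_chain X p x \<longleftrightarrow> (\<forall>i\<le>p. x i \<in> topspace X) \<and> (\<forall>j\<le>p. \<forall>i<j. space_less X (x i) (x j))"

definition order_simplices :: "nat \<Rightarrow> 'a topology \<Rightarrow> ((nat \<Rightarrow> real) \<Rightarrow> 'a) set" where
  "order_simplices p X = order_simplex p ` Collect (strict_chain X p)"

definition order_chains :: "nat \<Rightarrow> 'a topology \<Rightarrow> 'a chain set" where
  "order_chains p X = frags (order_simplices p X)"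

abbreviation basis_point :: "nat \<Rightarrow> nat \<Rightarrow> real" where
  "basis_point i \<equiv> \<lambda>j. if j = i then 1 else 0"

lemma Least_support:
  assumes "t \<in> standard_simplex p"
  shows "(LEAST i. t i \<noteq> 0) \<le> p" "t (LEAST i. t i \<noteq> 0) \<noteq> 0"
proof -
  have "\<exists>i\<le>p. t i \<noteq> 0"
  proof (rule ccontr)
    assume "\<not> ?thesis"
    then have "(\<Sum>i\<le>p. t i) = 0" by (intro sum.neutral) auto
    then show False using assms by (simp add: standard_simplex_def)
  qed
  then obtain i where i: "i \<le> p" "t i \<noteq> 0" by blast
  show "t (LEAST i. t i \<noteq> 0) \<noteq> 0" using LeastI[of "\<lambda>i. t i \<noteq> 0", OF i(2)] .
  have "(LEAST i. t i \<noteq> 0) \<le> i" using i(2) by (rule Least_le)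
  then show "(LEAST i. t i \<noteq> 0) \<le> p" using i(1) by simp
qed

lemma Least_basis_point: "(LEAST j. basis_point i j \<noteq> 0) = i"
  by (rule Least_equality) (auto split: if_splits)

lemma order_simplex_basis_point: "i \<le> p \<Longrightarrow> order_simplex p x (basis_point i) = x i"
  using Least_basis_point[of i] by (simp add: order_simplex_def)

lemma order_simplex_image: "order_simplex p x ` standard_simplex p = x ` {..p}"
proof
  show "order_simplex p x ` standard_simplex p \<subseteq> x ` {..p}"
    using Least_support(1) by (auto simp: order_simplex_def)
  show "x ` {..p} \<subseteq> order_simplex p x ` standard_simplex p"
  proof
    fix y assume "y \<in> x ` {..p}"
    then obtain i where "i \<le> p" "y = x i" by auto
    then show "y \<in> order_simplex p x ` standard_simplex p"
      using order_simplex_basis_point[of i p x] by (intro image_eqI[where x = "basis_point i"]) auto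
  qed
qed

lemma order_simplex_cong: "(\<And>i. i \<le> p \<Longrightarrow> x i = y i) \<Longrightarrow> order_simplex p x = order_simplex p y"
  using Least_support(1) unfolding order_simplex_def by (intro restrict_ext) blast

lemma strict_chain_le:
  assumes "strict_chain X p x" "i \<le> j" "j \<le> p"
  shows "space_le X (x i) (x j)"
  using assms space_le_refl[of "x j" X] by (cases "i = j") (auto simp: strict_chain_def space_less_def)

lemma strict_chain_inj: "strict_chain X p x \<Longrightarrow> inj_on x {..p}"
proof (rule linorder_inj_onI)
  fix i j assume "strict_chain X p x" "i < j" "i \<in> {..p}" "j \<in> {..p}"
  then show "x i \<noteq> x j" by (auto simp: strict_chain_def space_less_def)
qed auto

lemma strict_chain_subtopology:
  "strict_chain (subtopology X A) p x \<longleftrightarrow> strict_chain X p x \<and> x ` {..p} \<subseteq> A"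
proof
  assume x: "strict_chain (subtopology X A) p x"
  then show "strict_chain X p x \<and> x ` {..p} \<subseteq> A"
    unfolding strict_chain_def space_less_subtopology by auto
next
  assume x: "strict_chain X p x \<and> x ` {..p} \<subseteq> A"
  then have "x i \<in> A" if "i \<le> p" for i using that by blast
  then show "strict_chain (subtopology X A) p x"
    using x unfolding strict_chain_def space_less_subtopology by auto
qed

text \<open>
  The preimage of an open set \<open>U\<close> is the union of the open sets \<open>{t. t i \<noteq> 0}\<close> over all \<open>i\<close> with \<open>x i \<in> U\<close>: if
  \<open>t i \<noteq> 0\<close>, then the value at \<open>t\<close> is at most \<open>x i\<close>, and \<open>U\<close> is a lower set.
\<close>

lemma singular_simplex_order_simplex:
  assumes x: "strict_chain X p x"
  shows "singular_simplex p X (order_simplex p x)"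
proof -
  let ?D = "subtopology (powertop_real UNIV) (standard_simplex p)"
  have "continuous_map ?D X (order_simplex p x)"
    unfolding continuous_map_def
  proof (intro conjI allI impI)
    show "order_simplex p x \<in> topspace ?D \<rightarrow> topspace X"
      using x Least_support(1) by (auto simp: order_simplex_def strict_chain_def)
    fix U assume U: "openin X U"
    have "{t \<in> topspace ?D. order_simplex p x t \<in> U} =
        standard_simplex p \<inter> (\<Union>i\<in>{i. i \<le> p \<and> x i \<in> U}. {t \<in> topspace (powertop_real UNIV). t i \<in> - {0}})"
    proof (intro equalityI subsetI)
      fix t assume t: "t \<in> {t \<in> topspace ?D. order_simplex p x t \<in> U}"
      then have s: "t \<in> standard_simplex p" "x (LEAST i. t i \<noteq> 0) \<in> U" by (auto simp: order_simplex_def)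
      then show "t \<in> standard_simplex p \<inter> (\<Union>i\<in>{i. i \<le> p \<and> x i \<in> U}. {t \<in> topspace (powertop_real UNIV). t i \<in> - {0}})"
        using Least_support[OF s(1)] by auto
    next
      fix t assume "t \<in> standard_simplex p \<inter> (\<Union>i\<in>{i. i \<le> p \<and> x i \<in> U}. {t \<in> topspace (powertop_real UNIV). t i \<in> - {0}})"
      then obtain i where i: "t \<in> standard_simplex p" "i \<le> p" "x i \<in> U" "t i \<noteq> 0" by auto
      have "(LEAST i. t i \<noteq> 0) \<le> i" using i(4) by (rule Least_le)
      then have "space_le X (x (LEAST i. t i \<noteq> 0)) (x i)" using strict_chain_le[OF x] i(2) by blast
      then have "x (LEAST i. t i \<noteq> 0) \<in> U" using U i(3) by (auto simp: space_le_iff)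
      then show "t \<in> {t \<in> topspace ?D. order_simplex p x t \<in> U}" using i(1) by (simp add: order_simplex_def)
    qed
    moreover have "openin (powertop_real UNIV) {t \<in> topspace (powertop_real UNIV). t i \<in> - {0 :: real}}" for i :: nat
      by (rule openin_continuous_map_preimage[OF continuous_map_product_projection]) auto
    ultimately show "openin ?D {t \<in> topspace ?D. order_simplex p x t \<in> U}"
      by (simp only:) (intro openin_subtopology_Int2 openin_Union; blast)
  qed
  then show ?thesis by (simp add: singular_simplex_def order_simplex_def)
qed

lemma order_simplices_subset_singular: "order_simplices p X \<subseteq> singular_simplex_set p X"
  by (auto simp: order_simplices_def singular_simplex_order_simplex)

lemma order_chains_singular: "c \<in> order_chains p X \<Longrightarrow> singular_chain p X c"
  using order_simplices_subset_singular by (auto simp: order_chains_def frags_def singular_chain_def)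

lemma order_simplices_subtopology:
  "order_simplices p (subtopology X A) = {\<sigma> \<in> order_simplices p X. \<sigma> ` standard_simplex p \<subseteq> A}"
proof -
  have "(strict_chain X p x \<and> x ` {..p} \<subseteq> A) \<longleftrightarrow>
      (strict_chain X p x \<and> order_simplex p x ` standard_simplex p \<subseteq> A)" for x
    by (simp only: order_simplex_image)
  then show ?thesis unfolding order_simplices_def strict_chain_subtopology by blast
qed

lemma order_chains_subtopology:
  assumes "c \<in> order_chains p X" "singular_chain p (subtopology X A) c"
  shows "c \<in> order_chains p (subtopology X A)"
  using assms unfolding order_chains_def frags_def order_simplices_subtopology singular_chain_subtopology
  by blast

lemma order_chains_mono:
  assumes "c \<in> order_chains p (subtopology X A)" "A \<subseteq> B"
  shows "c \<in> order_chains p (subtopology X B)"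
  using assms unfolding order_chains_def frags_def order_simplices_subtopology by blast

lemma order_chains_subset: "c \<in> order_chains p (subtopology X A) \<Longrightarrow> c \<in> order_chains p X"
  unfolding order_chains_def frags_def order_simplices_subtopology by blast

lemma diff_closed_order_chains [simp]: "diff_closed (order_chains p X)"
  by (simp add: order_chains_def)

text \<open>
  The coface map: the increasing enumeration of the indices other than \<open>k\<close>.
\<close>

definition skip :: "nat \<Rightarrow> nat \<Rightarrow> nat" where
  "skip k i = (if i < k then i else Suc i)"

lemma singular_face_order_simplex:
  assumes "k \<le> Suc p"
  shows "singular_face (Suc p) k (order_simplex (Suc p) x) = order_simplex p (x \<circ> skip k)"
proof
  fix t
  show "singular_face (Suc p) k (order_simplex (Suc p) x) t = order_simplex p (x \<circ> skip k) t"
  proof (cases "t \<in> standard_simplex p")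
    case t: True
    have s: "simplical_face k t \<in> standard_simplex (Suc p)"
      using simplical_face_in_standard_simplex[of "Suc p" k t] t assms by simp
    have "(LEAST i. simplical_face k t i \<noteq> 0) = skip k (LEAST i. t i \<noteq> 0)"
    proof (rule Least_equality)
      show "simplical_face k t (skip k (LEAST i. t i \<noteq> 0)) \<noteq> 0"
        using Least_support(2)[OF t] by (auto simp: simplical_face_def skip_def)
    next
      fix j assume j: "simplical_face k t j \<noteq> 0"
      define i where "i = (if j < k then j else j - 1)"
      have i: "j = skip k i" "t i \<noteq> 0"
        using j by (auto simp: i_def simplical_face_def skip_def split: if_splits)
      have "(LEAST i. t i \<noteq> 0) \<le> i" using i(2) by (rule Least_le)
      then show "skip k (LEAST i. t i \<noteq> 0) \<le> j" using i(1) by (auto simp: skip_def)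
    qed
    then show ?thesis using t s by (simp add: singular_face_def order_simplex_def)
  qed (simp add: singular_face_def order_simplex_def)
qed

lemma strict_chain_skip:
  assumes "strict_chain X (Suc p) x"
  shows "strict_chain X p (x \<circ> skip k)"
  using assms by (auto simp: strict_chain_def skip_def)

lemma singular_face_order_simplices:
  assumes "\<sigma> \<in> order_simplices (Suc p) X" "k \<le> Suc p"
  shows "singular_face (Suc p) k \<sigma> \<in> order_simplices p X"
proof -
  obtain x where x: "strict_chain X (Suc p) x" "\<sigma> = order_simplex (Suc p) x"
    using assms(1) by (auto simp: order_simplices_def)
  then show ?thesis
    unfolding order_simplices_def using singular_face_order_simplex[OF assms(2), of x] strict_chain_skip[OF x(1), of k]
    by (intro image_eqI[where x = "x \<circ> skip k"]) auto
qed

lemma order_chains_induct [consumes 1, case_names zero one diff]: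
  assumes "c \<in> order_chains p X" "P 0" "\<And>\<sigma>. \<sigma> \<in> order_simplices p X \<Longrightarrow> P (frag_of \<sigma>)"
    "\<And>a b. P a \<Longrightarrow> P b \<Longrightarrow> P (a - b)"
  shows "P c"
proof -
  have "Poly_Mapping.keys c \<subseteq> order_simplices p X" using assms(1) by (simp add: order_chains_def frags_def)
  then show ?thesis by (induction c rule: frag_induction) (use assms in auto)
qed

lemma chain_boundary_order_chains:
  "c \<in> order_chains (Suc p) X \<Longrightarrow> chain_boundary (Suc p) c \<in> order_chains p X"
proof (induction rule: order_chains_induct)
  case zero
  show ?case by (simp add: diff_closedD(1))
next
  case (one \<sigma>)
  then show ?case
    unfolding chain_boundary_of order_chains_def
    by (auto simp: singular_face_order_simplices simp del: sum.atMost_Suc intro!: diff_closed_sum diff_closed_cmul)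
next
  case (diff a b)
  then show ?case by (simp add: chain_boundary_diff diff_closedD(2))
qed

lemma finite_order_simplices: "finite (topspace X) \<Longrightarrow> finite (order_simplices p X)"
proof -
  assume X: "finite (topspace X)"
  have "order_simplices p X \<subseteq> order_simplex p ` ({..p} \<rightarrow>\<^sub>E topspace X)"
  proof
    fix \<sigma> assume "\<sigma> \<in> order_simplices p X"
    then obtain x where x: "strict_chain X p x" "\<sigma> = order_simplex p x" by (auto simp: order_simplices_def)
    then have "\<sigma> = order_simplex p (restrict x {..p})" by (auto intro: order_simplex_cong)
    moreover have "restrict x {..p} \<in> {..p} \<rightarrow>\<^sub>E topspace X" using x(1) by (auto simp: strict_chain_def)
    ultimately show "\<sigma> \<in> order_simplex p ` ({..p} \<rightarrow>\<^sub>E topspace X)" by blast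
  qed
  then show ?thesis using X by (meson finite_PiE finite_atMost finite_imageI finite_subset)
qed

lemma order_simplices_high_dimension:
  assumes "finite (topspace X)" "card (topspace X) \<le> p"
  shows "order_simplices p X = {}"
proof -
  have False if x: "strict_chain X p x" for x
  proof -
    have "x ` {..p} \<subseteq> topspace X" using x by (auto simp: strict_chain_def)
    then have "card (x ` {..p}) \<le> card (topspace X)" using assms(1) by (rule card_mono[rotated])
    then show False using assms(2) by (simp add: card_image[OF strict_chain_inj[OF x]])
  qed
  then show ?thesis by (auto simp: order_simplices_def)
qed

section \<open>Acyclic spaces on the level of chains\<close>

text \<open>
  Acyclicity in the form used for constructing chains. In degree \<open>0\<close> it is path connectedness, so that
  no augmentation is needed.
\<close>

definition chain_acyclic :: "'a topology \<Rightarrow> bool" where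
  "chain_acyclic X \<longleftrightarrow> topspace X \<noteq> {} \<and> path_connected_space X \<and>
    (\<forall>p z. 0 < p \<longrightarrow> singular_chain p X z \<longrightarrow> chain_boundary p z = 0 \<longrightarrow>
       (\<exists>w. singular_chain (Suc p) X w \<and> chain_boundary (Suc p) w = z))"

lemma acyclic_space_imp_chain_acyclic:
  assumes "acyclic_space X"
  shows "chain_acyclic X"
proof -
  have iso: "homology_group p X \<cong> homology_group p (discrete_topology {()})" for p
    using assms by (simp add: acyclic_space_def)
  have eq: "path_components_of X \<approx> path_components_of (discrete_topology {()})"
    by (rule isomorphic_homology_imp_path_components[OF iso])
  have "topspace X \<noteq> {}"
  proof
    assume "topspace X = {}"
    then have "path_components_of X = {}" by (simp add: path_components_of_eq_empty null_topspace_iff_trivial)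
    moreover have "path_components_of (discrete_topology {()}) \<noteq> {}"
      by (simp add: path_components_of_eq_empty flip: null_topspace_iff_trivial)
    ultimately show False using eq unfolding eqpoll_def by (auto simp: bij_betw_def)
  qed
  moreover have "path_connected_space X"
    using isomorphic_homology_imp_path_connectedness[OF iso]
    by (simp add: contractible_imp_path_connected_space)
  moreover have "\<exists>w. singular_chain (Suc p) X w \<and> chain_boundary (Suc p) w = z"
    if p: "0 < p" and z: "singular_chain p X z" "chain_boundary p z = 0" for p z
  proof -
    have "trivial_group (homology_group (int p) (discrete_topology {()}))"
      by (rule homology_dimension_axiom[where a = "()"]) (use p in auto)
    then have "trivial_group (homology_group (int p) X)"
      using isomorphic_group_triviality[OF iso] by simp
    moreover have "homologous_rel_set p X {} z \<in> carrier (homology_group (int p) X)"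
      using z unfolding carrier_relative_homology_group singular_cycle by blast
    ultimately have "homologous_rel_set p X {} z = singular_relboundary_set p X {}"
      by (auto simp: trivial_group_def)
    then show ?thesis by (simp add: homologous_rel_set_eq_relboundary singular_boundary)
  qed
  ultimately show ?thesis by (simp add: chain_acyclic_def)
qed

lemma contractible_imp_chain_acyclic:
  assumes "contractible_space X" "topspace X \<noteq> {}"
  shows "chain_acyclic X"
proof -
  obtain a where a: "a \<in> topspace X" using assms(2) by blast
  let ?P = "discrete_topology {()}"
  have "homotopic_with (\<lambda>x. True) X X id (\<lambda>x. a)"
    using assms(1) a by (simp add: contractible_space_alt)
  then have "homotopic_with (\<lambda>x. True) X X ((\<lambda>_. a) \<circ> (\<lambda>_. ())) id"
    by (simp add: o_def homotopic_with_symD)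
  moreover have "homotopic_with (\<lambda>x. True) ?P ?P ((\<lambda>_. ()) \<circ> (\<lambda>_. a)) id"
    by (rule homotopic_with_equal) (auto simp: continuous_map_def)
  ultimately have "X homotopy_equivalent_space ?P"
    unfolding homotopy_equivalent_space_def using a
    by (intro exI[of _ "\<lambda>_. ()"] exI[of _ "\<lambda>_. a"] conjI) (simp_all add: continuous_map_def)
  then have "acyclic_space X"
    unfolding acyclic_space_def by (intro allI homotopy_equivalent_space_imp_isomorphic_homology_groups)
  then show ?thesis by (rule acyclic_space_imp_chain_acyclic)
qed

text \<open>
  The homotopy stays at the identity for \<open>t < 1\<close> and jumps to the maximum at \<open>t = 1\<close>. It is continuous
  because the only open set containing the maximum is the whole space.
\<close>

lemma contractible_space_if_maximum:
  assumes m: "m \<in> topspace X" and le: "\<And>x. x \<in> topspace X \<Longrightarrow> space_le X x m"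
  shows "contractible_space X"
proof -
  let ?I = "subtopology euclideanreal {0..1}"
  define h where "h = (\<lambda>(t :: real, x). if t < 1 then x else m)"
  have "continuous_map (prod_topology ?I X) X h"
    unfolding continuous_map_def
  proof (intro conjI allI impI)
    show "h \<in> topspace (prod_topology ?I X) \<rightarrow> topspace X" using m by (auto simp: h_def)
    fix U assume U: "openin X U"
    show "openin (prod_topology ?I X) {z \<in> topspace (prod_topology ?I X). h z \<in> U}"
    proof (cases "m \<in> U")
      case True
      then have "topspace X \<subseteq> U" using le U by (auto simp: space_le_iff)
      then have "{z \<in> topspace (prod_topology ?I X). h z \<in> U} = topspace (prod_topology ?I X)"
        using m by (auto simp: h_def)
      then show ?thesis by (metis openin_topspace)
    next
      case False
      then have "{z \<in> topspace (prod_topology ?I X). h z \<in> U} = {t \<in> {0..1}. t < 1} \<times> U"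
        using openin_subset[OF U] by (auto simp: h_def split: if_splits)
      moreover have "openin ?I {t \<in> {0..1}. t < 1}"
        unfolding openin_subtopology by (intro exI[of _ "{..<1}"]) auto
      ultimately show ?thesis using U by (simp add: openin_prod_Times_iff)
    qed
  qed
  then have "homotopic_with (\<lambda>x. True) X X id (\<lambda>x. m)"
    by (subst homotopic_with) (auto simp: h_def intro!: exI[of _ h])
  then show ?thesis unfolding contractible_space_def by blast
qed

lemma homologous_multiple_of_vertex:
  assumes X: "path_connected_space X" and v: "singular_simplex 0 X v" and s: "singular_chain 0 X s"
  shows "\<exists>t. singular_chain (Suc 0) X t \<and> chain_boundary (Suc 0) t = s - frag_extend (\<lambda>_. frag_of v) s"
proof -
  have "Poly_Mapping.keys s \<subseteq> singular_simplex_set 0 X" using s by (simp add: singular_chain_def)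
  then have "homologous_rel 0 X {} s (frag_extend (\<lambda>_. frag_of v) s)"
  proof (induction s rule: frag_induction)
    case (one \<sigma>)
    then show ?case using iso_integer_zeroth_homology_group_aux[OF X _ v] by simp
  next
    case (diff a b)
    then show ?case by (simp add: frag_extend_diff homologous_rel_diff)
  qed simp
  then show ?thesis by (simp add: homologous_rel_def singular_boundary)
qed

text \<open>
  Here \<open>frag_extend (\<lambda>_. c)\<close> is the augmentation times \<open>c\<close>. It vanishes on the boundary of an edge because the two
  ends have opposite signs.
\<close>

lemma augmentation_boundary:
  "frag_extend (\<lambda>_. c) (chain_boundary (Suc 0) d) = 0"
  using subset_UNIV
proof (induction d rule: frag_induction)
  case (one \<sigma>)
  show ?case by (simp add: chain_boundary_of frag_extend_diff)
next
  case (diff a b)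
  then show ?case by (simp add: chain_boundary_diff frag_extend_diff)
qed simp

section \<open>Order chains compute singular homology\<close>

text \<open>
  The quotient of the singular complex by the subcomplex of order chains is acyclic. This one statement
  contains both halves of the comparison: for a cycle \<open>s\<close> it yields a homologous order cycle, and if the boundary of
  \<open>s\<close> is an order chain, then that chain is already the boundary of an order chain. In degree \<open>0\<close> the condition on the
  boundary is empty, since \<open>chain_boundary 0\<close> is zero.
\<close>

definition order_chains_suffice :: "'a topology \<Rightarrow> bool" where
  "order_chains_suffice X \<longleftrightarrow>
    (\<forall>p s. singular_chain p X s \<longrightarrow> chain_boundary p s \<in> order_chains (p - Suc 0) X \<longrightarrow>
       (\<exists>t. singular_chain (Suc p) X t \<and> s - chain_boundary (Suc p) t \<in> order_chains p X))"

lemma order_boundary_if_singular_boundary: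
  assumes suff: "order_chains_suffice X" and z: "z \<in> order_chains q X"
    and w: "singular_chain (Suc q) X w" "chain_boundary (Suc q) w = z"
  shows "\<exists>w\<in>order_chains (Suc q) X. chain_boundary (Suc q) w = z"
proof -
  have "chain_boundary (Suc q) w \<in> order_chains (Suc q - Suc 0) X" using w z by simp
  then obtain t where t: "singular_chain (Suc (Suc q)) X t" "w - chain_boundary (Suc (Suc q)) t \<in> order_chains (Suc q) X"
    using suff w(1) unfolding order_chains_suffice_def by blast
  moreover have "chain_boundary (Suc q) (w - chain_boundary (Suc (Suc q)) t) = z"
    using chain_boundary_boundary_alt[OF t(1)] w(2) by (simp add: chain_boundary_diff)
  ultimately show ?thesis by blast
qed

definition append_vertex :: "'a \<Rightarrow> nat \<Rightarrow> (nat \<Rightarrow> 'a) \<Rightarrow> nat \<Rightarrow> 'a" where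
  "append_vertex m p x = (\<lambda>i. if i \<le> p then x i else m)"

text \<open>
  The cone with apex \<open>m\<close>, where \<open>m\<close> is the last vertex. A simplex that contains \<open>m\<close> already would give a
  degenerate simplex, so its cone is zero.
\<close>

definition chain_cone :: "'a \<Rightarrow> nat \<Rightarrow> 'a chain \<Rightarrow> 'a chain" where
  "chain_cone m p = frag_extend (\<lambda>\<sigma>. if m \<in> \<sigma> ` standard_simplex p then 0
     else frag_of (order_simplex (Suc p) (append_vertex m p (\<lambda>i. \<sigma> (basis_point i)))))"

lemma chain_cone_order_simplex:
  "chain_cone m p (frag_of (order_simplex p x)) =
     (if m \<in> x ` {..p} then 0 else frag_of (order_simplex (Suc p) (append_vertex m p x)))"
proof -
  have "order_simplex (Suc p) (append_vertex m p (\<lambda>i. order_simplex p x (basis_point i))) =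
      order_simplex (Suc p) (append_vertex m p x)"
    by (rule order_simplex_cong) (simp add: append_vertex_def order_simplex_basis_point)
  then show ?thesis by (simp add: chain_cone_def order_simplex_image)
qed

context
  fixes X :: "'a topology" and m :: 'a
  assumes T0: "t0_space X" and mX: "m \<in> topspace X"
    and maximum: "\<And>x. x \<in> topspace X \<Longrightarrow> space_le X x m"
begin

lemma strict_chain_append_vertex:
  assumes "strict_chain X p x" "m \<notin> x ` {..p}"
  shows "strict_chain X (Suc p) (append_vertex m p x)"
proof -
  have "x i \<noteq> m" "x i \<in> topspace X" if "i \<le> p" for i
    using assms that by (auto simp: strict_chain_def)
  then have "space_less X (x i) m" if "i \<le> p" for i
    using maximum that by (simp add: space_less_def)
  then show ?thesis
    using assms(1) mX unfolding strict_chain_def append_vertex_def by (auto simp: le_Suc_eq)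
qed

lemma chain_cone_order_chains:
  assumes "c \<in> order_chains p X"
  shows "chain_cone m p c \<in> order_chains (Suc p) X"
  using assms
proof (induction rule: order_chains_induct)
  case zero
  show ?case by (simp add: chain_cone_def diff_closedD(1))
next
  case (one \<sigma>)
  then obtain x where "strict_chain X p x" "\<sigma> = order_simplex p x" by (auto simp: order_simplices_def)
  then show ?case
    using strict_chain_append_vertex[of p x] diff_closedD(1)[OF diff_closed_order_chains[of "Suc p" X]]
    by (auto simp: chain_cone_order_simplex order_chains_def order_simplices_def)
next
  case (diff a b)
  then show ?case by (simp add: chain_cone_def frag_extend_diff diff_closedD(2))
qed

lemma maximum_is_last_vertex:
  assumes x: "strict_chain X p x" and m: "m \<in> x ` {..p}"
  shows "x p = m" "\<And>i. i < p \<Longrightarrow> x i \<noteq> m"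
proof -
  obtain i where i: "i \<le> p" "x i = m" using m by auto
  have "i = p"
  proof (rule ccontr)
    assume "i \<noteq> p"
    then have "space_less X m (x p)" "x p \<in> topspace X" using x i by (auto simp: strict_chain_def)
    then show False using maximum[of "x p"] space_le_antisym[OF T0] by (auto simp: space_less_def)
  qed
  then show "x p = m" using i by simp
  then show "x i \<noteq> m" if "i < p" for i using x that by (auto simp: strict_chain_def space_less_def)
qed

text \<open>
  If \<open>m\<close> is not a vertex, the last face of the cone is the simplex itself and the other faces are the cones of
  its faces. If \<open>m\<close> is a vertex, it is the last one and the cone is zero; then all faces but the last contain
  \<open>m\<close>, and the cone of the last face is the simplex, so that the two terms on the right cancel.
\<close>

lemma chain_boundary_cone_order_simplex:
  assumes x: "strict_chain X (Suc q) x"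
  shows "chain_boundary (Suc (Suc q)) (chain_cone m (Suc q) (frag_of (order_simplex (Suc q) x))) =
    chain_cone m q (chain_boundary (Suc q) (frag_of (order_simplex (Suc q) x))) +
    frag_cmul ((-1) ^ q) (frag_of (order_simplex (Suc q) x))"
proof -
  let ?s = "order_simplex (Suc q) x"
  have face: "singular_face (Suc q) k ?s = order_simplex q (x \<circ> skip k)" if "k \<le> Suc q" for k
    by (rule singular_face_order_simplex[OF that])
  have cone_bd: "chain_cone m q (chain_boundary (Suc q) (frag_of ?s)) =
      (\<Sum>k\<le>Suc q. frag_cmul ((-1) ^ k) (chain_cone m q (frag_of (order_simplex q (x \<circ> skip k)))))"
  proof -
    have "chain_boundary (Suc q) (frag_of ?s) =
        (\<Sum>k\<le>Suc q. frag_cmul ((-1) ^ k) (frag_of (order_simplex q (x \<circ> skip k))))"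
      unfolding chain_boundary_of using face by (auto intro!: sum.cong simp del: sum.atMost_Suc)
    then show ?thesis
      by (simp only: chain_cone_def frag_extend_sum[OF finite_atMost] o_def frag_extend_cmul)
  qed
  show ?thesis
  proof (cases "m \<in> x ` {..Suc q}")
    case True
    note last = maximum_is_last_vertex[OF x True]
    have "chain_cone m q (frag_of (order_simplex q (x \<circ> skip k))) = 0" if "k \<le> q" for k
    proof -
      have "(x \<circ> skip k) q = m" using that last(1) by (simp add: skip_def)
      then have "m \<in> (x \<circ> skip k) ` {..q}" by (metis atMost_iff image_eqI order_refl)
      then show ?thesis by (simp add: chain_cone_order_simplex)
    qed
    moreover have "chain_cone m q (frag_of (order_simplex q (x \<circ> skip (Suc q)))) = frag_of ?s"
    proof -
      have "x i \<noteq> m" if "i \<le> q" for i using last(2)[of i] that by simp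
      then have "m \<notin> (x \<circ> skip (Suc q)) ` {..q}" by (force simp: skip_def)
      moreover have "order_simplex (Suc q) (append_vertex m q (x \<circ> skip (Suc q))) = ?s"
        by (rule order_simplex_cong) (auto simp: append_vertex_def skip_def last(1) le_Suc_eq)
      ultimately show ?thesis by (simp add: chain_cone_order_simplex)
    qed
    ultimately have "chain_cone m q (chain_boundary (Suc q) (frag_of ?s)) = frag_cmul ((-1) ^ Suc q) (frag_of ?s)"
      unfolding cone_bd by simp
    moreover have "frag_cmul ((-1) ^ Suc q) c + frag_cmul ((-1) ^ q) c = 0" for c :: "'a chain"
      by (simp flip: frag_cmul_distrib)
    ultimately show ?thesis using True by (simp add: chain_cone_order_simplex)
  next
    case False
    let ?x = "append_vertex m (Suc q) x"
    have "singular_face (Suc (Suc q)) (Suc (Suc q)) (order_simplex (Suc (Suc q)) ?x) = ?s"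
      unfolding singular_face_order_simplex[OF order_refl]
      by (rule order_simplex_cong) (auto simp: append_vertex_def skip_def)
    moreover have "frag_of (singular_face (Suc (Suc q)) k (order_simplex (Suc (Suc q)) ?x)) =
        chain_cone m q (frag_of (order_simplex q (x \<circ> skip k)))" if k: "k \<le> Suc q" for k
    proof -
      have "(x \<circ> skip k) ` {..q} \<subseteq> x ` {..Suc q}" by (auto simp: skip_def)
      then have "m \<notin> (x \<circ> skip k) ` {..q}" using False by blast
      moreover have "order_simplex (Suc q) (?x \<circ> skip k) = order_simplex (Suc q) (append_vertex m q (x \<circ> skip k))"
        by (rule order_simplex_cong) (use k in \<open>auto simp: append_vertex_def skip_def\<close>)
      ultimately show ?thesis
        using k singular_face_order_simplex[of k "Suc q" ?x] by (simp add: chain_cone_order_simplex)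
    qed
    ultimately show ?thesis
      using False unfolding cone_bd by (simp add: chain_cone_order_simplex chain_boundary_of)
  qed
qed

lemma chain_boundary_cone:
  assumes "c \<in> order_chains (Suc q) X"
  shows "chain_boundary (Suc (Suc q)) (chain_cone m (Suc q) c) =
    chain_cone m q (chain_boundary (Suc q) c) + frag_cmul ((-1) ^ q) c"
  using assms
proof (induction rule: order_chains_induct)
  case (one \<sigma>)
  then show ?case using chain_boundary_cone_order_simplex by (auto simp: order_simplices_def)
next
  case (diff a b)
  then show ?case
    by (simp add: chain_cone_def frag_extend_diff chain_boundary_diff frag_cmul_diff_distrib2)
qed (simp add: chain_cone_def)

lemma chain_boundary_cone_0:
  assumes "c \<in> order_chains 0 X"
  shows "chain_boundary (Suc 0) (chain_cone m 0 c) = frag_extend (\<lambda>_. frag_of (order_simplex 0 (\<lambda>_. m))) c - c"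
  using assms
proof (induction rule: order_chains_induct)
  case (one \<sigma>)
  then obtain x where x: "strict_chain X 0 x" "\<sigma> = order_simplex 0 x" by (auto simp: order_simplices_def)
  have "order_simplex 0 x = order_simplex 0 (\<lambda>_. m)" if "x 0 = m"
    by (rule order_simplex_cong) (simp add: that)
  moreover have "order_simplex 0 (append_vertex m 0 x \<circ> skip (Suc 0)) = order_simplex 0 x"
    by (rule order_simplex_cong) (simp add: append_vertex_def skip_def)
  moreover have "order_simplex 0 (append_vertex m 0 x \<circ> skip 0) = order_simplex 0 (\<lambda>_. m)"
    by (rule order_simplex_cong) (simp add: append_vertex_def skip_def)
  ultimately show ?case
    by (auto simp: x(2) chain_cone_order_simplex chain_boundary_of singular_face_order_simplex)
next
  case (diff a b)
  then show ?case
    by (simp add: chain_cone_def frag_extend_diff chain_boundary_diff)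
qed (simp add: chain_cone_def)

text \<open>
  The singular complex is acyclic by contractibility and the complex of order chains by the cone operator. In positive
  degrees, the cycle \<open>\<partial> s\<close> is therefore the boundary of an order chain \<open>c\<close>, and the cycle \<open>s - c\<close> bounds. In degree \<open>0\<close>,
  \<open>s\<close> is homologous to a multiple of the vertex \<open>m\<close>.
\<close>

lemma order_chains_suffice_maximum: "order_chains_suffice X"
  unfolding order_chains_suffice_def
proof (intro allI impI)
  fix p s assume s: "singular_chain p X s" and bd: "chain_boundary p s \<in> order_chains (p - Suc 0) X"
  have acyc: "chain_acyclic X"
    using contractible_imp_chain_acyclic contractible_space_if_maximum[OF mX maximum] mX by blast
  let ?m = "order_simplex 0 (\<lambda>_. m)"
  have m: "?m \<in> order_simplices 0 X"
    using mX by (auto simp: order_simplices_def strict_chain_def)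
  show "\<exists>t. singular_chain (Suc p) X t \<and> s - chain_boundary (Suc p) t \<in> order_chains p X"
  proof (cases p)
    case 0
    have "path_connected_space X" using acyc by (simp add: chain_acyclic_def)
    then obtain t where t: "singular_chain (Suc 0) X t"
      "chain_boundary (Suc 0) t = s - frag_extend (\<lambda>_. frag_of ?m) s"
      using homologous_multiple_of_vertex[of X ?m s] s 0 m order_simplices_subset_singular by blast
    have "frag_extend (\<lambda>_. frag_of ?m) s \<in> order_chains 0 X"
      unfolding frag_extend_def order_chains_def using m by (intro diff_closed_sum diff_closed_cmul) auto
    then show ?thesis using t 0 by (intro exI[of _ t]) simp
  next
    case (Suc q)
    have "\<exists>c\<in>order_chains p X. chain_boundary p c = chain_boundary p s"
    proof (cases q)
      case 0
      (* In degree 0 the cone operator reproduces a chain only up to its augmentation, which vanishes on boundaries. *)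
      let ?c = "- chain_cone m 0 (chain_boundary p s)"
      have "chain_boundary (Suc 0) ?c = chain_boundary p s"
        using chain_boundary_cone_0[of "chain_boundary p s"] bd augmentation_boundary[of _ s] Suc 0
        by (simp add: chain_boundary_minus)
      moreover have "?c \<in> order_chains p X"
        using chain_cone_order_chains[of "chain_boundary p s" 0] bd Suc 0 by (simp add: diff_closedD(3))
      ultimately show ?thesis using Suc 0 by blast
    next
      case (Suc q')
      with \<open>p = Suc q\<close> have p: "p = Suc (Suc q')" by simp
      let ?c = "frag_cmul ((-1) ^ q') (chain_cone m (Suc q') (chain_boundary p s))"
      have "chain_boundary (Suc q') (chain_boundary p s) = 0"
        using chain_boundary_boundary_alt s p by blast
      then have "chain_boundary p ?c = chain_boundary p s"
        using chain_boundary_cone[of "chain_boundary p s" q'] bd p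
        by (simp add: chain_boundary_cmul chain_cone_def flip: power_add)
      moreover have "?c \<in> order_chains p X"
        using chain_cone_order_chains[of "chain_boundary p s" "Suc q'"] bd p
        by (simp add: diff_closed_cmul)
      ultimately show ?thesis by blast
    qed
    then obtain c where c: "c \<in> order_chains p X" "chain_boundary p c = chain_boundary p s" by blast
    have "singular_chain p X (s - c)" "chain_boundary p (s - c) = 0"
      using singular_chain_diff[OF s order_chains_singular[OF c(1)]] c(2) by (simp_all add: chain_boundary_diff)
    then obtain t where "singular_chain (Suc p) X t" "chain_boundary (Suc p) t = s - c"
      using acyc Suc unfolding chain_acyclic_def by blast
    then show ?thesis using c(1) by (intro exI[of _ t]) simp
  qed
qed

end

text \<open>
  The Mayer--Vietoris argument for the quotient complexes. Subdivision replaces \<open>s\<close>, up to a boundary, by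
  a sum of chains \<open>a\<close> in \<open>A\<close> and \<open>b\<close> in \<open>B\<close> with the same total boundary. Modulo order chains, the boundaries of \<open>a\<close> and \<open>b\<close>
  are opposite and lie in \<open>A \<inter> B\<close>, where the hypothesis on \<open>A \<inter> B\<close> provides a chain \<open>u\<close> that bounds them. The hypotheses on
  \<open>A\<close> and \<open>B\<close> then apply to \<open>a - u\<close> and \<open>b + u\<close>.
\<close>

lemma order_chains_suffice_union:
  fixes X :: "'a topology"
  assumes A: "openin X A" and B: "openin X B" and AB: "A \<union> B = topspace X"
    and split: "\<And>p. order_simplices p X \<subseteq> order_simplices p (subtopology X A) \<union> order_simplices p (subtopology X B)"
    and RA: "order_chains_suffice (subtopology X A)" and RB: "order_chains_suffice (subtopology X B)"
    and RAB: "order_chains_suffice (subtopology X (A \<inter> B))"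
  shows "order_chains_suffice X"
  unfolding order_chains_suffice_def
proof (intro allI impI)
  fix p s assume s: "singular_chain p X s" and bd: "chain_boundary p s \<in> order_chains (p - Suc 0) X"
  let ?A = "subtopology X A" and ?B = "subtopology X B" and ?AB = "subtopology X (A \<inter> B)"
  have inX: "singular_chain q X c" if "singular_chain q (subtopology X C) c" for q c C
    using that by (simp add: singular_chain_subtopology)
  obtain n where n: "\<And>k f. \<lbrakk>n \<le> k; f \<in> Poly_Mapping.keys ((singular_subdivision p ^^ k) s)\<rbrakk>
      \<Longrightarrow> \<exists>V\<in>{A, B}. f \<in> standard_simplex p \<rightarrow> V"
    by (rule sufficient_iterated_singular_subdivision_exists[of "{A, B}" X p s])
      (use A B AB s in auto)
  obtain h where h: "\<And>p. h p 0 = (0 :: 'a chain)"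
      "\<And>p c1 c2. h p (c1 - c2) = h p c1 - h p c2"
      "\<And>p X c. singular_chain p X c \<Longrightarrow> singular_chain (Suc p) X (h p c)"
      "\<And>p X c. singular_chain p X c \<Longrightarrow>
        chain_boundary (Suc p) (h p c) + h (p - Suc 0) (chain_boundary p c) = (singular_subdivision p ^^ n) c - c"
    by (rule chain_homotopic_iterated_singular_subdivision[of n]) blast
  have hadd: "h q (a + b) = h q a + h q b" for q a b
    using h(2)[of q a "- b"] h(2)[of q 0 b] h(1) by simp
  let ?sd = "(singular_subdivision p ^^ n) s"
  have sd: "singular_chain p X ?sd"
    by (induction n) (auto simp: s singular_chain_singular_subdivision)
  have "Poly_Mapping.keys ?sd \<subseteq> singular_simplex_set p ?A \<union> singular_simplex_set p ?B"
  proof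
    fix f assume f: "f \<in> Poly_Mapping.keys ?sd"
    then have "singular_simplex p X f" using sd by (auto simp: singular_chain_def)
    moreover have "f ` standard_simplex p \<subseteq> A \<or> f ` standard_simplex p \<subseteq> B" using n[OF order_refl f] by auto
    ultimately show "f \<in> singular_simplex_set p ?A \<union> singular_simplex_set p ?B"
      by (auto simp: singular_simplex_subtopology)
  qed
  then obtain a0 b0 where ab0: "singular_chain p ?A a0" "singular_chain p ?B b0" "a0 + b0 = ?sd"
    by (rule frag_split) (simp add: singular_chain_def)
  have "Poly_Mapping.keys (chain_boundary p s) \<subseteq>
      order_simplices (p - Suc 0) ?A \<union> order_simplices (p - Suc 0) ?B"
    using bd split unfolding order_chains_def frags_def by blast
  then obtain cA cB where c: "cA \<in> order_chains (p - Suc 0) ?A" "cB \<in> order_chains (p - Suc 0) ?B"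
    "cA + cB = chain_boundary p s"
    by (rule frag_split) (simp add: order_chains_def frags_def)
  (* Adding the boundary of h s instead of passing to the subdivision of s keeps the boundary of s unchanged.
     The correction term h (\<partial> s) is small as well, because the order chain \<partial> s is. *)
  have small: "\<exists>a b. singular_chain p ?A a \<and> singular_chain p ?B b \<and> s + chain_boundary (Suc p) (h p s) = a + b"
  proof (cases p)
    case 0
    then have "s + chain_boundary (Suc p) (h p s) = ?sd"
      using h(4)[OF s] by (simp add: chain_boundary_def h(1))
    then show ?thesis using ab0 by (intro exI[of _ a0] exI[of _ b0]) simp
  next
    case (Suc q)
    have "singular_chain p ?A (h q cA)" "singular_chain p ?B (h q cB)"
      using h(3)[OF order_chains_singular[OF c(1)]] h(3)[OF order_chains_singular[OF c(2)]] Suc by simp_all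
    then have "singular_chain p ?A (a0 - h q cA)" "singular_chain p ?B (b0 - h q cB)"
      by (simp_all add: singular_chain_diff ab0)
    moreover have "s + chain_boundary (Suc p) (h p s) = (a0 - h q cA) + (b0 - h q cB)"
    proof -
      have "h q (chain_boundary p s) = h q cA + h q cB" by (simp only: hadd flip: c(3))
      then show ?thesis using h(4)[OF s] ab0(3) Suc by (simp add: algebra_simps)
    qed
    ultimately show ?thesis by blast
  qed
  then obtain a b where ab: "singular_chain p ?A a" "singular_chain p ?B b"
    "s + chain_boundary (Suc p) (h p s) = a + b" by blast
  have "\<exists>u. singular_chain p ?AB u \<and> chain_boundary p (a - u) \<in> order_chains (p - Suc 0) ?A \<and>
     chain_boundary p (b + u) \<in> order_chains (p - Suc 0) ?B"
  proof (cases p)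
    case 0
    then show ?thesis by (intro exI[of _ 0]) (simp add: chain_boundary_def diff_closedD(1))
  next
    case (Suc q)
    (* The chain w lies in A by its definition and in B because it equals cB - \<partial> b. *)
    let ?w = "chain_boundary p a - cA"
    have bab: "chain_boundary p a + chain_boundary p b = cA + cB"
    proof -
      have "chain_boundary p (chain_boundary (Suc p) (h p s)) = 0"
        using chain_boundary_boundary_alt[OF h(3)[OF s]] .
      then have "chain_boundary p (a + b) = chain_boundary p s"
        unfolding ab(3)[symmetric] chain_boundary_add by simp
      then show ?thesis using c(3) by (simp add: chain_boundary_add)
    qed
    then have w2: "?w = cB - chain_boundary p b" by (simp add: algebra_simps)
    have "singular_chain q ?A ?w"
      using singular_chain_boundary[OF ab(1)] order_chains_singular[OF c(1)] Suc by (simp add: singular_chain_diff)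
    moreover have "singular_chain q ?B ?w"
      unfolding w2 using singular_chain_boundary[OF ab(2)] order_chains_singular[OF c(2)] Suc
      by (simp add: singular_chain_diff)
    ultimately have w: "singular_chain q ?AB ?w"
      unfolding singular_chain_subtopology by blast
    have "chain_boundary q (chain_boundary p a) = 0"
      using chain_boundary_boundary[OF ab(1)] Suc by simp
    then have bw: "chain_boundary q ?w = - chain_boundary q cA" by (simp add: chain_boundary_diff)
    have "chain_boundary q ?w \<in> order_chains (q - Suc 0) ?AB"
    proof (cases q)
      case 0
      then show ?thesis by (simp add: chain_boundary_def diff_closedD(1))
    next
      case (Suc q')
      have "chain_boundary q cA \<in> order_chains q' ?A"
        using chain_boundary_order_chains[of cA q'] c(1) \<open>p = Suc q\<close> Suc by simp
      then have "chain_boundary q ?w \<in> order_chains q' X"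
        unfolding bw by (rule diff_closedD(3)[OF diff_closed_order_chains order_chains_subset])
      then show ?thesis
        using singular_chain_boundary[OF w] Suc by (simp add: order_chains_subtopology)
    qed
    then obtain u where u: "singular_chain (Suc q) ?AB u" "?w - chain_boundary (Suc q) u \<in> order_chains q ?AB"
      using RAB w unfolding order_chains_suffice_def by blast
    let ?c = "?w - chain_boundary (Suc q) u"
    have cAB: "?c \<in> order_chains q ?A" "?c \<in> order_chains q ?B"
      using order_chains_mono[OF u(2), of A] order_chains_mono[OF u(2), of B] by simp_all
    have "chain_boundary p (a - u) = cA + ?c"
      using Suc by (simp add: chain_boundary_diff)
    moreover have "cA + ?c \<in> order_chains (p - Suc 0) ?A"
      by (rule diff_closedD(4)) (use c(1) cAB(1) Suc in simp_all)
    moreover have "chain_boundary p (b + u) = cB - ?c"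
      using Suc w2 by (simp add: chain_boundary_add algebra_simps)
    moreover have "cB - ?c \<in> order_chains (p - Suc 0) ?B"
      by (rule diff_closedD(2)) (use c(2) cAB(2) Suc in simp_all)
    ultimately show ?thesis
      using u(1) Suc by (intro exI[of _ u]) (simp only: simp_thms)
  qed
  then obtain u where u: "singular_chain p ?AB u" "chain_boundary p (a - u) \<in> order_chains (p - Suc 0) ?A"
     "chain_boundary p (b + u) \<in> order_chains (p - Suc 0) ?B" by blast
  have "singular_chain p ?A u" "singular_chain p ?B u"
    using singular_chain_mono[OF u(1), of A] singular_chain_mono[OF u(1), of B] by simp_all
  then have "singular_chain p ?A (a - u)" "singular_chain p ?B (b + u)"
    using ab(1,2) by (simp_all add: singular_chain_diff singular_chain_add)
  then obtain tA tB where tA: "singular_chain (Suc p) ?A tA" "a - u - chain_boundary (Suc p) tA \<in> order_chains p ?A"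
    and tB: "singular_chain (Suc p) ?B tB" "b + u - chain_boundary (Suc p) tB \<in> order_chains p ?B"
    using RA RB u(2,3) unfolding order_chains_suffice_def by blast
  let ?t = "tA + tB - h p s"
  have "singular_chain (Suc p) X ?t"
    using inX[OF tA(1)] inX[OF tB(1)] h(3)[OF s] by (intro singular_chain_diff singular_chain_add)
  moreover have "s - chain_boundary (Suc p) ?t =
      (a - u - chain_boundary (Suc p) tA) + (b + u - chain_boundary (Suc p) tB)"
    using ab(3) by (simp add: chain_boundary_diff chain_boundary_add algebra_simps)
  moreover have "\<dots> \<in> order_chains p X"
    using order_chains_subset[OF tA(2)] order_chains_subset[OF tB(2)] by (intro diff_closedD(4)) simp_all
  ultimately show "\<exists>t. singular_chain (Suc p) X t \<and> s - chain_boundary (Suc p) t \<in> order_chains p X"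
    by (intro exI[of _ ?t]) simp
qed

text \<open>
  Removing a maximal element \<open>m\<close> leaves an open set, and every chain that contains \<open>m\<close> lies in the minimal
  open neighbourhood of \<open>m\<close>. So the two open sets satisfy the hypotheses of \<open>order_chains_suffice_union\<close>, unless the
  neighbourhood is the whole space and \<open>m\<close> is a maximum.
\<close>

theorem order_chains_suffice_finite:
  assumes "finite (topspace X)" "t0_space X"
  shows "order_chains_suffice X"
  using assms
proof (induction "card (topspace X)" arbitrary: X rule: less_induct)
  case less
  note fin = less.prems(1) and T0 = less.prems(2)
  show ?case
  proof (cases "topspace X = {}")
    case True
    then show ?thesis
      unfolding order_chains_suffice_def
      by (auto simp: singular_chain_empty diff_closedD(1) intro!: exI[of _ 0])
  next
    case False
    have "\<exists>m\<in>topspace X. \<forall>y\<in>topspace X. \<not> space_less X m y"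
    proof -
      (* A point whose minimal open neighbourhood has the largest cardinality is maximal. *)
      let ?c = "\<lambda>x. card (min_open X x)"
      have "Max (?c ` topspace X) \<in> ?c ` topspace X" using fin False by (intro Max_in) auto
      then obtain m0 where m0: "m0 \<in> topspace X" "Max (?c ` topspace X) = ?c m0" by blast
      have "?c y \<le> ?c m0" if "y \<in> topspace X" for y
        unfolding m0(2)[symmetric] using fin that by (intro Max_ge) auto
      then have "\<exists>m\<in>topspace X. \<forall>y\<in>topspace X. ?c y \<le> ?c m" using m0(1) by blast
      then obtain m where m: "m \<in> topspace X" "\<And>y. y \<in> topspace X \<Longrightarrow> card (min_open X y) \<le> card (min_open X m)"
        by blast
      have "\<not> space_less X m y" if y: "y \<in> topspace X" for y
      proof
        assume less: "space_less X m y"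
        then have sub: "min_open X m \<subseteq> min_open X y" by (simp add: space_less_def space_le_def)
        have "y \<notin> min_open X m"
          using less in_min_open_iff[OF fin m(1), of y] space_le_antisym[OF T0, of m y]
          by (auto simp: space_less_def)
        moreover have "y \<in> min_open X y" by (rule openin_min_open(2)[OF fin y])
        ultimately have "min_open X m \<subset> min_open X y" using sub by blast
        moreover have "finite (min_open X y)"
          using openin_subset[OF openin_min_open(1)[OF fin y]] fin finite_subset by blast
        ultimately have "card (min_open X m) < card (min_open X y)" by (rule psubset_card_mono[rotated])
        then show False using m(2)[OF y] by simp
      qed
      then show ?thesis using m(1) by blast
    qed
    then obtain m where m: "m \<in> topspace X" "\<And>y. y \<in> topspace X \<Longrightarrow> \<not> space_less X m y" by blast
    let ?A = "topspace X - {m}" and ?B = "min_open X m"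
    have B: "openin X ?B" "m \<in> ?B" using openin_min_open[OF fin m(1)] by auto
    show ?thesis
    proof (cases "?B = topspace X")
      case True
      then show ?thesis
        using in_min_open_iff[OF fin m(1)] by (intro order_chains_suffice_maximum[OF T0 m(1)]) blast
    next
      case notmax: False
      have "?A = (\<Union>y\<in>?A. min_open X y)"
      proof (intro equalityI subsetI)
        fix y assume "y \<in> ?A"
        then show "y \<in> (\<Union>y\<in>?A. min_open X y)" using openin_min_open(2)[OF fin] by blast
      next
        fix z assume "z \<in> (\<Union>y\<in>?A. min_open X y)"
        then obtain y where y: "y \<in> topspace X" "y \<noteq> m" "z \<in> min_open X y" by blast
        then have "space_le X z y" using in_min_open_iff[OF fin] by blast
        moreover have "z \<noteq> m" using calculation m(2)[OF y(1)] y(2) by (auto simp: space_less_def)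
        ultimately show "z \<in> ?A" by (auto simp: space_le_def)
      qed
      moreover have "openin X (\<Union>y\<in>?A. min_open X y)"
        using openin_min_open(1)[OF fin] by (intro openin_Union) blast
      ultimately have A: "openin X ?A" by simp
      have smaller: "order_chains_suffice (subtopology X C)" if C: "C \<subset> topspace X" for C
      proof (rule less.hyps)
        have "topspace (subtopology X C) = C" using C by auto
        then show "card (topspace (subtopology X C)) < card (topspace X)" "finite (topspace (subtopology X C))"
          using C fin by (auto intro: psubset_card_mono finite_subset)
        show "t0_space (subtopology X C)" using T0 by (rule t0_space_subtopology)
      qed
      show ?thesis
      proof (rule order_chains_suffice_union[OF A B(1)])
        show "?A \<union> ?B = topspace X" using B openin_subset by fastforce
        fix p
        show "order_simplices p X \<subseteq> order_simplices p (subtopology X ?A) \<union> order_simplices p (subtopology X ?B)"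
        proof
          fix \<sigma> assume "\<sigma> \<in> order_simplices p X"
          then obtain x where x: "strict_chain X p x" "\<sigma> = order_simplex p x" by (auto simp: order_simplices_def)
          have "x ` {..p} \<subseteq> ?A \<or> x ` {..p} \<subseteq> ?B"
          proof (cases "m \<in> x ` {..p}")
            case True
            then obtain i where i: "i \<le> p" "x i = m" by auto
            have "i = p"
            proof (rule ccontr)
              assume "i \<noteq> p"
              then have "space_less X m (x p)" "x p \<in> topspace X" using x i by (auto simp: strict_chain_def)
              then show False using m(2) by blast
            qed
            then have "space_le X (x j) m" if "j \<le> p" for j
              using strict_chain_le[OF x(1) that order_refl] i by simp
            then show ?thesis using in_min_open_iff[OF fin m(1)] by blast
          next
            case False
            then show ?thesis using x(1) by (auto simp: strict_chain_def)
          qed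
          then have "strict_chain (subtopology X ?A) p x \<or> strict_chain (subtopology X ?B) p x"
            using x(1) unfolding strict_chain_subtopology by blast
          then show "\<sigma> \<in> order_simplices p (subtopology X ?A) \<union> order_simplices p (subtopology X ?B)"
            unfolding order_simplices_def x(2) by blast
        qed
      next
        show "order_chains_suffice (subtopology X ?A)" using m(1) by (intro smaller) blast
        show "order_chains_suffice (subtopology X ?B)"
          using notmax openin_subset[OF B(1)] by (intro smaller) blast
        show "order_chains_suffice (subtopology X (?A \<inter> ?B))" using m(1) by (intro smaller) blast
      qed
    qed
  qed
qed

section \<open>Acyclic carriers\<close>

text \<open>
  A graded group of chains that is closed under boundaries and has the homology of a point. In degree \<open>0\<close>
  only differences of single simplices are required to bound, since the chain maps below send vertices to
  vertices.
\<close>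

definition acyclic_complex :: "(nat \<Rightarrow> 'b chain set) \<Rightarrow> bool" where
  "acyclic_complex T \<longleftrightarrow>
    (\<forall>q. diff_closed (T q)) \<and>
    (\<forall>q. \<forall>c\<in>T (Suc q). chain_boundary (Suc q) c \<in> T q \<and> chain_boundary q (chain_boundary (Suc q) c) = 0) \<and>
    (\<exists>v. frag_of v \<in> T 0) \<and>
    (\<forall>v w. frag_of v \<in> T 0 \<longrightarrow> frag_of w \<in> T 0 \<longrightarrow>
       (\<exists>e\<in>T (Suc 0). chain_boundary (Suc 0) e = frag_of v - frag_of w)) \<and>
    (\<forall>q. \<forall>z\<in>T (Suc q). chain_boundary (Suc q) z = 0 \<longrightarrow>
       (\<exists>w\<in>T (Suc (Suc q)). chain_boundary (Suc (Suc q)) w = z))"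

lemma acyclic_complexD:
  assumes "acyclic_complex T"
  shows "diff_closed (T q)"
    and "c \<in> T (Suc q) \<Longrightarrow> chain_boundary (Suc q) c \<in> T q"
    and "c \<in> T (Suc q) \<Longrightarrow> chain_boundary q (chain_boundary (Suc q) c) = 0"
    and "\<exists>v. frag_of v \<in> T 0"
    and "frag_of v \<in> T 0 \<Longrightarrow> frag_of w \<in> T 0 \<Longrightarrow> \<exists>e\<in>T (Suc 0). chain_boundary (Suc 0) e = frag_of v - frag_of w"
    and "z \<in> T (Suc q) \<Longrightarrow> chain_boundary (Suc q) z = 0 \<Longrightarrow> \<exists>w\<in>T (Suc (Suc q)). chain_boundary (Suc (Suc q)) w = z"
  using assms unfolding acyclic_complex_def by simp_all

lemma diff_closed_singular_chains [simp]: "diff_closed {c. singular_chain q X c}"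
  by (simp add: diff_closed_def singular_chain_diff)

lemma acyclic_complex_singular:
  assumes "chain_acyclic X"
  shows "acyclic_complex (\<lambda>q. {c. singular_chain q X c})"
  unfolding acyclic_complex_def
proof (intro conjI allI ballI impI)
  obtain a where a: "a \<in> topspace X" using assms unfolding chain_acyclic_def by blast
  have "singular_simplex 0 X (restrict (\<lambda>x. a) (standard_simplex 0))"
    by (simp add: singular_simplex_def a)
  then show "\<exists>v. frag_of v \<in> {c. singular_chain 0 X c}" by (auto simp: singular_chain_of)
next
  fix v w assume "frag_of v \<in> {c. singular_chain 0 X c}" "frag_of w \<in> {c. singular_chain 0 X c}"
  then have "homologous_rel 0 X {} (frag_of v) (frag_of w)"
    using assms iso_integer_zeroth_homology_group_aux[of X v w] by (simp add: singular_chain_of chain_acyclic_def)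
  then show "\<exists>e\<in>{c. singular_chain (Suc 0) X c}. chain_boundary (Suc 0) e = frag_of v - frag_of w"
    by (simp add: homologous_rel_def singular_boundary)
next
  fix q z assume "z \<in> {c. singular_chain (Suc q) X c}" "chain_boundary (Suc q) z = 0"
  then show "\<exists>w\<in>{c. singular_chain (Suc (Suc q)) X c}. chain_boundary (Suc (Suc q)) w = z"
    using assms unfolding chain_acyclic_def by simp
qed (simp_all add: singular_chain_boundary_alt chain_boundary_boundary_alt)

lemma acyclic_complex_order:
  assumes "chain_acyclic X" and suff: "order_chains_suffice X"
  shows "acyclic_complex (\<lambda>q. order_chains q X)"
  unfolding acyclic_complex_def
proof (intro conjI allI ballI impI)
  note sing = acyclic_complexD[OF acyclic_complex_singular[OF assms(1)]]
  obtain a where a: "a \<in> topspace X" using assms unfolding chain_acyclic_def by blast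
  have "strict_chain X 0 (\<lambda>_. a)" using a by (simp add: strict_chain_def)
  then show "\<exists>v. frag_of v \<in> order_chains 0 X" by (auto simp: order_chains_def order_simplices_def)
  show "\<exists>e\<in>order_chains (Suc 0) X. chain_boundary (Suc 0) e = frag_of v - frag_of w"
    if vw: "frag_of v \<in> order_chains 0 X" "frag_of w \<in> order_chains 0 X" for v w
  proof -
    have "frag_of v - frag_of w \<in> order_chains 0 X" using vw by (simp add: diff_closedD(2))
    then show ?thesis
      using sing(5)[of v w] order_chains_singular[OF vw(1)] order_chains_singular[OF vw(2)] order_boundary_if_singular_boundary[OF suff] by auto
  qed
  show "\<exists>w\<in>order_chains (Suc (Suc q)) X. chain_boundary (Suc (Suc q)) w = z"
    if z: "z \<in> order_chains (Suc q) X" "chain_boundary (Suc q) z = 0" for q z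
    using sing(6)[of z q] order_chains_singular[OF z(1)] z order_boundary_if_singular_boundary[OF suff] by auto
  show "chain_boundary (Suc q) c \<in> order_chains q X" "chain_boundary q (chain_boundary (Suc q) c) = 0"
    if "c \<in> order_chains (Suc q) X" for q c
    using that chain_boundary_order_chains chain_boundary_boundary_alt[OF order_chains_singular] by auto
qed simp

text \<open>
  A carrier \<open>T\<close> assigns to a simplex \<open>\<sigma>\<close> of dimension \<open>p\<close> a graded group \<open>T p \<sigma>\<close>. The dimension is an argument
  because the vertex set of \<open>\<sigma>\<close> is its image on the standard simplex of that dimension. Preservation of vertices
  replaces compatibility with augmentations.
\<close>

definition carried_chain_map ::
    "'a topology \<Rightarrow> (nat \<Rightarrow> ((nat \<Rightarrow> real) \<Rightarrow> 'a) \<Rightarrow> nat \<Rightarrow> 'b chain set) \<Rightarrow> (nat \<Rightarrow> 'a chain \<Rightarrow> 'b chain) \<Rightarrow> bool" where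
  "carried_chain_map X T \<phi> \<longleftrightarrow>
    (\<forall>p. additive_on UNIV (\<phi> p)) \<and>
    (\<forall>p. \<forall>\<sigma>\<in>order_simplices p X. \<phi> p (frag_of \<sigma>) \<in> T p \<sigma> p) \<and>
    (\<forall>\<sigma>\<in>order_simplices 0 X. \<exists>v. \<phi> 0 (frag_of \<sigma>) = frag_of v) \<and>
    (\<forall>p. \<forall>c\<in>order_chains (Suc p) X. chain_boundary (Suc p) (\<phi> (Suc p) c) = \<phi> p (chain_boundary (Suc p) c))"

lemma carried_chain_mapD:
  assumes "carried_chain_map X T \<phi>"
  shows "additive_on UNIV (\<phi> p)"
    and "\<sigma> \<in> order_simplices p X \<Longrightarrow> \<phi> p (frag_of \<sigma>) \<in> T p \<sigma> p"
    and "\<sigma> \<in> order_simplices 0 X \<Longrightarrow> \<exists>v. \<phi> 0 (frag_of \<sigma>) = frag_of v"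
    and "c \<in> order_chains (Suc p) X \<Longrightarrow> chain_boundary (Suc p) (\<phi> (Suc p) c) = \<phi> p (chain_boundary (Suc p) c)"
  using assms unfolding carried_chain_map_def by simp_all

definition acyclic_carrier ::
    "'a topology \<Rightarrow> (nat \<Rightarrow> ((nat \<Rightarrow> real) \<Rightarrow> 'a) \<Rightarrow> nat \<Rightarrow> 'b chain set) \<Rightarrow> bool" where
  "acyclic_carrier X T \<longleftrightarrow>
    (\<forall>p. \<forall>\<sigma>\<in>order_simplices p X. acyclic_complex (T p \<sigma>)) \<and>
    (\<forall>p. \<forall>\<sigma>\<in>order_simplices (Suc p) X. \<forall>k\<le>Suc p. \<forall>q. T p (singular_face (Suc p) k \<sigma>) q \<subseteq> T (Suc p) \<sigma> q)"

lemma frag_extend_in: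
  assumes "diff_closed S" "\<And>\<sigma>. \<sigma> \<in> Poly_Mapping.keys c \<Longrightarrow> \<eta> \<sigma> \<in> S"
  shows "frag_extend \<eta> c \<in> S"
  unfolding frag_extend_def using assms by (intro diff_closed_sum diff_closed_cmul) auto

lemma keys_chain_boundary_of:
  "Poly_Mapping.keys (chain_boundary (Suc p) (frag_of \<sigma>)) \<subseteq> (\<lambda>k. singular_face (Suc p) k \<sigma>) ` {..Suc p}"
proof -
  have "chain_boundary (Suc p) (frag_of \<sigma>) \<in> frags ((\<lambda>k. singular_face (Suc p) k \<sigma>) ` {..Suc p})"
    unfolding chain_boundary_of by (auto simp del: sum.atMost_Suc intro!: diff_closed_sum diff_closed_cmul)
  then show ?thesis by (simp add: frags_def)
qed

lemma additive_on_frag_extend: "additive_on S (frag_extend \<eta>)"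
  by (simp add: additive_on_def frag_extend_diff)

lemma carried_boundary:
  assumes T: "acyclic_carrier X T" and \<sigma>: "\<sigma> \<in> order_simplices (Suc p) X"
    and \<eta>: "\<And>\<tau>. \<tau> \<in> order_simplices p X \<Longrightarrow> \<eta> \<tau> \<in> T p \<tau> q"
  shows "frag_extend \<eta> (chain_boundary (Suc p) (frag_of \<sigma>)) \<in> T (Suc p) \<sigma> q"
proof (rule frag_extend_in)
  have "acyclic_complex (T (Suc p) \<sigma>)" using T \<sigma> by (simp add: acyclic_carrier_def)
  then show "diff_closed (T (Suc p) \<sigma> q)" by (rule acyclic_complexD(1))
  fix \<tau> assume "\<tau> \<in> Poly_Mapping.keys (chain_boundary (Suc p) (frag_of \<sigma>))"
  then obtain k where k: "k \<le> Suc p" "\<tau> = singular_face (Suc p) k \<sigma>" using keys_chain_boundary_of by fastforce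
  then have "\<eta> \<tau> \<in> T p \<tau> q" using \<eta> singular_face_order_simplices[OF \<sigma>] by simp
  then show "\<eta> \<tau> \<in> T (Suc p) \<sigma> q" using T \<sigma> k unfolding acyclic_carrier_def by blast
qed

text \<open>
  The values on simplices are chosen dimension by dimension: the value on the boundary of \<open>\<sigma>\<close> is already
  defined, lies in the carrier of \<open>\<sigma>\<close>, and bounds there by acyclicity.
\<close>

lemma carried_chain_map_exists:
  fixes T :: "nat \<Rightarrow> ((nat \<Rightarrow> real) \<Rightarrow> 'a) \<Rightarrow> nat \<Rightarrow> 'b chain set"
  assumes T: "acyclic_carrier X T"
  obtains \<phi> where "carried_chain_map X T \<phi>"
proof -
  let ?K = "\<lambda>n. order_simplices n X"
  have ac: "acyclic_complex (T p \<sigma>)" if "\<sigma> \<in> ?K p" for \<sigma> p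
    using T that by (auto simp: acyclic_carrier_def)
  define P where "P n \<eta> \<longleftrightarrow> (\<forall>\<sigma>\<in>?K n. \<eta> \<sigma> \<in> T n \<sigma> n) \<and>
      (\<forall>c\<in>order_chains n X. chain_boundary n c = 0 \<longrightarrow> chain_boundary n (frag_extend \<eta> c) = 0) \<and>
      (n = 0 \<longrightarrow> (\<forall>\<sigma>\<in>?K n. \<exists>v. \<eta> \<sigma> = frag_of v))" for n and \<eta> :: "((nat \<Rightarrow> real) \<Rightarrow> 'a) \<Rightarrow> 'b chain"
  define Q where "Q n \<eta> \<eta>' \<longleftrightarrow> (\<forall>\<sigma>\<in>?K (Suc n). chain_boundary (Suc n) (\<eta>' \<sigma>) =
      frag_extend \<eta> (chain_boundary (Suc n) (frag_of \<sigma>)))" for n and \<eta> \<eta>' :: "((nat \<Rightarrow> real) \<Rightarrow> 'a) \<Rightarrow> 'b chain"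
  have Qlin: "chain_boundary (Suc n) (frag_extend \<eta>' c) = frag_extend \<eta> (chain_boundary (Suc n) c)"
    if Q: "Q n \<eta> \<eta>'" and c: "c \<in> order_chains (Suc n) X" for n \<eta> \<eta>' c
    using c
  proof (induction rule: order_chains_induct)
    case (one \<sigma>)
    then show ?case using Q by (simp add: Q_def)
  next
    case (diff a b)
    then show ?case by (simp add: frag_extend_diff chain_boundary_diff)
  qed simp
  have "\<exists>f. \<forall>n. P n (f n) \<and> Q n (f n) (f (Suc n))"
  proof (rule dependent_nat_choice)
    have "\<forall>\<sigma>\<in>?K 0. \<exists>v. frag_of v \<in> T 0 \<sigma> 0" using ac acyclic_complexD(4) by blast
    then obtain v where "\<forall>\<sigma>\<in>?K 0. frag_of (v \<sigma>) \<in> T 0 \<sigma> 0" by metis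
    then show "\<exists>\<eta>. P 0 \<eta>"
      by (intro exI[of _ "\<lambda>\<sigma>. frag_of (v \<sigma>)"]) (auto simp: P_def chain_boundary_def)
  next
    fix \<eta> n assume P: "P n \<eta>"
    have "\<exists>w\<in>T (Suc n) \<sigma> (Suc n). chain_boundary (Suc n) w = frag_extend \<eta> (chain_boundary (Suc n) (frag_of \<sigma>))"
      if \<sigma>: "\<sigma> \<in> ?K (Suc n)" for \<sigma>
    proof (cases n)
      case 0
      let ?f = "\<lambda>k. singular_face (Suc 0) k \<sigma>"
      have in_T: "\<eta> (?f k) \<in> T (Suc 0) \<sigma> 0" if "k \<le> Suc 0" for k
      proof -
        have "\<eta> (?f k) \<in> T 0 (?f k) 0"
          using P singular_face_order_simplices[of \<sigma> 0 X k] \<sigma> that 0 by (simp add: P_def)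
        then show ?thesis using T \<sigma> 0 that unfolding acyclic_carrier_def by blast
      qed
      have "\<exists>v. \<eta> (?f k) = frag_of v" if "k \<le> Suc 0" for k
        using P singular_face_order_simplices[of \<sigma> 0 X k] \<sigma> that 0 by (simp add: P_def)
      then obtain v w where "\<eta> (?f 0) = frag_of v" "\<eta> (?f (Suc 0)) = frag_of w" by blast
      moreover have "frag_extend \<eta> (chain_boundary (Suc 0) (frag_of \<sigma>)) = \<eta> (?f 0) - \<eta> (?f (Suc 0))"
        by (simp add: chain_boundary_of frag_extend_diff)
      ultimately show ?thesis
        using acyclic_complexD(5)[OF ac[OF \<sigma>], of v w] in_T[of 0] in_T[of "Suc 0"] 0 by simp
    next
      case (Suc m)
      have "frag_extend \<eta> (chain_boundary (Suc n) (frag_of \<sigma>)) \<in> T (Suc n) \<sigma> n"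
        using P by (intro carried_boundary[OF T \<sigma>]) (simp add: P_def)
      moreover have "chain_boundary n (frag_extend \<eta> (chain_boundary (Suc n) (frag_of \<sigma>))) = 0"
      proof -
        have "frag_of \<sigma> \<in> order_chains (Suc n) X" using \<sigma> by (simp add: order_chains_def)
        then show ?thesis
          using P chain_boundary_order_chains chain_boundary_boundary_alt[OF order_chains_singular]
          unfolding P_def by blast
      qed
      ultimately show ?thesis using acyclic_complexD(6)[OF ac[OF \<sigma>]] Suc by simp
    qed
    then obtain \<eta>' where \<eta>': "\<And>\<sigma>. \<sigma> \<in> ?K (Suc n) \<Longrightarrow> \<eta>' \<sigma> \<in> T (Suc n) \<sigma> (Suc n)"
      "\<And>\<sigma>. \<sigma> \<in> ?K (Suc n) \<Longrightarrow> chain_boundary (Suc n) (\<eta>' \<sigma>) = frag_extend \<eta> (chain_boundary (Suc n) (frag_of \<sigma>))"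
      by metis
    then have Q: "Q n \<eta> \<eta>'" by (simp add: Q_def)
    then have "P (Suc n) \<eta>'" using \<eta>'(1) Qlin[OF Q] by (simp add: P_def)
    then show "\<exists>\<eta>'. P (Suc n) \<eta>' \<and> Q n \<eta> \<eta>'" using Q by blast
  qed
  then obtain f where f: "\<And>n. P n (f n)" "\<And>n. Q n (f n) (f (Suc n))" by blast
  have "carried_chain_map X T (\<lambda>n. frag_extend (f n))"
    unfolding carried_chain_map_def
  proof (intro conjI allI ballI)
    show "frag_extend (f p) (frag_of \<sigma>) \<in> T p \<sigma> p" if "\<sigma> \<in> ?K p" for p \<sigma>
      using f(1)[of p] that by (simp add: P_def)
    show "\<exists>v. frag_extend (f 0) (frag_of \<sigma>) = frag_of v" if "\<sigma> \<in> ?K 0" for \<sigma>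
      using f(1)[of 0] that by (simp add: P_def)
  qed (simp_all add: additive_on_frag_extend Qlin[OF f(2)])
  then show thesis using that by blast
qed

text \<open>
  The chain homotopy between the two maps is built dimension by dimension. Each stage needs the homotopy of the previous one
  only on cycles, where its defining equation is the assertion itself; so the stages do not have to be
  assembled into one homotopy.
\<close>

lemma carried_chain_maps_homologous:
  assumes T: "acyclic_carrier X T" and \<phi>: "carried_chain_map X T \<phi>" and \<psi>: "carried_chain_map X T \<psi>"
    and U: "\<And>p \<sigma> q. \<sigma> \<in> order_simplices p X \<Longrightarrow> T p \<sigma> q \<subseteq> U q" "\<And>q. diff_closed (U q)"
    and c: "c \<in> order_chains p X" "chain_boundary p c = 0"
  shows "\<exists>w\<in>U (Suc p). chain_boundary (Suc p) w = \<phi> p c - \<psi> p c"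
proof -
  let ?K = "\<lambda>n. order_simplices n X"
  have ac: "acyclic_complex (T p \<sigma>)" if "\<sigma> \<in> ?K p" for \<sigma> p
    using T that by (auto simp: acyclic_carrier_def)
  note add\<phi> = additive_onD[OF diff_closed_UNIV carried_chain_mapD(1)[OF \<phi>], simplified]
    and add\<psi> = additive_onD[OF diff_closed_UNIV carried_chain_mapD(1)[OF \<psi>], simplified]
  define P where "P n \<eta> \<longleftrightarrow> (\<forall>\<sigma>\<in>?K n. \<eta> \<sigma> \<in> T n \<sigma> (Suc n)) \<and>
      (\<forall>c\<in>order_chains n X. chain_boundary n c = 0 \<longrightarrow>
         chain_boundary (Suc n) (frag_extend \<eta> c) = \<phi> n c - \<psi> n c)" for n \<eta>
  have "\<exists>\<eta>. P n \<eta>" for n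
  proof (induction n)
    case 0
    have "\<exists>w\<in>T 0 \<sigma> (Suc 0). chain_boundary (Suc 0) w = \<phi> 0 (frag_of \<sigma>) - \<psi> 0 (frag_of \<sigma>)" if \<sigma>: "\<sigma> \<in> ?K 0" for \<sigma>
      using carried_chain_mapD(2,3)[OF \<phi> \<sigma>] carried_chain_mapD(2,3)[OF \<psi> \<sigma>] acyclic_complexD(5)[OF ac[OF \<sigma>]]
      by metis
    then obtain \<eta> where \<eta>: "\<And>\<sigma>. \<sigma> \<in> ?K 0 \<Longrightarrow> \<eta> \<sigma> \<in> T 0 \<sigma> (Suc 0)"
      "\<And>\<sigma>. \<sigma> \<in> ?K 0 \<Longrightarrow> chain_boundary (Suc 0) (\<eta> \<sigma>) = \<phi> 0 (frag_of \<sigma>) - \<psi> 0 (frag_of \<sigma>)"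
      by metis
    have "chain_boundary (Suc 0) (frag_extend \<eta> c) = \<phi> 0 c - \<psi> 0 c" if "c \<in> order_chains 0 X" for c
      using that
    proof (induction rule: order_chains_induct)
      case (one \<sigma>)
      then show ?case using \<eta>(2) by simp
    next
      case (diff a b)
      then show ?case by (simp add: frag_extend_diff chain_boundary_diff add\<phi> add\<psi>)
    qed (simp add: add\<phi> add\<psi>)
    then have "P 0 \<eta>" using \<eta>(1) by (simp add: P_def)
    then show ?case by blast
  next
    case (Suc n)
    then obtain \<eta> where P: "P n \<eta>" by blast
    let ?z = "\<lambda>c. \<phi> (Suc n) c - \<psi> (Suc n) c - frag_extend \<eta> (chain_boundary (Suc n) c)"
    have "\<exists>w\<in>T (Suc n) \<sigma> (Suc (Suc n)). chain_boundary (Suc (Suc n)) w = ?z (frag_of \<sigma>)" if \<sigma>: "\<sigma> \<in> ?K (Suc n)" for \<sigma>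
    proof -
      let ?s = "frag_of \<sigma>"
      have s: "?s \<in> order_chains (Suc n) X" using \<sigma> by (simp add: order_chains_def)
      have "frag_extend \<eta> (chain_boundary (Suc n) ?s) \<in> T (Suc n) \<sigma> (Suc n)"
        using P by (intro carried_boundary[OF T \<sigma>]) (simp add: P_def)
      then have "?z ?s \<in> T (Suc n) \<sigma> (Suc n)"
        using carried_chain_mapD(2)[OF \<phi> \<sigma>] carried_chain_mapD(2)[OF \<psi> \<sigma>] acyclic_complexD(1)[OF ac[OF \<sigma>]]
        by (intro diff_closedD(2))
      moreover have "chain_boundary (Suc n) (frag_extend \<eta> (chain_boundary (Suc n) ?s)) =
          \<phi> n (chain_boundary (Suc n) ?s) - \<psi> n (chain_boundary (Suc n) ?s)"
        using P chain_boundary_order_chains[OF s] chain_boundary_boundary_alt[OF order_chains_singular[OF s]]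
        by (simp add: P_def)
      then have "chain_boundary (Suc n) (?z ?s) = 0"
        using carried_chain_mapD(4)[OF \<phi> s] carried_chain_mapD(4)[OF \<psi> s] by (simp add: chain_boundary_diff)
      ultimately show ?thesis by (rule acyclic_complexD(6)[OF ac[OF \<sigma>]])
    qed
    then obtain \<eta>' where \<eta>': "\<And>\<sigma>. \<sigma> \<in> ?K (Suc n) \<Longrightarrow> \<eta>' \<sigma> \<in> T (Suc n) \<sigma> (Suc (Suc n))"
      "\<And>\<sigma>. \<sigma> \<in> ?K (Suc n) \<Longrightarrow> chain_boundary (Suc (Suc n)) (\<eta>' \<sigma>) = ?z (frag_of \<sigma>)"
      by metis
    have lin: "chain_boundary (Suc (Suc n)) (frag_extend \<eta>' c) = ?z c" if "c \<in> order_chains (Suc n) X" for c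
      using that
    proof (induction rule: order_chains_induct)
      case (one \<sigma>)
      then show ?case using \<eta>'(2) by simp
    next
      case (diff a b)
      then show ?case by (simp add: frag_extend_diff chain_boundary_diff add\<phi> add\<psi>)
    qed (simp add: add\<phi> add\<psi>)
    then have "P (Suc n) \<eta>'" using \<eta>'(1) by (simp add: P_def)
    then show ?case by blast
  qed
  then obtain \<eta> where P: "P p \<eta>" by blast
  have "frag_extend \<eta> c \<in> U (Suc p)"
  proof (rule frag_extend_in[OF U(2)])
    fix \<sigma> assume "\<sigma> \<in> Poly_Mapping.keys c"
    then have "\<sigma> \<in> ?K p" using c(1) by (auto simp: order_chains_def frags_def)
    then show "\<eta> \<sigma> \<in> U (Suc p)" using P U(1) unfolding P_def by blast
  qed
  then show ?thesis using P c by (auto simp: P_def)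
qed

section \<open>Chain models of continuous maps\<close>

lemma order_cycle_representative:
  assumes suff: "order_chains_suffice X" and s: "singular_relcycle p X {} s"
  obtains z where "z \<in> order_chains p X" "chain_boundary p z = 0" "homologous_rel p X {} s z"
proof -
  have s': "singular_chain p X s" "chain_boundary p s = 0" using s by (auto simp: singular_cycle)
  have "chain_boundary p s \<in> order_chains (p - Suc 0) X" using s'(2) by (simp add: diff_closedD(1))
  then obtain t where t: "singular_chain (Suc p) X t" "s - chain_boundary (Suc p) t \<in> order_chains p X"
    using suff s'(1) unfolding order_chains_suffice_def by blast
  let ?z = "s - chain_boundary (Suc p) t"
  have "chain_boundary p ?z = 0"
    using s'(2) chain_boundary_boundary_alt[OF t(1)] by (simp add: chain_boundary_diff)
  moreover have "homologous_rel p X {} s ?z"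
    using t(1) by (auto simp: homologous_rel_def singular_boundary)
  ultimately show thesis using that t(2) by blast
qed

lemma order_cycle_singular_relcycle:
  "z \<in> order_chains p X \<Longrightarrow> chain_boundary p z = 0 \<Longrightarrow> singular_relcycle p X {} z"
  by (simp add: singular_cycle order_chains_singular)

lemma space_chain_of_monotone:
  fixes y :: "nat \<Rightarrow> 'b"
  assumes "\<And>i j. i \<le> j \<Longrightarrow> j \<le> p \<Longrightarrow> space_le Y (y i) (y j)"
  shows "\<exists>ys. space_chain Y ys \<and> set ys = y ` {..p}"
  using assms
proof (induction p)
  case 0
  have "y 0 \<in> topspace Y" using 0[of 0 0] by (simp add: space_le_iff)
  then show ?case by (intro exI[of _ "[y 0]"]) (simp add: space_chain_def)
next
  case (Suc p)
  have "\<exists>ys. space_chain Y ys \<and> set ys = y ` {..p}" using Suc.prems by (intro Suc.IH) simp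
  then obtain ys where ys: "space_chain Y ys" "set ys = y ` {..p}" by blast
  show ?case
  proof (cases "y (Suc p) \<in> y ` {..p}")
    case True
    then have "y ` {..Suc p} = y ` {..p}" by (auto simp: le_Suc_eq atMost_Suc)
    then show ?thesis using ys by auto
  next
    case False
    have "space_less Y x (y (Suc p))" if "x \<in> set ys" for x
    proof -
      have "x \<in> y ` {..p}" using that ys(2) by simp
      then have "x \<noteq> y (Suc p)" using False by blast
      moreover obtain i where "i \<le> p" "x = y i" using \<open>x \<in> y ` {..p}\<close> by auto
      ultimately show ?thesis using Suc.prems[of i "Suc p"] by (simp add: space_less_def)
    qed
    moreover have "y (Suc p) \<in> topspace Y" using Suc.prems[of "Suc p" "Suc p"] by (simp add: space_le_iff)
    ultimately have "space_chain Y (ys @ [y (Suc p)])"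
      using ys(1) by (simp add: space_chain_def sorted_wrt_append)
    then show ?thesis using ys(2) by (intro exI[of _ "ys @ [y (Suc p)]"]) (simp add: atMost_Suc)
  qed
qed

lemma chain_acyclic_monotone_image:
  fixes y :: "nat \<Rightarrow> 'b"
  assumes "\<And>i. i \<le> p \<Longrightarrow> space_le Y (y i) (y p)"
  shows "chain_acyclic (subtopology Y (y ` {..p}))"
proof -
  let ?S = "subtopology Y (y ` {..p})"
  have yp: "y p \<in> topspace ?S" using assms[of p] by (auto simp: space_le_iff)
  have "space_le ?S x (y p)" if "x \<in> topspace ?S" for x
    using that assms by (auto simp: space_le_subtopology)
  then show ?thesis
    using contractible_imp_chain_acyclic contractible_space_if_maximum[OF yp] yp by blast
qed

text \<open>
  The definition of a Vietoris-like map speaks of strict chains. Images of simplices under a continuous map may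
  have repeated vertices, so the preimages of weakly increasing sequences are needed as well.
\<close>

lemma chain_acyclic_vietoris_fibre:
  fixes y :: "nat \<Rightarrow> 'b"
  assumes f: "vietoris_like_map X Y f" and y: "\<And>i j. i \<le> j \<Longrightarrow> j \<le> p \<Longrightarrow> space_le Y (y i) (y j)"
  shows "chain_acyclic (subtopology X {x \<in> topspace X. f x \<in> y ` {..p}})"
proof -
  obtain ys where ys: "space_chain Y ys" "set ys = y ` {..p}"
    using space_chain_of_monotone[of p Y y] y by blast
  have eq: "(\<Union>y\<in>set ys. {x \<in> topspace X. f x = y}) = {x \<in> topspace X. f x \<in> y ` {..p}}"
    using ys(2) by auto
  have "acyclic_space (subtopology X (\<Union>y\<in>set ys. {x \<in> topspace X. f x = y}))"
    using f[unfolded vietoris_like_map_def, THEN conjunct2] ys(1) by blast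
  then have "acyclic_space (subtopology X {x \<in> topspace X. f x \<in> y ` {..p}})"
    by (simp only: eq)
  then show ?thesis by (rule acyclic_space_imp_chain_acyclic)
qed

lemma singular_face_image:
  assumes "k \<le> Suc p"
  shows "singular_face (Suc p) k \<sigma> ` standard_simplex p \<subseteq> \<sigma> ` standard_simplex (Suc p)"
  using simplical_face_in_standard_simplex[of "Suc p" k] assms by (auto simp: singular_face_def)

lemma order_simplex_in_order_chains:
  assumes "\<sigma> \<in> order_simplices p X" "\<sigma> ` standard_simplex p \<subseteq> A"
  shows "frag_of \<sigma> \<in> order_chains p (subtopology X A)"
  using assms by (simp add: order_chains_def order_simplices_subtopology)

lemma additive_map_in:
  fixes f :: "('k \<Rightarrow>\<^sub>0 int) \<Rightarrow> ('l \<Rightarrow>\<^sub>0 int)"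
  assumes f: "additive_on UNIV f" and S: "diff_closed S"
    and k: "\<And>\<sigma>. \<sigma> \<in> Poly_Mapping.keys c \<Longrightarrow> f (frag_of \<sigma>) \<in> S"
  shows "f c \<in> S"
proof -
  have "f c = (\<Sum>s\<in>Poly_Mapping.keys c. frag_cmul (Poly_Mapping.lookup c s) (f (frag_of s)))"
    by (rule additive_on_expansion) (auto simp: frags_def additive_on_subset[OF f])
  also have "\<dots> \<in> S" by (intro diff_closed_sum[OF S] diff_closed_cmul[OF S] k)
  finally show ?thesis .
qed

lemma order_chains_suffice_subtopology:
  assumes "finite (topspace X)" "t0_space X"
  shows "order_chains_suffice (subtopology X A)"
  using assms by (intro order_chains_suffice_finite) (auto intro: t0_space_subtopology)

text \<open>
  A simplex enters a carrier only through its set of vertices, which is its image on the standard simplex.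
\<close>

definition image_carrier :: "'b topology \<Rightarrow> ('a \<Rightarrow> 'b) \<Rightarrow> nat \<Rightarrow> ((nat \<Rightarrow> real) \<Rightarrow> 'a) \<Rightarrow> 'b topology" where
  "image_carrier Y h p \<sigma> = subtopology Y (h ` \<sigma> ` standard_simplex p)"

definition fibre_carrier :: "'a topology \<Rightarrow> ('a \<Rightarrow> 'b) \<Rightarrow> nat \<Rightarrow> ((nat \<Rightarrow> real) \<Rightarrow> 'b) \<Rightarrow> 'a topology" where
  "fibre_carrier X f p \<tau> = subtopology X {x \<in> topspace X. f x \<in> \<tau> ` standard_simplex p}"

lemma chain_acyclic_image_carrier:
  assumes h: "continuous_map X Y h" and \<sigma>: "\<sigma> \<in> order_simplices p X"
  shows "chain_acyclic (image_carrier Y h p \<sigma>)"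
proof -
  obtain x where x: "strict_chain X p x" "\<sigma> = order_simplex p x" using \<sigma> by (auto simp: order_simplices_def)
  have "chain_acyclic (subtopology Y ((h \<circ> x) ` {..p}))"
    by (rule chain_acyclic_monotone_image)
      (use space_le_continuous_map[OF h strict_chain_le[OF x(1) _ order_refl]] in simp)
  then show ?thesis by (simp add: image_carrier_def x(2) order_simplex_image image_comp)
qed

lemma image_carrier_face:
  "k \<le> Suc p \<Longrightarrow> h ` singular_face (Suc p) k \<sigma> ` standard_simplex p \<subseteq> h ` \<sigma> ` standard_simplex (Suc p)"
  using singular_face_image by (intro image_mono)

lemma acyclic_carrier_image_singular:
  assumes "continuous_map X Y h"
  shows "acyclic_carrier X (\<lambda>p \<sigma> q. {c. singular_chain q (image_carrier Y h p \<sigma>) c})"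
  unfolding acyclic_carrier_def
proof (intro conjI allI ballI impI subsetI)
  fix p \<sigma> k q c assume "k \<le> Suc p" "c \<in> {c. singular_chain q (image_carrier Y h p (singular_face (Suc p) k \<sigma>)) c}"
  then show "c \<in> {c. singular_chain q (image_carrier Y h (Suc p) \<sigma>) c}"
    using image_carrier_face[of k p h \<sigma>] by (auto simp: image_carrier_def intro: singular_chain_mono)
qed (simp add: acyclic_complex_singular chain_acyclic_image_carrier[OF assms])

lemma acyclic_carrier_image_order:
  assumes h: "continuous_map X Y h" and Y: "finite (topspace Y)" "t0_space Y"
  shows "acyclic_carrier X (\<lambda>p \<sigma> q. order_chains q (image_carrier Y h p \<sigma>))"
  unfolding acyclic_carrier_def
proof (intro conjI allI ballI impI subsetI)
  fix p \<sigma> assume "\<sigma> \<in> order_simplices p X"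
  then show "acyclic_complex (\<lambda>q. order_chains q (image_carrier Y h p \<sigma>))"
    using chain_acyclic_image_carrier[OF h] order_chains_suffice_subtopology[OF Y]
    by (intro acyclic_complex_order) (auto simp: image_carrier_def)
next
  fix p \<sigma> k q c assume "k \<le> Suc p" "c \<in> order_chains q (image_carrier Y h p (singular_face (Suc p) k \<sigma>))"
  then show "c \<in> order_chains q (image_carrier Y h (Suc p) \<sigma>)"
    using image_carrier_face[of k p h \<sigma>] order_chains_mono unfolding image_carrier_def by blast
qed

lemma carried_singular_chain_map:
  assumes h: "continuous_map X Y h"
  shows "carried_chain_map X (\<lambda>p \<sigma> q. {c. singular_chain q (image_carrier Y h p \<sigma>) c}) (\<lambda>p. chain_map p h)"
  unfolding carried_chain_map_def
proof (intro conjI allI ballI)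
  fix p \<sigma> assume \<sigma>: "\<sigma> \<in> order_simplices p X"
  have "singular_simplex p Y (simplex_map p h \<sigma>)"
    using \<sigma> order_simplices_subset_singular h by (blast intro: singular_simplex_simplex_map)
  then show "chain_map p h (frag_of \<sigma>) \<in> {c. singular_chain p (image_carrier Y h p \<sigma>) c}"
    by (auto simp: singular_chain_of image_carrier_def singular_simplex_subtopology simplex_map_def)
next
  fix p c assume "c \<in> order_chains (Suc p) X"
  then show "chain_boundary (Suc p) (chain_map (Suc p) h c) = chain_map p h (chain_boundary (Suc p) c)"
    using chain_boundary_chain_map[OF order_chains_singular, of c "Suc p" X h] by simp
qed (auto simp: additive_on_def chain_map_diff)

lemma carried_order_imp_singular:
  assumes "carried_chain_map X (\<lambda>p \<sigma> q. order_chains q (S p \<sigma>)) \<phi>"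
  shows "carried_chain_map X (\<lambda>p \<sigma> q. {c. singular_chain q (S p \<sigma>) c}) \<phi>"
  using assms order_chains_singular unfolding carried_chain_map_def by blast

text \<open>
  Both \<open>H\<close> and the map induced by \<open>h\<close> on singular chains have as a carrier the singular chains of \<open>h(\<sigma>)\<close>, a space with a
  maximum. The naive formula for \<open>H\<close> would have to discard degenerate images; a choice of \<open>H\<close> by acyclic
  carriers does not, and only its carrier matters later.
\<close>

lemma simplicial_approximation:
  assumes h: "continuous_map X Y h" and Y: "finite (topspace Y)" "t0_space Y"
  obtains H where "carried_chain_map X (\<lambda>p \<sigma> q. order_chains q (image_carrier Y h p \<sigma>)) H"
    "\<And>p c. c \<in> order_chains p X \<Longrightarrow> chain_boundary p c = 0 \<Longrightarrow> homologous_rel p Y {} (chain_map p h c) (H p c)"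
proof -
  obtain H where H: "carried_chain_map X (\<lambda>p \<sigma> q. order_chains q (image_carrier Y h p \<sigma>)) H"
    using carried_chain_map_exists[OF acyclic_carrier_image_order[OF h Y]] .
  have "homologous_rel p Y {} (chain_map p h c) (H p c)"
    if "c \<in> order_chains p X" "chain_boundary p c = 0" for p c
  proof -
    have "\<exists>w\<in>{c. singular_chain (Suc p) Y c}. chain_boundary (Suc p) w = chain_map p h c - H p c"
      by (rule carried_chain_maps_homologous[OF acyclic_carrier_image_singular[OF h]
            carried_singular_chain_map[OF h] carried_order_imp_singular[OF H] _ _ that])
        (auto simp: image_carrier_def singular_chain_subtopology)
    then show ?thesis by (auto simp: homologous_rel_def singular_boundary)
  qed
  then show thesis using that H by blast
qed

lemma carried_image_order_chains:
  assumes "carried_chain_map X (\<lambda>p \<sigma> q. order_chains q (subtopology Y (S p \<sigma>))) \<phi>" "c \<in> order_chains p X"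
  shows "\<phi> p c \<in> order_chains p Y"
proof (rule additive_map_in[OF carried_chain_mapD(1)[OF assms(1)]])
  fix \<sigma> assume "\<sigma> \<in> Poly_Mapping.keys c"
  then have "\<sigma> \<in> order_simplices p X" using assms(2) by (auto simp: order_chains_def frags_def)
  then show "\<phi> p (frag_of \<sigma>) \<in> order_chains p Y"
    using carried_chain_mapD(2)[OF assms(1)] order_chains_subset by blast
qed simp

lemma carried_cycle:
  assumes "carried_chain_map X T \<phi>" "c \<in> order_chains p X" "chain_boundary p c = 0"
  shows "chain_boundary p (\<phi> p c) = 0"
proof (cases p)
  case 0
  then show ?thesis by (simp add: chain_boundary_def)
next
  case (Suc q)
  then show ?thesis
    using carried_chain_mapD(4)[OF assms(1), of c q] assms(2,3)
      additive_onD(1)[OF diff_closed_UNIV carried_chain_mapD(1)[OF assms(1)]] by simp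
qed

section \<open>The transfer of a Vietoris-like map\<close>

lemma acyclic_carrier_fibre:
  assumes f: "vietoris_like_map X Y f" and X: "finite (topspace X)" "t0_space X"
  shows "acyclic_carrier Y (\<lambda>p \<tau> q. order_chains q (fibre_carrier X f p \<tau>))"
  unfolding acyclic_carrier_def
proof (intro conjI allI ballI impI subsetI)
  fix p \<tau> assume "\<tau> \<in> order_simplices p Y"
  then obtain y where y: "strict_chain Y p y" "\<tau> = order_simplex p y" by (auto simp: order_simplices_def)
  have "chain_acyclic (fibre_carrier X f p \<tau>)"
    unfolding fibre_carrier_def y(2) order_simplex_image
    by (rule chain_acyclic_vietoris_fibre[OF f strict_chain_le[OF y(1)]])
  then show "acyclic_complex (\<lambda>q. order_chains q (fibre_carrier X f p \<tau>))"
    using order_chains_suffice_subtopology[OF X]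
    by (intro acyclic_complex_order) (auto simp: fibre_carrier_def)
next
  fix p \<tau> k q c assume "k \<le> Suc p" "c \<in> order_chains q (fibre_carrier X f p (singular_face (Suc p) k \<tau>))"
  then show "c \<in> order_chains q (fibre_carrier X f (Suc p) \<tau>)"
    using singular_face_image[of k p \<tau>] unfolding fibre_carrier_def by (elim order_chains_mono) fast
qed

text \<open>
  This carrier, \<open>\<sigma> \<mapsto> f\<^sup>-\<^sup>1(f(\<sigma>))\<close>, is common to the identity of \<open>X\<close> and to the composite of a model of \<open>f\<close> with
  the transfer.
\<close>

lemma acyclic_carrier_fibre_of_image:
  assumes f: "vietoris_like_map X Y f" and X: "finite (topspace X)" "t0_space X"
  shows "acyclic_carrier X (\<lambda>p \<sigma> q. order_chains q (fibre_carrier X f p (f \<circ> \<sigma>)))"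
  unfolding acyclic_carrier_def
proof (intro conjI allI ballI impI subsetI)
  have cont: "continuous_map X Y f" using f unfolding vietoris_like_map_def by (rule conjunct1)
  fix p \<sigma> assume "\<sigma> \<in> order_simplices p X"
  then obtain x where x: "strict_chain X p x" "\<sigma> = order_simplex p x" by (auto simp: order_simplices_def)
  have img: "(f \<circ> \<sigma>) ` standard_simplex p = (f \<circ> x) ` {..p}"
    unfolding image_comp[symmetric] x(2) order_simplex_image ..
  have "chain_acyclic (fibre_carrier X f p (f \<circ> \<sigma>))"
    unfolding fibre_carrier_def img
    by (rule chain_acyclic_vietoris_fibre[OF f])
      (use space_le_continuous_map[OF cont strict_chain_le[OF x(1)]] in simp)
  then show "acyclic_complex (\<lambda>q. order_chains q (fibre_carrier X f p (f \<circ> \<sigma>)))"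
    using order_chains_suffice_subtopology[OF X]
    by (intro acyclic_complex_order) (auto simp: fibre_carrier_def)
next
  fix p \<sigma> k q c assume k: "k \<le> Suc p" and c: "c \<in> order_chains q (fibre_carrier X f p (f \<circ> singular_face (Suc p) k \<sigma>))"
  have sub: "(f \<circ> singular_face (Suc p) k \<sigma>) ` standard_simplex p \<subseteq> (f \<circ> \<sigma>) ` standard_simplex (Suc p)"
    unfolding image_comp[symmetric] by (rule image_carrier_face[OF k])
  show "c \<in> order_chains q (fibre_carrier X f (Suc p) (f \<circ> \<sigma>))"
    unfolding fibre_carrier_def by (rule order_chains_mono[OF c[unfolded fibre_carrier_def]]) (use sub in fast)
qed

text \<open>
  The chain map \<open>\<Phi>\<close> is carried by \<open>\<tau> \<mapsto> f\<^sup>-\<^sup>1(\<tau>)\<close>. Therefore \<open>f \<circ> \<Phi>\<close> is carried by \<open>\<tau> \<mapsto> \<tau>\<close>, like the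
  identity of \<open>Y\<close>, which makes \<open>f\<close> surjective on homology. For a model \<open>F\<close> of \<open>f\<close> on order chains, \<open>\<Phi> \<circ> F\<close> is carried by
  \<open>\<sigma> \<mapsto> f\<^sup>-\<^sup>1(f(\<sigma>))\<close>, like the identity of \<open>X\<close>: if \<open>f z\<close> bounds, then so do \<open>F z\<close>, \<open>\<Phi> (F z)\<close> and \<open>z\<close>, so \<open>f\<close> is
  injective on homology.
\<close>

lemma vietoris_transfer:
  assumes f: "vietoris_like_map X Y f" and X: "finite (topspace X)" "t0_space X"
    and Y: "finite (topspace Y)" "t0_space Y"
  obtains \<Phi> where "carried_chain_map Y (\<lambda>p \<tau> q. order_chains q (fibre_carrier X f p \<tau>)) \<Phi>"
    "\<And>p z. z \<in> order_chains p Y \<Longrightarrow> chain_boundary p z = 0 \<Longrightarrow>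
      homologous_rel p Y {} (chain_map p f (\<Phi> p z)) z"
    "\<And>p z. z \<in> order_chains p X \<Longrightarrow> chain_boundary p z = 0 \<Longrightarrow>
      homologous_rel p Y {} (chain_map p f z) 0 \<Longrightarrow> homologous_rel p X {} z 0"
proof -
  have cont: "continuous_map X Y f" using f unfolding vietoris_like_map_def by (rule conjunct1)
  obtain \<Phi> where \<Phi>: "carried_chain_map Y (\<lambda>p \<tau> q. order_chains q (fibre_carrier X f p \<tau>)) \<Phi>"
    using carried_chain_map_exists[OF acyclic_carrier_fibre[OF f X]] .
  note add\<Phi> = additive_onD[OF diff_closed_UNIV carried_chain_mapD(1)[OF \<Phi>], simplified]
  have \<Phi>X: "\<Phi> p c \<in> order_chains p X" if "c \<in> order_chains p Y" for p c
    using carried_image_order_chains[OF \<Phi>[unfolded fibre_carrier_def] that] .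
  have "homologous_rel p Y {} (chain_map p f (\<Phi> p z)) z"
    if z: "z \<in> order_chains p Y" "chain_boundary p z = 0" for p z
  proof -
    let ?T = "\<lambda>p \<tau> q. {c. singular_chain q (image_carrier Y id p \<tau>) c}"
    have 1: "carried_chain_map Y ?T (\<lambda>p c. chain_map p f (\<Phi> p c))"
      unfolding carried_chain_map_def
    proof (intro conjI allI ballI)
      show "additive_on UNIV (\<lambda>c. chain_map p f (\<Phi> p c))" for p
        by (simp add: additive_on_def add\<Phi> chain_map_diff)
    next
      fix p \<tau> assume "\<tau> \<in> order_simplices p Y"
      then have "singular_chain p (fibre_carrier X f p \<tau>) (\<Phi> p (frag_of \<tau>))"
        using carried_chain_mapD(2)[OF \<Phi>] order_chains_singular by blast
      moreover have "continuous_map (fibre_carrier X f p \<tau>) (image_carrier Y id p \<tau>) f"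
        unfolding fibre_carrier_def image_carrier_def
        by (rule continuous_map_into_subtopology[OF continuous_map_from_subtopology[OF cont]]) auto
      ultimately show "chain_map p f (\<Phi> p (frag_of \<tau>)) \<in> ?T p \<tau> p"
        by (simp add: singular_chain_chain_map)
    next
      fix \<tau> assume "\<tau> \<in> order_simplices 0 Y"
      then obtain v where "\<Phi> 0 (frag_of \<tau>) = frag_of v" using carried_chain_mapD(3)[OF \<Phi>] by blast
      then show "\<exists>v. chain_map 0 f (\<Phi> 0 (frag_of \<tau>)) = frag_of v"
        by (intro exI[of _ "simplex_map 0 f v"]) simp
    next
      fix p c assume c: "c \<in> order_chains (Suc p) Y"
      show "chain_boundary (Suc p) (chain_map (Suc p) f (\<Phi> (Suc p) c)) = chain_map p f (\<Phi> p (chain_boundary (Suc p) c))"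
        using chain_boundary_chain_map[OF order_chains_singular[OF \<Phi>X[OF c]]] carried_chain_mapD(4)[OF \<Phi> c] by simp
    qed
    have 2: "carried_chain_map Y ?T (\<lambda>p c. c)"
      unfolding carried_chain_map_def
    proof (intro conjI allI ballI)
      fix p \<tau> assume \<tau>: "\<tau> \<in> order_simplices p Y"
      then have "frag_of \<tau> \<in> order_chains p (image_carrier Y id p \<tau>)"
        unfolding image_carrier_def by (intro order_simplex_in_order_chains) auto
      then show "frag_of \<tau> \<in> ?T p \<tau> p" using order_chains_singular by blast
    qed (auto simp: additive_on_def)
    have "\<exists>w\<in>{c. singular_chain (Suc p) Y c}. chain_boundary (Suc p) w = chain_map p f (\<Phi> p z) - z"
      by (rule carried_chain_maps_homologous[OF acyclic_carrier_image_singular[OF continuous_map_id] 1 2 _ _ z])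
        (auto simp: image_carrier_def singular_chain_subtopology)
    then show ?thesis by (auto simp: homologous_rel_def singular_boundary)
  qed
  moreover
  have "homologous_rel p X {} z 0"
    if z: "z \<in> order_chains p X" "chain_boundary p z = 0" and bd: "homologous_rel p Y {} (chain_map p f z) 0" for p z
  proof -
    obtain F where F: "carried_chain_map X (\<lambda>p \<sigma> q. order_chains q (image_carrier Y f p \<sigma>)) F"
      and Fh: "\<And>p c. c \<in> order_chains p X \<Longrightarrow> chain_boundary p c = 0 \<Longrightarrow> homologous_rel p Y {} (chain_map p f c) (F p c)"
      using simplicial_approximation[OF cont Y] by blast
    have FY: "F p c \<in> order_chains p Y" if "c \<in> order_chains p X" for p c
      using carried_image_order_chains[OF F[unfolded image_carrier_def] that] .
    have "homologous_rel p Y {} (F p z) 0"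
      using Fh[OF z] bd by (metis homologous_rel_sym homologous_rel_trans)
    then obtain w where w: "w \<in> order_chains (Suc p) Y" "chain_boundary (Suc p) w = F p z"
      using order_boundary_if_singular_boundary[OF order_chains_suffice_finite[OF Y] FY[OF z(1)]]
      by (auto simp: homologous_rel_def singular_boundary)
    have "chain_boundary (Suc p) (\<Phi> (Suc p) w) = \<Phi> p (F p z)"
      using carried_chain_mapD(4)[OF \<Phi> w(1)] w(2) by simp
    then have \<Phi>F0: "homologous_rel p X {} (\<Phi> p (F p z)) 0"
      using order_chains_singular[OF \<Phi>X[OF w(1)]] by (auto simp: homologous_rel_def singular_boundary)
    let ?T = "\<lambda>p \<sigma> q. order_chains q (fibre_carrier X f p (f \<circ> \<sigma>))"
    have 1: "carried_chain_map X ?T (\<lambda>p c. \<Phi> p (F p c))"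
      unfolding carried_chain_map_def
    proof (intro conjI allI ballI)
      show "additive_on UNIV (\<lambda>c. \<Phi> p (F p c))" for p
        using additive_onD(2)[OF diff_closed_UNIV carried_chain_mapD(1)[OF F]]
        by (simp add: additive_on_def add\<Phi>)
    next
      fix p \<sigma> assume "\<sigma> \<in> order_simplices p X"
      then have Fs: "F p (frag_of \<sigma>) \<in> order_chains p (image_carrier Y f p \<sigma>)" by (rule carried_chain_mapD(2)[OF F])
      show "\<Phi> p (F p (frag_of \<sigma>)) \<in> ?T p \<sigma> p"
      proof (rule additive_map_in[OF carried_chain_mapD(1)[OF \<Phi>]])
        fix \<tau> assume "\<tau> \<in> Poly_Mapping.keys (F p (frag_of \<sigma>))"
        then have \<tau>: "\<tau> \<in> order_simplices p Y" "\<tau> ` standard_simplex p \<subseteq> (f \<circ> \<sigma>) ` standard_simplex p"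
          using Fs unfolding order_chains_def frags_def image_carrier_def order_simplices_subtopology image_comp by blast+
        show "\<Phi> p (frag_of \<tau>) \<in> ?T p \<sigma> p"
          using carried_chain_mapD(2)[OF \<Phi> \<tau>(1)] \<tau>(2) unfolding fibre_carrier_def by (elim order_chains_mono) blast
      qed simp
    next
      fix \<sigma> assume \<sigma>: "\<sigma> \<in> order_simplices 0 X"
      then obtain v where v: "F 0 (frag_of \<sigma>) = frag_of v" using carried_chain_mapD(3)[OF F] by blast
      have "v \<in> order_simplices 0 Y" using FY[of "frag_of \<sigma>" 0] \<sigma> v by (simp add: order_chains_def)
      then show "\<exists>v. \<Phi> 0 (F 0 (frag_of \<sigma>)) = frag_of v" using carried_chain_mapD(3)[OF \<Phi>] v by simp
    next
      fix p c assume c: "c \<in> order_chains (Suc p) X"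
      show "chain_boundary (Suc p) (\<Phi> (Suc p) (F (Suc p) c)) = \<Phi> p (F p (chain_boundary (Suc p) c))"
        using carried_chain_mapD(4)[OF \<Phi> FY[OF c]] carried_chain_mapD(4)[OF F c] by simp
    qed
    have 2: "carried_chain_map X ?T (\<lambda>p c. c)"
      unfolding carried_chain_map_def
    proof (intro conjI allI ballI)
      fix p \<sigma> assume \<sigma>: "\<sigma> \<in> order_simplices p X"
      then obtain x where "strict_chain X p x" "\<sigma> = order_simplex p x" by (auto simp: order_simplices_def)
      then have "\<sigma> ` standard_simplex p \<subseteq> topspace X"
        unfolding strict_chain_def by (simp only: order_simplex_image) blast
      then show "frag_of \<sigma> \<in> ?T p \<sigma> p"
        unfolding fibre_carrier_def by (intro order_simplex_in_order_chains[OF \<sigma>]) auto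
    qed (auto simp: additive_on_def)
    have "\<exists>w\<in>order_chains (Suc p) X. chain_boundary (Suc p) w = \<Phi> p (F p z) - z"
      by (rule carried_chain_maps_homologous[OF acyclic_carrier_fibre_of_image[OF f X] 1 2 _ _ z])
        (auto simp: fibre_carrier_def intro: order_chains_subset)
    then have "homologous_rel p X {} (\<Phi> p (F p z)) z"
      by (auto simp: homologous_rel_def singular_boundary dest: order_chains_singular)
    then show ?thesis using \<Phi>F0 by (metis homologous_rel_sym homologous_rel_trans)
  qed
  ultimately show thesis using that \<Phi> by blast
qed

theorem vietoris_like_map_iso:
  assumes f: "vietoris_like_map X Y f" and X: "finite (topspace X)" "t0_space X"
    and Y: "finite (topspace Y)" "t0_space Y"
  shows "homology_map p X Y f \<in> iso (homology_group p X) (homology_group p Y)"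
proof (cases "p < 0")
  case True
  then have "carrier (homology_group p X) = {\<one>\<^bsub>homology_group p X\<^esub>}"
    "carrier (homology_group p Y) = {\<one>\<^bsub>homology_group p Y\<^esub>}"
    using trivial_relative_homology_group[of p X "{}"] trivial_relative_homology_group[of p Y "{}"]
    by (simp_all add: trivial_group_def)
  moreover have "homology_map p X Y f \<in> hom (homology_group p X) (homology_group p Y)" by (rule hom_induced_hom)
  ultimately show ?thesis
    using hom_one[OF hom_induced_hom group_relative_homology_group group_relative_homology_group]
    by (simp add: iso_def bij_betw_def)
next
  case False
  then obtain n where p: "p = int n" by (metis int_nat_eq not_less)
  have cont: "continuous_map X Y f" using f unfolding vietoris_like_map_def by (rule conjunct1)
  obtain \<Phi> where \<Phi>: "carried_chain_map Y (\<lambda>p \<tau> q. order_chains q (fibre_carrier X f p \<tau>)) \<Phi>"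
    and f\<Phi>: "\<And>p z. z \<in> order_chains p Y \<Longrightarrow> chain_boundary p z = 0 \<Longrightarrow> homologous_rel p Y {} (chain_map p f (\<Phi> p z)) z"
    and inj: "\<And>p z. z \<in> order_chains p X \<Longrightarrow> chain_boundary p z = 0 \<Longrightarrow>
      homologous_rel p Y {} (chain_map p f z) 0 \<Longrightarrow> homologous_rel p X {} z 0"
    using vietoris_transfer[OF f X Y] by blast
  let ?f = "homology_map (int n) X Y f"
  interpret group_hom "homology_group (int n) X" "homology_group (int n) Y" ?f
    by (intro group_hom.intro group_hom_axioms.intro) (simp_all add: hom_induced_hom)
  have "inj_on ?f (carrier (homology_group (int n) X))"
    unfolding inj_on_one_iff
  proof (intro allI impI)
    fix C assume C: "C \<in> carrier (homology_group (int n) X)" "?f C = \<one>\<^bsub>homology_group (int n) Y\<^esub>"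
    then obtain s where s: "singular_relcycle n X {} s" "C = homologous_rel_set n X {} s"
      by (auto simp: carrier_relative_homology_group)
    then obtain z where z: "z \<in> order_chains n X" "chain_boundary n z = 0" "homologous_rel n X {} s z"
      using order_cycle_representative[OF order_chains_suffice_finite[OF X]] by blast
    have Cz: "C = homologous_rel_set n X {} z" using s(2) z(3) homologous_rel_set_eq by blast
    have "?f C = homologous_rel_set n Y {} (chain_map n f z)"
      unfolding Cz using hom_induced_chain_map[OF cont _ order_cycle_singular_relcycle[OF z(1,2)], of "{}"] by simp
    then have "homologous_rel_set n Y {} (chain_map n f z) = singular_relboundary_set n Y {}"
      using C(2) by simp
    then have "homologous_rel n Y {} (chain_map n f z) 0"
      unfolding homologous_rel_set_eq_relboundary by (simp add: homologous_rel_def)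
    then have "homologous_rel n X {} z 0" using inj[OF z(1,2)] by blast
    then have "homologous_rel_set n X {} z = singular_relboundary_set n X {}"
      unfolding homologous_rel_set_eq_relboundary by (simp add: homologous_rel_def)
    then show "C = \<one>\<^bsub>homology_group (int n) X\<^esub>" by (simp add: Cz)
  qed
  moreover have "?f ` carrier (homology_group (int n) X) = carrier (homology_group (int n) Y)"
  proof
    show "?f ` carrier (homology_group (int n) X) \<subseteq> carrier (homology_group (int n) Y)"
      using hom_induced_carrier by blast
    show "carrier (homology_group (int n) Y) \<subseteq> ?f ` carrier (homology_group (int n) X)"
    proof
      fix C assume "C \<in> carrier (homology_group (int n) Y)"
      then obtain s where s: "singular_relcycle n Y {} s" "C = homologous_rel_set n Y {} s"
        by (auto simp: carrier_relative_homology_group)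
      then obtain z where z: "z \<in> order_chains n Y" "chain_boundary n z = 0" "homologous_rel n Y {} s z"
        using order_cycle_representative[OF order_chains_suffice_finite[OF Y]] by blast
      have cyc: "singular_relcycle n X {} (\<Phi> n z)"
        using carried_image_order_chains[OF \<Phi>[unfolded fibre_carrier_def] z(1)] carried_cycle[OF \<Phi> z(1,2)]
        by (rule order_cycle_singular_relcycle)
      have "?f (homologous_rel_set n X {} (\<Phi> n z)) = homologous_rel_set n Y {} (chain_map n f (\<Phi> n z))"
        using hom_induced_chain_map[OF cont _ cyc, of "{}"] by simp
      also have "\<dots> = C"
        unfolding s(2) homologous_rel_set_eq
        using f\<Phi>[OF z(1,2)] z(3) by (metis homologous_rel_sym homologous_rel_trans)
      finally show "C \<in> ?f ` carrier (homology_group (int n) X)"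
        using cyc by (force simp: carrier_relative_homology_group)
    qed
  qed
  ultimately show ?thesis by (simp add: p iso_def bij_betw_def hom_induced_hom)
qed

section \<open>Coincidences and traces\<close>

text \<open>
  Take the largest \<open>m\<close> with \<open>g (x m) \<le> f (x m)\<close>; the index \<open>0\<close> qualifies, because \<open>f (x 0)\<close> is one of the values of
  \<open>g\<close> on the chain, and \<open>g (x 0)\<close> is the least of them. If \<open>m < n\<close>, then \<open>f (x (m + 1)) = g (x j)\<close> with \<open>j \<le> m\<close>, for
  otherwise \<open>m + 1\<close> would qualify. Hence \<open>f (x m) \<le> f (x (m + 1)) = g (x j) \<le> g (x m)\<close>, and equality holds.
  If \<open>m = n\<close>, then \<open>f (x n)\<close> is at most \<open>g (x n)\<close>, the greatest value of \<open>g\<close>.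
\<close>

lemma coincidence_on_chain:
  fixes x :: "nat \<Rightarrow> 'a"
  assumes T0: "t0_space Y" and fg: "continuous_map X Y f" "continuous_map X Y g"
    and x: "\<And>i j. i \<le> j \<Longrightarrow> j \<le> n \<Longrightarrow> space_le X (x i) (x j)"
    and sub: "\<And>i. i \<le> n \<Longrightarrow> f (x i) \<in> g ` x ` {..n}"
  shows "\<exists>i\<le>n. f (x i) = g (x i)"
proof -
  note f = space_le_continuous_map[OF fg(1) x] and g = space_le_continuous_map[OF fg(2) x]
  define S where "S = {i. i \<le> n \<and> space_le Y (g (x i)) (f (x i))}"
  have "0 \<in> S"
  proof -
    obtain j where "j \<le> n" "f (x 0) = g (x j)" using sub[of 0] by auto
    then show ?thesis using g[of 0 j] by (simp add: S_def)
  qed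
  moreover have "finite S" by (simp add: S_def)
  ultimately have m: "Max S \<in> S" "\<And>i. i \<in> S \<Longrightarrow> i \<le> Max S" by (auto intro: Max_in)
  define m where "m = Max S"
  have mS: "m \<le> n" "space_le Y (g (x m)) (f (x m))" using m(1) by (auto simp: S_def m_def)
  have "f (x m) = g (x m)"
  proof (cases "m = n")
    case True
    obtain j where "j \<le> n" "f (x n) = g (x j)" using sub[of n] by auto
    then have "space_le Y (f (x m)) (g (x m))" using g[of j n] True by simp
    then show ?thesis using mS(2) by (rule space_le_antisym[OF T0])
  next
    case False
    then have m': "Suc m \<le> n" using mS(1) by simp
    obtain j where j: "j \<le> n" "f (x (Suc m)) = g (x j)" using sub[OF m'] by auto
    have "Suc m \<notin> S" using m(2)[of "Suc m"] by (auto simp: m_def)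
    then have "\<not> space_le Y (g (x (Suc m))) (g (x j))" using m' j(2) by (simp add: S_def)
    then have "j \<le> m" using g[of "Suc m" j] j(1) by (cases "j \<le> m") auto
    then have "space_le Y (g (x j)) (g (x m))" using mS(1) by (rule g)
    moreover have "space_le Y (f (x m)) (g (x j))" using f[of m "Suc m"] m' j(2) by simp
    ultimately have "space_le Y (f (x m)) (g (x m))" by (rule space_le_trans[rotated])
    then show ?thesis using mS(2) by (rule space_le_antisym[OF T0])
  qed
  then show ?thesis using mS(1) by blast
qed

text \<open>
  A simplex \<open>\<tau>\<close> of \<open>\<Phi> \<sigma>\<close> has \<open>f(\<tau>) \<subseteq> \<sigma>\<close>, and if \<open>\<sigma>\<close> occurs in \<open>G \<tau>\<close>, then \<open>\<sigma> \<subseteq> g(\<tau>)\<close>.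
\<close>

lemma diagonal_entry_imp_coincidence:
  assumes T0: "t0_space Y" and fg: "continuous_map X Y f" "continuous_map X Y g"
    and \<Phi>: "carried_chain_map Y (\<lambda>p \<tau> q. order_chains q (fibre_carrier X f p \<tau>)) \<Phi>"
    and G: "carried_chain_map X (\<lambda>p \<sigma> q. order_chains q (image_carrier Y g p \<sigma>)) G"
    and \<sigma>: "\<sigma> \<in> order_simplices n Y" and ne: "Poly_Mapping.lookup (G n (\<Phi> n (frag_of \<sigma>))) \<sigma> \<noteq> 0"
  shows "\<exists>x\<in>topspace X. f x = g x"
proof -
  let ?c = "\<Phi> n (frag_of \<sigma>)"
  have "\<exists>\<tau>\<in>Poly_Mapping.keys ?c. Poly_Mapping.lookup (G n (frag_of \<tau>)) \<sigma> \<noteq> 0"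
  proof (rule ccontr)
    assume none: "\<not> ?thesis"
    have "diff_closed {d. Poly_Mapping.lookup d \<sigma> = (0 :: int)}"
      by (simp add: diff_closed_def lookup_minus)
    moreover have "G n (frag_of \<tau>) \<in> {d. Poly_Mapping.lookup d \<sigma> = 0}" if "\<tau> \<in> Poly_Mapping.keys ?c" for \<tau>
      using none that by simp
    ultimately have "G n ?c \<in> {d. Poly_Mapping.lookup d \<sigma> = 0}"
      by (rule additive_map_in[OF carried_chain_mapD(1)[OF G]])
    then show False using ne by simp
  qed
  then obtain \<tau> where \<tau>: "\<tau> \<in> Poly_Mapping.keys ?c" "\<sigma> \<in> Poly_Mapping.keys (G n (frag_of \<tau>))"
    unfolding in_keys_iff by blast
  have "?c \<in> order_chains n (fibre_carrier X f n \<sigma>)" using carried_chain_mapD(2)[OF \<Phi> \<sigma>] .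
  then have \<tau>2: "\<tau> \<in> order_simplices n X" "\<tau> ` standard_simplex n \<subseteq> {x \<in> topspace X. f x \<in> \<sigma> ` standard_simplex n}"
    using \<tau>(1) unfolding order_chains_def frags_def fibre_carrier_def order_simplices_subtopology by blast+
  have "\<sigma> ` standard_simplex n \<subseteq> g ` \<tau> ` standard_simplex n"
    using carried_chain_mapD(2)[OF G \<tau>2(1)] \<tau>(2)
    unfolding order_chains_def frags_def image_carrier_def order_simplices_subtopology by blast
  moreover obtain x where x: "strict_chain X n x" "\<tau> = order_simplex n x"
    using \<tau>2(1) by (auto simp: order_simplices_def)
  ultimately have sub: "f (x i) \<in> g ` x ` {..n}" if "i \<le> n" for i
    using \<tau>2(2) that unfolding x(2) order_simplex_image by blast
  have "\<exists>i\<le>n. f (x i) = g (x i)"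
    by (rule coincidence_on_chain[OF T0 fg strict_chain_le[OF x(1)] sub])
  then show ?thesis using x(1) unfolding strict_chain_def by blast
qed

lemma mult_homologous_rel_set:
  assumes "singular_relcycle n Y {} a" "singular_relcycle n Y {} b"
  shows "homologous_rel_set n Y {} a \<otimes>\<^bsub>homology_group (int n) Y\<^esub> homologous_rel_set n Y {} b =
    homologous_rel_set n Y {} (a + b)"
proof -
  interpret normal "singular_relboundary_set n Y {}" "relcycle_group n Y {}"
    by (rule normal_subgroup_singular_relboundary_relcycle)
  have "r_coset (relcycle_group n Y {}) (singular_relboundary_set n Y {}) c = homologous_rel_set n Y {} c" for c
    by (simp add: right_coset_singular_relboundary)
  then show ?thesis
    using rcos_sum[of a b] assms by (simp add: nontrivial_relative_homology_group FactGroup_def)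
qed

lemma pow_homologous_rel_set:
  assumes "singular_relcycle n Y {} a"
  shows "homologous_rel_set n Y {} a [^]\<^bsub>homology_group (int n) Y\<^esub> (k :: nat) =
    homologous_rel_set n Y {} (frag_cmul (int k) a)"
proof (induction k)
  case 0
  have "homologous_rel_set n Y {} 0 = singular_relboundary_set n Y {}"
    unfolding homologous_rel_set_eq_relboundary by simp
  then show ?case by simp
next
  case (Suc k)
  then show ?case
    using mult_homologous_rel_set[OF singular_relcycle_cmul[OF assms, of "int k"] assms]
    by (simp add: frag_cmul_distrib add.commute)
qed

abbreviation order_cycles :: "nat \<Rightarrow> 'a topology \<Rightarrow> 'a chain set" where
  "order_cycles n Y \<equiv> {c \<in> frags (order_simplices n Y). chain_boundary n c = 0}"

abbreviation order_boundaries :: "nat \<Rightarrow> 'a topology \<Rightarrow> 'a chain set" where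
  "order_boundaries n Y \<equiv> chain_boundary (Suc n) ` frags (order_simplices (Suc n) Y)"

lemma diff_closed_order_cycles: "diff_closed (order_cycles n Y)"
  using diff_closedD[OF diff_closed_frags] by (auto simp: diff_closed_def chain_boundary_diff)

lemma order_boundary_if_homologous:
  assumes suff: "order_chains_suffice Y" and z: "z \<in> order_cycles n Y" "homologous_rel n Y {} z 0"
  shows "z \<in> order_boundaries n Y"
proof -
  obtain w where "singular_chain (Suc n) Y w" "chain_boundary (Suc n) w = z"
    using z(2) by (auto simp: homologous_rel_def singular_boundary)
  moreover have "z \<in> order_chains n Y" using z(1) by (simp add: order_chains_def)
  ultimately obtain w where "w \<in> order_chains (Suc n) Y" "chain_boundary (Suc n) w = z"
    using order_boundary_if_singular_boundary[OF suff] by blast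
  then show ?thesis by (auto simp: order_chains_def)
qed

text \<open>
  The comparison theorem turns a homology basis of the order complex into dual bases for singular homology
  modulo torsion: every class has an order cycle as representative, and two such representatives differ by the
  boundary of an order chain, so the functionals are well defined on classes.
\<close>

lemma homology_group_trace:
  assumes suff: "order_chains_suffice Y"
    and basis: "homology_basis (order_cycles n Y) (order_boundaries n Y) r z l"
    and \<phi>: "\<phi> \<in> hom (homology_group (int n) Y) (homology_group (int n) Y)"
    and \<psi>: "\<And>c. c \<in> order_cycles n Y \<Longrightarrow> \<psi> c \<in> order_cycles n Y"
      "\<And>c. c \<in> order_cycles n Y \<Longrightarrow> \<phi> (homologous_rel_set n Y {} c) = homologous_rel_set n Y {} (\<psi> c)"
  shows "group_trace (homology_group (int n) Y) \<phi> = (\<Sum>i<r. l i (\<psi> (z i)))"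
proof -
  let ?H = "homology_group (int n) Y" and ?cls = "homologous_rel_set n Y {}"
  let ?Z = "order_cycles n Y"
  note Zd = diff_closed_order_cycles[of n Y]
  have basis': "\<And>i. i < r \<Longrightarrow> z i \<in> ?Z" "\<And>i. i < r \<Longrightarrow> additive_on ?Z (l i)"
    "\<And>i b. i < r \<Longrightarrow> b \<in> order_boundaries n Y \<Longrightarrow> l i b = 0"
    "\<And>i j. i < r \<Longrightarrow> j < r \<Longrightarrow> l i (z j) = (if i = j then 1 else 0)"
    "\<And>c. c \<in> ?Z \<Longrightarrow> \<forall>i<r. l i c = 0 \<Longrightarrow> \<exists>m. m \<noteq> 0 \<and> frag_cmul m c \<in> order_boundaries n Y"
    using basis unfolding homology_basis_def by blast+
  have cyc: "singular_relcycle n Y {} c" if "c \<in> ?Z" for c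
    using that order_cycle_singular_relcycle[of c n Y] by (simp add: order_chains_def)
  have cls: "?cls c \<in> carrier ?H" if "c \<in> ?Z" for c
    using cyc[OF that] by (auto simp: carrier_relative_homology_group)
  have rep: "\<exists>c. c \<in> ?Z \<and> C = ?cls c" if C: "C \<in> carrier ?H" for C
  proof -
    obtain s where s: "singular_relcycle n Y {} s" "C = ?cls s"
      using C by (auto simp: carrier_relative_homology_group)
    obtain c where c: "c \<in> order_chains n Y" "chain_boundary n c = 0" "homologous_rel n Y {} s c"
      using order_cycle_representative[OF suff s(1)] .
    then show ?thesis using s(2) homologous_rel_set_eq[of n Y "{}" s c]
      by (intro exI[of _ c]) (simp add: order_chains_def)
  qed
  define R where "R C = (SOME c. c \<in> ?Z \<and> C = ?cls c)" for C
  have R: "R C \<in> ?Z" "C = ?cls (R C)" if "C \<in> carrier ?H" for C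
    using someI_ex[OF rep[OF that]] by (simp_all add: R_def)
  have l_cls: "l i (R (?cls c)) = l i c" if i: "i < r" and c: "c \<in> ?Z" for i c
  proof -
    note RZ = R(1)[OF cls[OF c]]
    have "homologous_rel n Y {} c (R (?cls c))"
      using R(2)[OF cls[OF c]] homologous_rel_set_eq by blast
    then have "homologous_rel n Y {} (c - R (?cls c)) 0" by (simp add: homologous_rel_def)
    then have "c - R (?cls c) \<in> order_boundaries n Y"
      by (rule order_boundary_if_homologous[OF suff diff_closedD(2)[OF Zd c RZ]])
    then show ?thesis using basis'(3)[OF i] additive_onD(2)[OF Zd basis'(2)[OF i] c RZ] by simp
  qed
  have "group_trace ?H \<phi> = (\<Sum>i<r. l i (R (\<phi> (?cls (z i)))))"
  proof (rule group_trace_dual_bases[OF abelian_homology_group \<phi>])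
    show "?cls (z i) \<in> carrier ?H" if "i < r" for i by (rule cls[OF basis'(1)[OF that]])
    show "l i (R (?cls (z j))) = (if i = j then 1 else 0)" if "i < r" "j < r" for i j
      using l_cls[OF that(1) basis'(1)[OF that(2)]] basis'(4)[OF that] by simp
  next
    fix i C D assume i: "i < r" and CD: "C \<in> carrier ?H" "D \<in> carrier ?H"
    have "C \<otimes>\<^bsub>?H\<^esub> D = ?cls (R C + R D)"
      using mult_homologous_rel_set[OF cyc[OF R(1)[OF CD(1)]] cyc[OF R(1)[OF CD(2)]]] R(2)[OF CD(1)] R(2)[OF CD(2)]
      by simp
    then show "l i (R (C \<otimes>\<^bsub>?H\<^esub> D)) = l i (R C) + l i (R D)"
      using l_cls[OF i diff_closedD(4)[OF Zd R(1)[OF CD(1)] R(1)[OF CD(2)]]]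
        additive_onD(4)[OF Zd basis'(2)[OF i] R(1)[OF CD(1)] R(1)[OF CD(2)]] by simp
  next
    fix C assume C: "C \<in> carrier ?H" "\<forall>i<r. l i (R C) = 0"
    obtain m where m: "m \<noteq> 0" "frag_cmul m (R C) \<in> order_boundaries n Y"
      using basis'(5)[OF R(1)[OF C(1)] C(2)] by blast
    then obtain w where w: "w \<in> frags (order_simplices (Suc n) Y)" "chain_boundary (Suc n) w = frag_cmul m (R C)"
      by auto
    (* Torsion is defined by powers with natural exponents, so the sign of m is moved to the bounding chain. *)
    let ?w = "frag_cmul (sgn m) w"
    have "singular_chain (Suc n) Y ?w"
      using w(1) by (intro singular_chain_cmul order_chains_singular) (simp add: order_chains_def)
    moreover have "chain_boundary (Suc n) ?w = frag_cmul (int (nat \<bar>m\<bar>)) (R C)"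
    proof -
      have "sgn m * m = int (nat \<bar>m\<bar>)" by (simp add: sgn_if)
      then show ?thesis using w(2) by (simp only: chain_boundary_cmul frag_cmul_cmul)
    qed
    ultimately have "?cls (frag_cmul (int (nat \<bar>m\<bar>)) (R C)) = singular_relboundary_set n Y {}"
      unfolding homologous_rel_set_eq_relboundary singular_boundary by blast
    then have "C [^]\<^bsub>?H\<^esub> (nat \<bar>m\<bar>) = \<one>\<^bsub>?H\<^esub>"
      using pow_homologous_rel_set[OF cyc[OF R(1)[OF C(1)]], of "nat \<bar>m\<bar>"] R(2)[OF C(1)] by simp
    then show "C \<in> torsion_set ?H"
      using C(1) m(1) unfolding torsion_set_def by (auto intro!: exI[of _ "nat \<bar>m\<bar>"])
  qed
  also have "\<dots> = (\<Sum>i<r. l i (\<psi> (z i)))"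
  proof (intro sum.cong refl)
    fix i assume "i \<in> {..<r}"
    then have i: "i < r" by simp
    show "l i (R (\<phi> (?cls (z i)))) = l i (\<psi> (z i))"
      using \<psi>(2)[OF basis'(1)[OF i]] l_cls[OF i \<psi>(1)[OF basis'(1)[OF i]]] by (simp only:)
  qed
  finally show ?thesis .
qed

lemma chain_boundary_0_dimension: "chain_boundary 0 c = 0"
  by (simp add: chain_boundary_def)

text \<open>
  Above the height of \<open>Y\<close> there are no order simplices. So the sum defining the Lefschetz number is finite, and the
  telescoping of the Hopf trace formula leaves no term at the upper end.
\<close>

lemma lefschetz_number_eq_trace:
  assumes Y: "finite (topspace Y)" "t0_space Y"
    and \<psi>: "\<And>n. additive_on UNIV (\<psi> n)" "\<And>n c. c \<in> order_chains n Y \<Longrightarrow> \<psi> n c \<in> order_chains n Y"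
      "\<And>n c. c \<in> order_chains (Suc n) Y \<Longrightarrow> chain_boundary (Suc n) (\<psi> (Suc n) c) = \<psi> n (chain_boundary (Suc n) c)"
    and \<phi>: "\<And>n. \<phi> (int n) \<in> hom (homology_group (int n) Y) (homology_group (int n) Y)"
      "\<And>n c. c \<in> order_chains n Y \<Longrightarrow> chain_boundary n c = 0 \<Longrightarrow>
        \<phi> (int n) (homologous_rel_set n Y {} c) = homologous_rel_set n Y {} (\<psi> n c)"
  shows "lefschetz_number Y \<phi> = (\<Sum>n\<le>card (topspace Y). (-1) ^ n * matrix_trace (order_simplices n Y) (\<psi> n))"
proof -
  let ?K = "\<lambda>n. order_simplices n Y" and ?M = "card (topspace Y)"
  note suff = order_chains_suffice_finite[OF Y]
  have add: "additive_on S (chain_boundary n)" for S :: "'a chain set" and n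
    by (simp add: additive_on_def chain_boundary_diff)
  have bd: "chain_boundary (Suc n) c \<in> frags (?K n)" "chain_boundary n (chain_boundary (Suc n) c) = 0"
    if "c \<in> frags (?K (Suc n))" for n c
    using chain_boundary_order_chains[of c n Y] chain_boundary_boundary_alt[OF order_chains_singular, of c n Y] that
    by (simp_all add: order_chains_def)
  have "\<forall>n. \<exists>r z l. homology_basis (order_cycles n Y) (order_boundaries n Y) r z l"
    by (intro allI homology_basis_exists[OF finite_order_simplices[OF Y(1)] finite_order_simplices[OF Y(1)] add])
      (use bd diff_closed_order_cycles in auto)
  then obtain r z l where "\<forall>n. homology_basis (order_cycles n Y) (order_boundaries n Y) (r n) (z n) (l n)"
    unfolding choice_iff by blast
  then have basis: "homology_basis (order_cycles n Y) (order_boundaries n Y) (r n) (z n) (l n)" for n ..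
  have \<psi>Z: "\<psi> n c \<in> order_cycles n Y" if c: "c \<in> order_cycles n Y" for n c
  proof -
    have "chain_boundary n (\<psi> n c) = 0"
    proof (cases n)
      case (Suc m)
      then show ?thesis
        using \<psi>(3)[of c m] c additive_onD(1)[OF diff_closed_UNIV \<psi>(1)] by (simp add: order_chains_def)
    qed (simp add: chain_boundary_0_dimension)
    then show ?thesis using c \<psi>(2)[of c n] by (simp add: order_chains_def)
  qed
  have gt: "group_trace (homology_group (int n) Y) (\<phi> (int n)) = (\<Sum>i<r n. l n i (\<psi> n (z n i)))" for n
    by (rule homology_group_trace[OF suff basis \<phi>(1) \<psi>Z]) (simp_all add: \<phi>(2) order_chains_def)
  have high: "(\<Sum>i<r n. l n i (\<psi> n (z n i))) = 0" if "?M \<le> n" for n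
  proof (intro sum.neutral ballI)
    fix i assume "i \<in> {..<r n}"
    then have i: "z n i \<in> order_cycles n Y" "additive_on (order_cycles n Y) (l n i)"
      using basis[of n] unfolding homology_basis_def by simp_all
    have "\<psi> n (z n i) = 0"
      using \<psi>Z[OF i(1)] order_simplices_high_dimension[OF Y(1) that] by (simp add: frags_def)
    then show "l n i (\<psi> n (z n i)) = 0" using additive_onD(1)[OF diff_closed_order_cycles i(2)] by simp
  qed
  have "lefschetz_number Y \<phi> = Sum_any (\<lambda>n::nat. (-1) ^ n * (\<Sum>i<r n. l n i (\<psi> n (z n i))))"
    by (simp add: lefschetz_number_def gt)
  also have "\<dots> = (\<Sum>n\<le>?M. (-1) ^ n * (\<Sum>i<r n. l n i (\<psi> n (z n i))))"
  proof (rule Sum_any.expand_superset)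
    show "{n. (-1) ^ n * (\<Sum>i<r n. l n i (\<psi> n (z n i))) \<noteq> 0} \<subseteq> {..?M}"
      using high by (auto simp: not_le intro: ccontr)
  qed simp
  also have "\<dots> = (\<Sum>n\<le>?M. (-1) ^ n * matrix_trace (?K n) (\<psi> n))"
  proof (rule Hopf_trace_formula[OF finite_order_simplices[OF Y(1)] _ add _ bd(2) chain_boundary_0_dimension \<psi>(1) _ _ basis])
    show "order_simplices (Suc ?M) Y = {}" by (rule order_simplices_high_dimension[OF Y(1)]) simp
    show "chain_boundary (Suc n) \<in> frags (?K (Suc n)) \<rightarrow> frags (?K n)" for n using bd(1) by blast
    show "\<psi> n \<in> frags (?K n) \<rightarrow> frags (?K n)" for n using \<psi>(2)[of _ n] by (simp add: order_chains_def)
    show "chain_boundary (Suc n) (\<psi> (Suc n) c) = \<psi> n (chain_boundary (Suc n) c)"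
      if "c \<in> frags (?K (Suc n))" for n c
      using \<psi>(3)[of c n] that by (simp add: order_chains_def)
  qed
  finally show ?thesis .
qed

theorem theorem1:
  fixes X :: "'a topology" and Y :: "'b topology" and f g :: "'a \<Rightarrow> 'b"
  assumes "finite (topspace X)" "t0_space X"
    and "finite (topspace Y)" "t0_space Y"
    and "continuous_map X Y f" "continuous_map X Y g"
    and "vietoris_like_map X Y f"
  shows "(\<forall>p. homology_map p X Y f \<in> iso (homology_group p X) (homology_group p Y)) \<and>
    (lefschetz_number Y
       (\<lambda>p. homology_map p X Y g \<circ> inv_into (carrier (homology_group p X)) (homology_map p X Y f)) \<noteq> 0
     \<longrightarrow> (\<exists>x\<in>topspace X. f x = g x))"
proof (intro conjI allI impI)
  note X = assms(1,2) and Y = assms(3,4) and cont = assms(5,6) and f = assms(7)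
  show iso: "homology_map p X Y f \<in> iso (homology_group p X) (homology_group p Y)" for p
    by (rule vietoris_like_map_iso[OF f X Y])
  let ?\<phi> = "\<lambda>p. homology_map p X Y g \<circ> inv_into (carrier (homology_group p X)) (homology_map p X Y f)"
  assume nonzero: "lefschetz_number Y ?\<phi> \<noteq> 0"
  obtain \<Phi> where \<Phi>: "carried_chain_map Y (\<lambda>p \<tau> q. order_chains q (fibre_carrier X f p \<tau>)) \<Phi>"
    and f\<Phi>: "\<And>p z. z \<in> order_chains p Y \<Longrightarrow> chain_boundary p z = 0 \<Longrightarrow> homologous_rel p Y {} (chain_map p f (\<Phi> p z)) z"
    by (rule vietoris_transfer[OF f X Y]) (rule that)
  obtain G where G: "carried_chain_map X (\<lambda>p \<sigma> q. order_chains q (image_carrier Y g p \<sigma>)) G"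
    and gG: "\<And>p c. c \<in> order_chains p X \<Longrightarrow> chain_boundary p c = 0 \<Longrightarrow> homologous_rel p Y {} (chain_map p g c) (G p c)"
    by (rule simplicial_approximation[OF cont(2) Y]) (rule that)
  have \<Phi>X: "\<Phi> p c \<in> order_chains p X" if "c \<in> order_chains p Y" for p c
    using carried_image_order_chains[OF \<Phi>[unfolded fibre_carrier_def] that] .
  have GY: "G p c \<in> order_chains p Y" if "c \<in> order_chains p X" for p c
    using carried_image_order_chains[OF G[unfolded image_carrier_def] that] .
  have "lefschetz_number Y ?\<phi> =
      (\<Sum>n\<le>card (topspace Y). (-1) ^ n * matrix_trace (order_simplices n Y) (\<lambda>c. G n (\<Phi> n c)))"
  proof (rule lefschetz_number_eq_trace[OF Y])
    fix n
    show "additive_on UNIV (\<lambda>c. G n (\<Phi> n c))"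
      by (rule additive_on_compose[OF carried_chain_mapD(1)[OF \<Phi>] carried_chain_mapD(1)[OF G]]) simp
    have "inv_into (carrier (homology_group (int n) X)) (homology_map (int n) X Y f)
        \<in> hom (homology_group (int n) Y) (homology_group (int n) X)"
      using group.iso_set_sym[OF group_relative_homology_group iso] by (simp add: iso_def)
    then show "?\<phi> (int n) \<in> hom (homology_group (int n) Y) (homology_group (int n) Y)"
      by (rule hom_compose) (rule hom_induced_hom)
  next
    fix n c assume c: "c \<in> order_chains n Y" "chain_boundary n c = 0"
    let ?X = "homologous_rel_set n X {}" and ?Y = "homologous_rel_set n Y {}"
    have \<Phi>c: "\<Phi> n c \<in> order_chains n X" "chain_boundary n (\<Phi> n c) = 0"
      using \<Phi>X[OF c(1)] carried_cycle[OF \<Phi> c] by auto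
    note cyc = order_cycle_singular_relcycle[OF \<Phi>c]
    have "homology_map (int n) X Y f (?X (\<Phi> n c)) = ?Y (chain_map n f (\<Phi> n c))"
      using hom_induced_chain_map[OF cont(1) _ cyc, of "{}"] by simp
    also have "\<dots> = ?Y c" using f\<Phi>[OF c] by (simp only: homologous_rel_set_eq)
    finally have "homology_map (int n) X Y f (?X (\<Phi> n c)) = ?Y c" .
    moreover have "inj_on (homology_map (int n) X Y f) (carrier (homology_group (int n) X))"
      using iso[of "int n"] by (simp add: iso_def bij_betw_def)
    moreover have "?X (\<Phi> n c) \<in> carrier (homology_group (int n) X)"
      using cyc by (auto simp: carrier_relative_homology_group)
    ultimately have "inv_into (carrier (homology_group (int n) X)) (homology_map (int n) X Y f) (?Y c) = ?X (\<Phi> n c)"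
      by (intro inv_into_f_eq)
    moreover have "homology_map (int n) X Y g (?X (\<Phi> n c)) = ?Y (chain_map n g (\<Phi> n c))"
      using hom_induced_chain_map[OF cont(2) _ cyc, of "{}"] by simp
    moreover have "\<dots> = ?Y (G n (\<Phi> n c))" using gG[OF \<Phi>c] by (simp only: homologous_rel_set_eq)
    ultimately show "?\<phi> (int n) (?Y c) = ?Y (G n (\<Phi> n c))" by simp
  qed (use \<Phi>X GY carried_chain_mapD(4)[OF \<Phi>] carried_chain_mapD(4)[OF G] in simp_all)
  then have "(\<Sum>n\<le>card (topspace Y). (-1) ^ n * matrix_trace (order_simplices n Y) (\<lambda>c. G n (\<Phi> n c))) \<noteq> 0"
    using nonzero by (simp only: not_False_eq_True)
  then obtain n where "(-1) ^ n * matrix_trace (order_simplices n Y) (\<lambda>c. G n (\<Phi> n c)) \<noteq> 0"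
    by (rule sum.not_neutral_contains_not_neutral)
  then have "matrix_trace (order_simplices n Y) (\<lambda>c. G n (\<Phi> n c)) \<noteq> 0" by simp
  then obtain \<sigma> where "\<sigma> \<in> order_simplices n Y" "Poly_Mapping.lookup (G n (\<Phi> n (frag_of \<sigma>))) \<sigma> \<noteq> 0"
    unfolding matrix_trace_def by (rule sum.not_neutral_contains_not_neutral)
  then show "\<exists>x\<in>topspace X. f x = g x"
    by (rule diagonal_entry_imp_coincidence[OF Y(2) cont \<Phi> G])
qed

end
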